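(* Let $J>1$, $\beta>0$ with $\beta J>1$, and let $c\ge 0$ be a fixed constant. Let $(X_n)$ be a sequence of (possibly random, defined on a common probability space) real symmetric $n\times n$ matrices with eigenvalues $\lambda_1\ge\lambda_2\ge\dots\ge\lambda_n$ (depending on $n$) such that $\lambda_1=J+\frac1J$, $\lambda_2=\lambda_1-\frac{c}{n}$, the empirical measure of $\lambda_2\ge\dots\ge\lambda_n$ converges weakly almost surely to the semicircular law $\mu_{\mathrm{sc}}$, and the rigidity condition given in the context holds almost surely. Given $X_n$, let $\underline\sigma^{(1)},\underline\sigma^{(2)}$ be two independent samples from the Gibbs measure $\mu_{n,\beta}^{\mathrm{Gibbs}}$, and let $\mathrm{Ov}(\underline\sigma^{(1)},\underline\sigma^{(2)})=\sum_{i=1}^n\sigma^{(1)}_i\sigma^{(2)}_i$. Put $\hat r_0=1-\frac{1}{\beta J}$. Then, for almost every realization of $(X_n)$, as $n\to\infty$, $$\mathrm{Ov}(\underline\sigma^{(1)},\underline\sigma^{(2)})\ \stackrel{d}{\to}\ \sqrt{s_1s_2}\,\zeta_1+\sqrt{(\hat r_0-s_1)(\hat r_0-s_2)}\,\zeta_2,$$ where $\zeta_1,\zeta_2$ are i.i.d. Rademacher random variables (values $\pm1$ with probability $\frac12$ each), $s_1,s_2$ are i.i.d. random variables, independent of $(\zeta_1,\zeta_2)$, with density $f_s$ satisfying $$f_s(x)\propto\frac{1}{\sqrt{x(\hat r_0-x)}}\exp\left\{-\frac{c\beta}{2}x\right\}\quad\text{for }0\le x\le\hat r_0,\qquad f_s(x)=0\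 \text{otherwise.}$$
   Context: $\mathbb{S}_{n-1}=\{\underline{\sigma}\in\mathbb{R}^n:\|\underline{\sigma}\|^2=1\}$ is the unit sphere and $\mu_n$ is the uniform probability measure on it. The Hamiltonian is $H_n(\underline{\sigma})=\frac n2\,\underline{\sigma}'X_n\underline{\sigma}$ for $\underline\sigma\in\mathbb{S}_{n-1}$. The partition function at inverse temperature $\beta>0$ is $Z_n(\beta)=\int_{\mathbb{S}_{n-1}}\exp\{\beta H_n(\underline\sigma)\}\,d\mu_n(\underline\sigma)$. The Gibbs measure $\mu_{n,\beta}^{\mathrm{Gibbs}}$ is the probability measure on $\mathbb{S}_{n-1}$ given by $d\mu_{n,\beta}^{\mathrm{Gibbs}}(\underline\sigma)=\frac{\exp\{\beta H_n(\underline\sigma)\}}{Z_n(\beta)}\,d\mu_n(\underline\sigma)$. The semicircular law $\mu_{\mathrm{sc}}$ is the probability measure on $[-2,2]$ with density $\frac{1}{2\pi}\sqrt{4-x^2}$. Rigidity condition: for an integer $K\ge1$ let $2=\tilde\lambda_1\ge\tilde\lambda_2\ge\dots\ge\tilde\lambda_{K+1}=-2$ be such that $\int_{\tilde\lambda_{j+1}}^{\tilde\lambda_j}d\mu_{\mathrm{sc}}=\frac1K$ for $1\le j\le K$. The condition is: for every $\varepsilon>0$ there is $K_0$ such that for every $K\ge K_0$ and all sufficiently large $n$ (depending on $K$ and on the realization), $$\sup_{1\le i\le K}\ \sup_{\frac{(i-1)(n-2)}{K}+3\le j\le\frac{i(n-2)}{K}+2}|\lambda_j-\tilde\lambda_i|\le\varepsilon,$$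 where $j$ ranges over integers. *)

theory Defs
  imports "HOL-Probability.Probability" "Jordan_Normal_Form.Char_Poly"
begin

text \<open>
  Since the dimension \<open>n\<close> varies, \<open>\<real>\<^sup>n\<close> is the product space over the index set \<open>{..<n}\<close>, whose
  points are extensional functions; coordinates are numbered from 0. Measures on the unit sphere
  are measures on this space that are concentrated on the sphere.
\<close>

abbreviation Rn :: "nat \<Rightarrow> (nat \<Rightarrow> real) measure" where
  "Rn n \<equiv> Pi\<^sub>M {..<n} (\<lambda>_. lborel)"

definition norm_n :: "nat \<Rightarrow> (nat \<Rightarrow> real) \<Rightarrow> real" where
  "norm_n n x = sqrt (\<Sum>i<n. (x i)\<^sup>2)"

definition sphere_n :: "nat \<Rightarrow> (nat \<Rightarrow> real) set" where
  "sphere_n n = {x \<in> space (Rn n). norm_n n x = 1}"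

text \<open>
  The uniform probability measure on the sphere is the normalised cone measure: the image of the
  uniform distribution on the unit ball under the radial projection \<open>x \<mapsto> x / \<parallel>x\<parallel>\<close>. For \<open>n \<ge> 1\<close> the
  projection is undefined only at the origin, which is a null set.
\<close>

definition uniform_sphere :: "nat \<Rightarrow> (nat \<Rightarrow> real) measure" where
  "uniform_sphere n =
     distr (uniform_measure (Rn n) {x \<in> space (Rn n). norm_n n x \<le> 1}) (Rn n)
       (\<lambda>x. \<lambda>i\<in>{..<n}. x i / norm_n n x)"

lemma measurable_norm_n[measurable]: "norm_n n \<in> borel_measurable (Rn n)"
  unfolding norm_n_def by measurable

lemma emeasure_unit_ball_n:
  "emeasure (Rn n) {x \<in> space (Rn n). norm_n n x \<le> 1} = ennreal (unit_ball_vol (real n))"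
proof -
  have "{x \<in> space (Rn n). norm_n n x \<le> 1} = {f. sqrt (\<Sum>i\<in>{..<n}. (f i)\<^sup>2) \<le> 1} \<inter> space (Rn n)"
    by (auto simp: norm_n_def)
  then show ?thesis using emeasure_cball_aux[of "{..<n}" 1] by simp
qed

lemma prob_space_uniform_sphere: "prob_space (uniform_sphere n)"
  unfolding uniform_sphere_def
proof (rule prob_space.prob_space_distr)
  show "prob_space (uniform_measure (Rn n) {x \<in> space (Rn n). norm_n n x \<le> 1})"
  proof (rule prob_space_uniform_measure)
    have "(unit_ball_vol (real n) :: real) > 0"
      by (rule unit_ball_vol_pos) simp
    then have "(unit_ball_vol (real n) :: real) \<noteq> 0"
      by linarith
    then show "emeasure (Rn n) {x \<in> space (Rn n). norm_n n x \<le> 1} \<noteq> 0"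
      unfolding emeasure_unit_ball_n by simp
    show "emeasure (Rn n) {x \<in> space (Rn n). norm_n n x \<le> 1} \<noteq> \<infinity>"
      unfolding emeasure_unit_ball_n by simp
  qed
  show "(\<lambda>x. \<lambda>i\<in>{..<n}. x i / norm_n n x)
    \<in> uniform_measure (Rn n) {x \<in> space (Rn n). norm_n n x \<le> 1} \<rightarrow>\<^sub>M Rn n"
    by simp
qed

lemma AE_uniform_sphere:
  assumes n: "n \<ge> 1"
  shows "AE x in uniform_sphere n. x \<in> sphere_n n"
proof -
  interpret product_sigma_finite "\<lambda>_::nat. lborel::real measure" ..
  let ?p = "\<lambda>x. \<lambda>i\<in>{..<n}. x i / norm_n n x"
  have "emeasure (Rn n) (PiE {..<n} (\<lambda>_. {0::real})) = (\<Prod>i<n. emeasure lborel {0::real})"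
    by (rule emeasure_PiM) auto
  then have z: "AE x in Rn n. x \<notin> PiE {..<n} (\<lambda>_. {0::real})"
    using n by (intro AE_not_in null_setsI sets_PiM_I_finite) (auto simp: power_0_left)
  have norm_p: "norm_n n (?p x) = 1"
    if x: "x \<in> space (Rn n)" "x \<notin> PiE {..<n} (\<lambda>_. {0::real})" for x
  proof -
    obtain k where k: "k < n" "x k \<noteq> 0"
      using x unfolding space_PiM PiE_iff by blast
    have pos: "(\<Sum>i<n. (x i)\<^sup>2) > 0"
      using k by (intro sum_pos2[of _ k]) auto
    then have sq: "(norm_n n x)\<^sup>2 = (\<Sum>i<n. (x i)\<^sup>2)"
      by (simp add: norm_n_def)
    have "(\<Sum>i<n. (?p x i)\<^sup>2) = (\<Sum>i<n. (x i)\<^sup>2 / (norm_n n x)\<^sup>2)"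
      by (rule sum.cong) (simp_all add: power_divide)
    also have "\<dots> = (\<Sum>i<n. (x i)\<^sup>2) / (norm_n n x)\<^sup>2"
      by (rule sum_divide_distrib[symmetric])
    also have "\<dots> = 1"
      using pos unfolding sq by simp
    finally show ?thesis
      unfolding norm_n_def[of n "?p x"] by simp
  qed
  have "AE x in Rn n. ?p x \<in> sphere_n n"
    using z AE_space
  proof eventually_elim
    case (elim x)
    then show ?case
      using norm_p[of x] by (simp add: sphere_n_def space_PiM)
  qed
  then have ae: "AE x in uniform_measure (Rn n) {x \<in> space (Rn n). norm_n n x \<le> 1}. ?p x \<in> sphere_n n"
    by (intro AE_uniform_measureI) (measurable, auto elim: eventually_mono)
  have m: "{x \<in> space (Rn n). x \<in> sphere_n n} \<in> sets (Rn n)"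
    unfolding sphere_n_def by simp
  have p: "?p \<in> uniform_measure (Rn n) {x \<in> space (Rn n). norm_n n x \<le> 1} \<rightarrow>\<^sub>M Rn n"
    by simp
  show ?thesis
    unfolding uniform_sphere_def using ae by (simp only: AE_distr_iff[OF p m])
qed

definition hamiltonian :: "nat \<Rightarrow> real mat \<Rightarrow> (nat \<Rightarrow> real) \<Rightarrow> real" where
  "hamiltonian n A \<sigma> = real n / 2 * (\<Sum>i<n. \<Sum>j<n. \<sigma> i * A $$ (i, j) * \<sigma> j)"

definition partition_function :: "nat \<Rightarrow> real mat \<Rightarrow> real \<Rightarrow> real" where
  "partition_function n A \<beta> = (\<integral>\<sigma>. exp (\<beta> * hamiltonian n A \<sigma>) \<partial>uniform_sphere n)"

definition gibbs :: "nat \<Rightarrow> real mat \<Rightarrow> real \<Rightarrow> (nat \<Rightarrow> real) measure" where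
  "gibbs n A \<beta> = density (uniform_sphere n)
     (\<lambda>\<sigma>. ennreal (exp (\<beta> * hamiltonian n A \<sigma>) / partition_function n A \<beta>))"

definition overlap :: "nat \<Rightarrow> (nat \<Rightarrow> real) \<Rightarrow> (nat \<Rightarrow> real) \<Rightarrow> real" where
  "overlap n \<sigma> \<tau> = (\<Sum>i<n. \<sigma> i * \<tau> i)"

definition overlap_law :: "nat \<Rightarrow> real mat \<Rightarrow> real \<Rightarrow> real measure" where
  "overlap_law n A \<beta> = distr (gibbs n A \<beta> \<Otimes>\<^sub>M gibbs n A \<beta>) borel (\<lambda>(\<sigma>, \<tau>). overlap n \<sigma> \<tau>)"

text \<open>
  \<open>eig A j\<close> is the \<open>j\<close>-th largest real eigenvalue of \<open>A\<close>, counted with algebraic multiplicity and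
  numbered from 1. It is only meaningful for \<open>1 \<le> j \<le> n\<close> when \<open>A\<close> is an \<open>n \<times> n\<close> matrix with \<open>n\<close>
  real eigenvalues, in particular when \<open>A\<close> is symmetric.
\<close>

definition eig :: "real mat \<Rightarrow> nat \<Rightarrow> real" where
  "eig A j = rev (sorted_list_of_multiset (proots (char_poly A))) ! (j - 1)"

text \<open>The empirical measure of \<open>\<lambda>\<^sub>2, \<dots>, \<lambda>\<^sub>n\<close>, each of which has mass \<open>1 / (n - 1)\<close>.\<close>

definition empirical_measure :: "nat \<Rightarrow> real mat \<Rightarrow> real measure" where
  "empirical_measure n A = distr (uniform_count_measure {2..n}) borel (eig A)"

definition semicircle :: "real measure" where
  "semicircle = density lborel (\<lambda>x. ennreal (indicator {-2..2} x * sqrt (4 - x\<^sup>2) / (2 * pi)))"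

definition sc_quantiles :: "nat \<Rightarrow> (nat \<Rightarrow> real) \<Rightarrow> bool" where
  "sc_quantiles K q \<longleftrightarrow> q 1 = 2 \<and> q (K + 1) = -2 \<and>
     (\<forall>j\<in>{1..K}. q (j + 1) \<le> q j \<and> measure semicircle {q (j + 1)..q j} = 1 / real K)"

text \<open>Rigidity of one realization \<open>A\<close>, with \<open>q K i\<close> in the role of \<open>\<lambda>\<^sub>i\<close>-tilde for the given \<open>K\<close>.\<close>

definition rigid :: "(nat \<Rightarrow> nat \<Rightarrow> real) \<Rightarrow> (nat \<Rightarrow> real mat) \<Rightarrow> bool" where
  "rigid q A \<longleftrightarrow>
     (\<forall>\<epsilon>>0. \<exists>K0\<ge>1. \<forall>K\<ge>K0. \<forall>\<^sub>F n in sequentially.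
        \<forall>i\<in>{1..K}. \<forall>j::nat.
          (real i - 1) * (real n - 2) / real K + 3 \<le> real j \<and>
          real j \<le> real i * (real n - 2) / real K + 2 \<longrightarrow>
          \<bar>eig (A n) j - q K i\<bar> \<le> \<epsilon>)"

definition s_weight :: "real \<Rightarrow> real \<Rightarrow> real \<Rightarrow> real \<Rightarrow> real" where
  "s_weight r c \<beta> x = indicator {0..r} x * (1 / sqrt (x * (r - x)) * exp (- (c * \<beta> / 2) * x))"

definition s_law :: "real \<Rightarrow> real \<Rightarrow> real \<Rightarrow> real measure" where
  "s_law r c \<beta> = density lborel
     (\<lambda>x. ennreal (s_weight r c \<beta> x / (\<integral>y. s_weight r c \<beta> y \<partial>lborel)))"

definition rademacher :: "real measure" where
  "rademacher = distr (uniform_count_measure {-1, 1}) borel (\<lambda>x. x)"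

definition limit_law :: "real \<Rightarrow> real \<Rightarrow> real \<Rightarrow> real measure" where
  "limit_law r c \<beta> =
     distr ((s_law r c \<beta> \<Otimes>\<^sub>M s_law r c \<beta>) \<Otimes>\<^sub>M (rademacher \<Otimes>\<^sub>M rademacher)) borel
       (\<lambda>((s1, s2), (z1, z2)). sqrt (s1 * s2) * z1 + sqrt ((r - s1) * (r - s2)) * z2)"

end

theory Submission
  imports Defs "Jordan_Normal_Form.Spectral_Radius"
begin

text \<open>
  The proof replaces saddle point asymptotics by an exact Gaussian representation of the Gibbs
  measure. (This comment numbers coordinates and eigenvalues from 1; the formal text numbers
  coordinates from 0.) The uniform measure and the overlap are invariant under orthogonal maps, so
  one may pass to an eigenbasis, in which a Gibbs sample \<open>\<sigma>\<close> has density proportional to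
  \<open>exp (\<beta> n / 2 \<cdot> \<Sum>\<^sub>j \<lambda>\<^sub>j \<sigma>\<^sub>j\<^sup>2)\<close> on the sphere.

  By a theorem of Archimedes (\<open>nn_integral_uniform_sphere_tail\<close>) the tail \<open>v = (\<sigma>\<^sub>3, \<dots>, \<sigma>\<^sub>n)\<close> of a
  uniform point of the sphere is uniformly distributed in the unit ball, and given \<open>v\<close> the first two
  coordinates are uniform on the circle of squared radius \<open>r = 1 - \<parallel>v\<parallel>\<^sup>2\<close>: their signs are
  independent and fair, and the fraction \<open>p\<close> of \<open>r\<close> taken by \<open>\<sigma>\<^sub>2\<^sup>2\<close> has the arcsine law. Since
  \<open>\<lambda>\<^sub>2 = \<lambda>\<^sub>1 - c / n\<close>, the Gibbs weight at this point is a constant times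
  \<open>exp (- \<beta> n / 2 \<cdot> \<Sum>\<^sub>j\<^sub>\<ge>\<^sub>3 (\<lambda>\<^sub>1 - \<lambda>\<^sub>j) v\<^sub>j\<^sup>2) \<cdot> exp (- c \<beta> / 2 \<cdot> r p)\<close>. So \<open>v\<close> is a vector of
  independent Gaussians with variances \<open>1 / (\<beta> n (\<lambda>\<^sub>1 - \<lambda>\<^sub>j))\<close>, restricted to the unit ball and tilted
  by a bounded factor (\<open>gibbs_weight_disintegration\<close>).

  Under the Gaussian measure the mean of \<open>\<parallel>v\<parallel>\<^sup>2\<close> is \<open>1 / (\<beta> n) \<cdot> \<Sum>\<^sub>j\<^sub>\<ge>\<^sub>3 1 / (\<lambda>\<^sub>1 - \<lambda>\<^sub>j)\<close>, which converges
  to \<open>1 / \<beta>\<close> times the Stieltjes transform of the semicircular law at \<open>J + 1 / J\<close>, that is, to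
  \<open>1 / (\<beta> J) < 1\<close> (\<open>semicircle_stieltjes\<close>, \<open>bulk_resolvent_sum\<close>). Its variance, and the second
  moment of the inner product of two independent copies of \<open>v\<close>, are of the order of the sum of the
  squared variances, which is \<open>O(1 / n)\<close> because rigidity keeps \<open>\<lambda>\<^sub>3\<close> away from \<open>\<lambda>\<^sub>1\<close>. In particular
  the restriction to the unit ball is asymptotically irrelevant, \<open>r\<close> tends to \<open>1 - 1 / (\<beta> J)\<close>, and
  the tails do not contribute to the overlap.

  The expectation of a test function of the overlap is a quotient of two Gaussian expectations
  of a function \<open>Psi\<close> of the norms and the inner product of the two tails
  (\<open>expectation_overlap_law\<close>), which is bounded and continuous at the limit point. Its value there is
  the expectation under the limit law, up to a common factor (\<open>Psi_eq_limit_law\<close>).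
\<close>

section \<open>Orthogonal diagonalization of symmetric matrices\<close>

text \<open>
  A complex eigenvector \<open>z\<close> exists; its eigenvalue \<open>\<mu>\<close> is real because \<open>\<mu> \<parallel>z\<parallel>\<^sup>2\<close> is the value at \<open>z\<close> of
  a Hermitian form.
\<close>

lemma symmetric_mat_eigenvalue_exists:
  fixes A :: "real mat"
  assumes A: "A \<in> carrier_mat n n" and sym: "transpose_mat A = A" and n: "n > 0"
  obtains r where "eigenvalue A r"
proof -
  define C where "C = map_mat complex_of_real A"
  have C: "C \<in> carrier_mat n n" using A by (simp add: C_def)
  from spectrum_non_empty[OF C n] obtain \<mu> where "eigenvalue C \<mu>"
    by (auto simp: spectrum_def)
  then obtain z where "eigenvector C z \<mu>" by (auto simp: eigenvalue_def)
  then have z: "z \<in> carrier_vec n" "z \<noteq> 0\<^sub>v n" "C *\<^sub>v z = \<mu> \<cdot>\<^sub>v z"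
    using C by (auto simp: eigenvector_def)
  have symm: "A $$ (i, j) = A $$ (j, i)" if "i < n" "j < n" for i j
    using that A sym by (metis carrier_matD index_transpose_mat(1))
  have row: "(\<Sum>j<n. of_real (A $$ (i, j)) * z $ j) = \<mu> * z $ i" if i: "i < n" for i
  proof -
    have "(C *\<^sub>v z) $ i = \<mu> * z $ i" using i z by simp
    moreover have "(C *\<^sub>v z) $ i = (\<Sum>j<n. of_real (A $$ (i, j)) * z $ j)"
      using i z(1) C A by (auto simp: scalar_prod_def C_def lessThan_atLeast0 intro!: sum.cong)
    ultimately show ?thesis by simp
  qed
  define q where "q = (\<Sum>i<n. \<Sum>j<n. cnj (z $ i) * (of_real (A $$ (i, j)) * z $ j))"
  define N where "N = (\<Sum>i<n. (cmod (z $ i))\<^sup>2)"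
  have "q = (\<Sum>i<n. cnj (z $ i) * (\<mu> * z $ i))"
    unfolding q_def sum_distrib_left[symmetric] by (intro sum.cong refl) (simp add: row)
  also have "\<dots> = \<mu> * of_real N"
    by (simp add: N_def sum_distrib_left complex_norm_square mult_ac del: of_real_power)
  finally have q: "q = \<mu> * of_real N" .
  have "cnj q = (\<Sum>i<n. \<Sum>j<n. z $ i * (of_real (A $$ (i, j)) * cnj (z $ j)))"
    by (simp add: q_def)
  also have "\<dots> = q"
    unfolding q_def by (subst sum.swap) (auto intro!: sum.cong simp: symm)
  finally have qr: "cnj q = q" .
  obtain k where k: "k < n" "z $ k \<noteq> 0"
    using z(1,2) by (metis carrier_vecD eq_vecI index_zero_vec(1,2))
  have "N > 0"
    unfolding N_def using k by (intro sum_pos2[of _ k]) auto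
  with q qr have "cnj \<mu> = \<mu>" by auto
  then have mu: "\<mu> = of_real (Re \<mu>)"
    by (metis Reals_cnj_iff of_real_Re)
  have "poly (char_poly C) \<mu> = 0"
    using \<open>eigenvalue C \<mu>\<close> eigenvalue_root_char_poly[OF C] by simp
  moreover have "char_poly C = map_poly complex_of_real (char_poly A)"
    unfolding C_def by (rule of_real_hom.char_poly_hom[OF A])
  ultimately have "poly (map_poly complex_of_real (char_poly A)) (of_real (Re \<mu>)) = 0"
    using mu \<open>char_poly C = _\<close> by simp
  then have "poly (char_poly A) (Re \<mu>) = 0"
    by simp
  then have "eigenvalue A (Re \<mu>)"
    using eigenvalue_root_char_poly[OF A] by simp
  then show thesis by (rule that)
qed

text \<open>
  The Householder reflection in the hyperplane orthogonal to \<open>u - e\<^sub>0\<close> exchanges the unit vectors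
  \<open>e\<^sub>0\<close> and \<open>u\<close>.
\<close>

lemma householder:
  fixes u :: "real vec"
  assumes u: "u \<in> carrier_vec n" and norm: "u \<bullet> u = 1" and n: "n > 0"
  obtains H where "H \<in> carrier_mat n n" "transpose_mat H = H" "H * H = 1\<^sub>m n"
    "H *\<^sub>v unit_vec n 0 = u"
proof (cases "u = unit_vec n 0")
  case True
  show thesis by (rule that[of "1\<^sub>m n"]) (use True in auto)
next
  case False
  define w where "w i = u $ i - (if i = 0 then 1 else 0)" for i
  define W where "W = (\<Sum>i<n. (w i)\<^sup>2)"
  have uu: "(\<Sum>i<n. (u $ i)\<^sup>2) = 1"
    using norm u by (simp add: scalar_prod_def lessThan_atLeast0 power2_eq_square)
  have "W = (\<Sum>i<n. (u $ i)\<^sup>2 + (if i = 0 then 1 - 2 * u $ 0 else 0))"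
    unfolding W_def by (intro sum.cong) (auto simp: w_def power2_eq_square algebra_simps)
  also have "\<dots> = 2 - 2 * u $ 0"
    using n by (simp add: sum.distrib uu sum.delta)
  finally have W: "W = 2 - 2 * u $ 0" .
  have "W \<noteq> 0"
  proof
    assume "W = 0"
    then have "\<forall>i\<in>{..<n}. (w i)\<^sup>2 = 0"
      unfolding W_def by (subst (asm) sum_nonneg_eq_0_iff) auto
    then have "u = unit_vec n 0"
      using u n by (intro eq_vecI) (auto simp: w_def)
    with False show False by simp
  qed
  \<comment> \<open>the reflection \<open>I - 2 w w\<^sup>T / \<parallel>w\<parallel>\<^sup>2\<close> with \<open>w = u - e\<^sub>0\<close>\<close>
  define H where "H = mat n n (\<lambda>(i, j). (if i = j then 1 else 0) - 2 * w i * w j / W)"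
  show thesis
  proof (rule that[of H])
    show "H \<in> carrier_mat n n" by (simp add: H_def)
    show "transpose_mat H = H"
      by (rule eq_matI) (auto simp: H_def)
    show "H * H = 1\<^sub>m n"
    proof (rule eq_matI)
      fix i j assume "i < dim_row (1\<^sub>m n :: real mat)" "j < dim_col (1\<^sub>m n :: real mat)"
      then have ij: "i < n" "j < n" by auto
      have "(H * H) $$ (i, j) = (\<Sum>k<n. ((if i = k then 1 else 0) - 2 * w i * w k / W) *
              ((if k = j then 1 else 0) - 2 * w k * w j / W))"
        using ij by (simp add: H_def scalar_prod_def lessThan_atLeast0)
      also have "\<dots> = (\<Sum>k<n. (if i = k then (if k = j then 1 else 0) - 2 * w k * w j / W else 0)
              + (if k = j then - (2 * w i * w j / W) else 0) + (4 * w i * w j / W\<^sup>2) * (w k)\<^sup>2)"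
        by (intro sum.cong refl) (auto simp: algebra_simps power2_eq_square)
      also have "\<dots> = ((if i = j then 1 else 0) - 2 * w i * w j / W) - 2 * w i * w j / W
              + (4 * w i * w j / W\<^sup>2) * W"
        using ij by (simp add: sum.distrib sum_distrib_left[symmetric] W_def[symmetric] del: times_divide_eq_left)
      also have "\<dots> = (if i = j then 1 else 0)"
        using \<open>W \<noteq> 0\<close> by (simp add: power2_eq_square)
      finally show "(H * H) $$ (i, j) = (1\<^sub>m n) $$ (i, j)" using ij by simp
    qed (auto simp: H_def)
    show "H *\<^sub>v unit_vec n 0 = u"
    proof (rule eq_vecI)
      fix i assume "i < dim_vec u"
      then have i: "i < n" using u by auto
      have "(H *\<^sub>v unit_vec n 0) $ i = H $$ (i, 0)"
        using i n by (simp add: H_def)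
      also have "\<dots> = u $ i"
      proof -
        have "w 0 = - W / 2" using W by (simp add: w_def)
        have "H $$ (i, 0) = (if i = 0 then 1 else 0) - 2 * w i * w 0 / W"
          using i n by (simp add: H_def)
        also have "\<dots> = (if i = 0 then 1 else 0) + w i"
          unfolding \<open>w 0 = - W / 2\<close> using \<open>W \<noteq> 0\<close> by simp
        finally show ?thesis by (simp add: w_def)
      qed
      finally show "(H *\<^sub>v unit_vec n 0) $ i = u $ i" .
    qed (use u in \<open>auto simp: H_def\<close>)
  qed
qed

text \<open>
  Induction on the dimension: conjugation with a Householder reflection that maps \<open>e\<^sub>0\<close> to a unit
  eigenvector splits off a \<open>1 \<times> 1\<close> block.
\<close>

theorem symmetric_mat_orthogonally_diagonalizable:
  fixes A :: "real mat"
  assumes "A \<in> carrier_mat n n" and "transpose_mat A = A"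
  shows "\<exists>D P. similar_mat_wit A D P (transpose_mat P) \<and> diagonal_mat D"
  using assms
proof (induction n arbitrary: A)
  case 0
  then have "similar_mat_wit A A (1\<^sub>m 0) (transpose_mat (1\<^sub>m 0))"
    using similar_mat_wit_refl[OF 0(1)] by simp
  moreover have "diagonal_mat A" using 0 by (auto simp: diagonal_mat_def)
  ultimately show ?case by blast
next
  case (Suc m)
  let ?n = "Suc m"
  note A = Suc.prems(1)
  obtain r where "eigenvalue A r"
    using symmetric_mat_eigenvalue_exists[OF Suc.prems] by auto
  then obtain v where v: "v \<in> carrier_vec ?n" "v \<noteq> 0\<^sub>v ?n" "A *\<^sub>v v = r \<cdot>\<^sub>v v"
    using A by (auto simp: eigenvalue_def eigenvector_def)
  have vv: "v \<bullet> v > 0"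
  proof -
    obtain k where k: "k < ?n" "v $ k \<noteq> 0"
      using v(1,2) by (metis carrier_vecD eq_vecI index_zero_vec(1,2))
    have "(\<Sum>i<?n. (v $ i)\<^sup>2) > 0"
      using k by (intro sum_pos2[of _ k]) auto
    then show ?thesis
      using v by (simp add: scalar_prod_def lessThan_atLeast0 power2_eq_square)
  qed
  define u where "u = (1 / sqrt (v \<bullet> v)) \<cdot>\<^sub>v v"
  have u: "u \<in> carrier_vec ?n" using v by (simp add: u_def)
  have uu: "u \<bullet> u = 1"
    using v vv by (simp add: u_def)
  have Au: "A *\<^sub>v u = r \<cdot>\<^sub>v u"
    using v A by (simp add: u_def mult_mat_vec smult_smult_assoc mult.commute)
  obtain H where H: "H \<in> carrier_mat ?n ?n" "transpose_mat H = H" "H * H = 1\<^sub>m ?n"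
    "H *\<^sub>v unit_vec ?n 0 = u"
    using householder[OF u uu] by auto
  define B where "B = H * A * H"
  have B: "B \<in> carrier_mat ?n ?n" using H A by (simp add: B_def)
  have HBH: "H * B * H = A"
  proof -
    have "H * B * H = (H * H) * A * (H * H)"
      using H(1) A by (simp add: B_def assoc_mult_mat[of _ ?n ?n _ ?n _ ?n])
    then show ?thesis using H A by simp
  qed
  have wit1: "similar_mat_wit A B H (transpose_mat H)"
    unfolding H(2) by (rule similar_mat_witI[of _ _ ?n]) (use H A B HBH in auto)
  have Bsym: "transpose_mat B = B"
    using H A Suc.prems(2) by (simp add: B_def transpose_mult[of _ ?n ?n _ ?n] assoc_mult_mat[of _ ?n ?n _ ?n _ ?n])
  have Be: "B *\<^sub>v unit_vec ?n 0 = r \<cdot>\<^sub>v unit_vec ?n 0"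
  proof -
    have Hu: "H *\<^sub>v u = unit_vec ?n 0"
      unfolding H(4)[symmetric] using H
      by (subst assoc_mult_mat_vec[symmetric, of _ ?n ?n _ ?n]) auto
    have "B *\<^sub>v unit_vec ?n 0 = H *\<^sub>v (A *\<^sub>v (H *\<^sub>v unit_vec ?n 0))"
      using H A by (simp add: B_def assoc_mult_mat_vec[of _ ?n ?n _ ?n])
    also have "\<dots> = r \<cdot>\<^sub>v unit_vec ?n 0"
      unfolding H(4) Au using H u by (simp add: mult_mat_vec Hu)
    finally show ?thesis .
  qed
  have col0: "B $$ (i, 0) = (if i = 0 then r else 0)" if "i < ?n" for i
  proof -
    have "(B *\<^sub>v unit_vec ?n 0) $ i = B $$ (i, 0)"
      using B that by auto
    then have "B $$ (i, 0) = (r \<cdot>\<^sub>v unit_vec ?n 0) $ i" using Be by simp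
    then show ?thesis using that by simp
  qed
  have row0: "B $$ (0, j) = (if j = 0 then r else 0)" if "j < ?n" for j
    using col0[OF that] that B Bsym by (metis carrier_matD index_transpose_mat(1) zero_less_Suc)
  define B' where "B' = mat m m (\<lambda>(i, j). B $$ (Suc i, Suc j))"
  have B': "B' \<in> carrier_mat m m" by (simp add: B'_def)
  have "transpose_mat B' = B'"
  proof (rule eq_matI)
    fix i j assume "i < dim_row B'" "j < dim_col B'"
    then have ij: "i < m" "j < m" by (auto simp: B'_def)
    then have "B $$ (Suc j, Suc i) = B $$ (Suc i, Suc j)"
      using B Bsym by (metis Suc_less_eq carrier_matD index_transpose_mat(1))
    then show "transpose_mat B' $$ (i, j) = B' $$ (i, j)" using ij by (simp add: B'_def)
  qed (auto simp: B'_def)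
  from Suc.IH[OF B' this] obtain D' P' where IH:
    "similar_mat_wit B' D' P' (transpose_mat P')" "diagonal_mat D'" by blast
  have cD': "D' \<in> carrier_mat m m" and cP': "P' \<in> carrier_mat m m"
    using similar_mat_witD2[OF B' IH(1)] by auto
  let ?r = "mat 1 1 (\<lambda>_. r)"
  let ?one = "1\<^sub>m 1 :: real mat"
  have Bblock: "B = four_block_mat ?r (0\<^sub>m 1 m) (0\<^sub>m m 1) B'"
  proof (rule eq_matI)
    fix i j
    assume "i < dim_row (four_block_mat ?r (0\<^sub>m 1 m) (0\<^sub>m m 1) B')"
      "j < dim_col (four_block_mat ?r (0\<^sub>m 1 m) (0\<^sub>m m 1) B')"
    then have "i < ?n" "j < ?n" by (auto simp: B'_def)
    then show "B $$ (i, j) = four_block_mat ?r (0\<^sub>m 1 m) (0\<^sub>m m 1) B' $$ (i, j)"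
      using col0[of i] row0[of j] by (cases i; cases j) (auto simp: B'_def)
  qed (use B in \<open>auto simp: B'_def\<close>)
  define D where "D = four_block_mat ?r (0\<^sub>m 1 m) (0\<^sub>m m 1) D'"
  define P where "P = four_block_mat ?one (0\<^sub>m 1 m) (0\<^sub>m m 1) P'"
  have tP: "transpose_mat P = four_block_mat ?one (0\<^sub>m 1 m) (0\<^sub>m m 1) (transpose_mat P')"
    unfolding P_def by (subst transpose_four_block_mat[of _ 1 1 _ m _ m]) (use cP' in auto)
  have "similar_mat_wit B D P (transpose_mat P)"
    unfolding tP unfolding Bblock D_def P_def
    by (rule similar_mat_wit_four_block[OF similar_mat_wit_refl IH(1), of _ 1])
       (use cD' cP' B' in auto)
  from similar_mat_wit_trans[OF wit1 this]
  have "similar_mat_wit A D (H * P) (transpose_mat P * transpose_mat H)" .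
  moreover have "transpose_mat P * transpose_mat H = transpose_mat (H * P)"
    by (subst transpose_mult[of _ ?n ?n _ ?n]) (use H cP' in \<open>auto simp: P_def\<close>)
  moreover have "diagonal_mat D"
    using IH(2) cD' by (auto simp: diagonal_mat_def D_def)
  ultimately show ?case by metis
qed

section \<open>Eigencoordinates\<close>

lemma proots_prod_linear_factors:
  fixes xs :: "'a::idom list"
  shows "proots (\<Prod>a\<leftarrow>xs. [:- a, 1:]) = mset xs"
proof (induction xs)
  case (Cons a xs)
  have "(\<Prod>a\<leftarrow>xs. [:- a, 1:]) \<noteq> 0"
    by (auto simp: prod_list_zero_iff)
  then show ?case
    using Cons by (simp add: proots_mult del: mult_pCons_left)
qed simp

lemma eig_list_of_orthogonal_diagonalization:
  fixes A D P :: "real mat"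
  assumes A: "A \<in> carrier_mat n n" and wit: "similar_mat_wit A D P (transpose_mat P)"
    and D: "diagonal_mat D"
  shows "mset (map (eig A) [1..<Suc n]) = mset (diag_mat D)"
    and "i \<in> {1..n} \<Longrightarrow> j \<in> {1..n} \<Longrightarrow> i \<le> j \<Longrightarrow> eig A j \<le> eig A i"
proof -
  define xs where "xs = rev (sorted_list_of_multiset (proots (char_poly A)))"
  have cD: "D \<in> carrier_mat n n"
    using similar_mat_witD2[OF A wit] by simp
  have "char_poly A = char_poly D"
    using char_poly_similar[of A D] wit unfolding similar_mat_def by blast
  also have "\<dots> = (\<Prod>a\<leftarrow>diag_mat D. [:- a, 1:])"
    by (rule char_poly_upper_triangular[OF cD])
       (use D cD in \<open>auto simp: upper_triangular_def diagonal_mat_def\<close>)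
  finally have "proots (char_poly A) = mset (diag_mat D)"
    by (simp add: proots_prod_linear_factors)
  then have ms: "mset xs = mset (diag_mat D)"
    by (simp add: xs_def)
  have len: "length xs = n"
    using mset_eq_length[OF ms] cD by (simp add: diag_mat_def)
  have nth: "eig A j = xs ! (j - 1)" for j
    by (simp add: eig_def xs_def)
  have "map (eig A) [1..<Suc n] = xs"
    by (rule nth_equalityI) (auto simp: len nth simp del: upt_Suc)
  then show "mset (map (eig A) [1..<Suc n]) = mset (diag_mat D)"
    using ms by simp
  have "sorted (rev xs)"
    by (simp add: xs_def)
  then show "eig A j \<le> eig A i" if "i \<in> {1..n}" "j \<in> {1..n}" "i \<le> j"
    using that len by (auto simp: nth sorted_rev_nth_mono)
qed

lemma eig_mono:
  fixes A :: "real mat"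
  assumes "A \<in> carrier_mat n n" and "transpose_mat A = A"
    and "i \<in> {1..n}" "j \<in> {1..n}" "i \<le> j"
  shows "eig A j \<le> eig A i"
  using symmetric_mat_orthogonally_diagonalizable[OF assms(1,2)]
    eig_list_of_orthogonal_diagonalization(2)[OF assms(1)] assms(3-) by blast

text \<open>
  Orthogonality of the \<open>n \<times> n\<close> array \<open>Q\<close>: both its columns and its rows are orthonormal.
\<close>

definition orthogonal_n :: "nat \<Rightarrow> (nat \<Rightarrow> nat \<Rightarrow> real) \<Rightarrow> bool" where
  "orthogonal_n n Q \<longleftrightarrow>
     (\<forall>i<n. \<forall>j<n. (\<Sum>k<n. Q k i * Q k j) = (if i = j then 1 else 0)) \<and>
     (\<forall>i<n. \<forall>j<n. (\<Sum>k<n. Q i k * Q j k) = (if i = j then 1 else 0))"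

text \<open>
  The columns of an orthogonal diagonalization are permuted so that column \<open>k\<close>, counted from 0,
  belongs to the eigenvalue \<open>eig A (Suc k)\<close>.
\<close>

lemma eig_orthogonal_decomposition:
  fixes A :: "real mat"
  assumes A: "A \<in> carrier_mat n n" and sym: "transpose_mat A = A"
  obtains Q where "orthogonal_n n Q"
    "\<And>i j. i < n \<Longrightarrow> j < n \<Longrightarrow> A $$ (i, j) = (\<Sum>k<n. eig A (Suc k) * Q i k * Q j k)"
proof -
  obtain D P where wit: "similar_mat_wit A D P (transpose_mat P)" and D: "diagonal_mat D"
    using symmetric_mat_orthogonally_diagonalizable[OF A sym] by blast
  note W = similar_mat_witD2[OF A wit]
  let ?L = "map (eig A) [1..<Suc n]"
  have "mset ?L = mset (diag_mat D)"
    by (rule eig_list_of_orthogonal_diagonalization(1)[OF A wit D])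
  then obtain \<pi> where \<pi>: "\<pi> permutes {..<length (diag_mat D)}" "permute_list \<pi> (diag_mat D) = ?L"
    using mset_eq_permutation by blast
  have len: "length (diag_mat D) = n"
    using W(5) by (simp add: diag_mat_def)
  have pi: "\<pi> permutes {..<n}" using \<pi>(1) len by simp
  have pin: "\<pi> k < n" if "k < n" for k
    using permutes_in_image[OF pi] that by auto
  have eig: "eig A (Suc k) = D $$ (\<pi> k, \<pi> k)" if k: "k < n" for k
  proof -
    have "eig A (Suc k) = ?L ! k" using k by (simp del: upt_Suc)
    also have "\<dots> = diag_mat D ! \<pi> k"
      unfolding \<pi>(2)[symmetric] using k len \<pi>(1) by (simp add: permute_list_nth)
    also have "\<dots> = D $$ (\<pi> k, \<pi> k)"
      using pin[OF k] W(5) by (auto simp: diag_mat_def)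
    finally show ?thesis .
  qed
  define Q where "Q i k = P $$ (i, \<pi> k)" for i k
  have PPt: "(\<Sum>k<n. P $$ (i, k) * P $$ (j, k)) = (if i = j then 1 else 0)" if "i < n" "j < n" for i j
  proof -
    have "(P * transpose_mat P) $$ (i, j) = (\<Sum>k<n. P $$ (i, k) * P $$ (j, k))"
      using that W(6) by (auto simp: scalar_prod_def lessThan_atLeast0)
    then show ?thesis using W(1) that by simp
  qed
  have PtP: "(\<Sum>k<n. P $$ (k, i) * P $$ (k, j)) = (if i = j then 1 else 0)" if "i < n" "j < n" for i j
  proof -
    have "(transpose_mat P * P) $$ (i, j) = (\<Sum>k<n. P $$ (k, i) * P $$ (k, j))"
      using that W(6) by (auto simp: scalar_prod_def lessThan_atLeast0)
    then show ?thesis using W(2) that by simp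
  qed
  show thesis
  proof (rule that[of Q])
    show "orthogonal_n n Q"
      unfolding orthogonal_n_def
    proof (intro conjI allI impI)
      fix i j assume ij: "i < n" "j < n"
      show "(\<Sum>k<n. Q k i * Q k j) = (if i = j then 1 else 0)"
        using PtP[OF pin[OF ij(1)] pin[OF ij(2)]] permutes_inj[OF pi]
        by (simp add: Q_def inj_eq)
      have "(\<Sum>k<n. Q i k * Q j k) = (\<Sum>k<n. P $$ (i, k) * P $$ (j, k))"
        unfolding Q_def
        using sum.permute[OF pi, of "\<lambda>k. P $$ (i, k) * P $$ (j, k)"] by (simp add: comp_def)
      then show "(\<Sum>k<n. Q i k * Q j k) = (if i = j then 1 else 0)"
        using PPt[OF ij] by simp
    qed
  next
    fix i j assume ij: "i < n" "j < n"
    have DP: "(D * transpose_mat P) $$ (k, j) = D $$ (k, k) * P $$ (j, k)" if k: "k < n" for k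
    proof -
      have "(D * transpose_mat P) $$ (k, j) = (\<Sum>l<n. D $$ (k, l) * P $$ (j, l))"
        using k ij W(5,6) by (auto simp: scalar_prod_def lessThan_atLeast0)
      also have "\<dots> = (\<Sum>l<n. if k = l then D $$ (k, k) * P $$ (j, k) else 0)"
        using D k W(5) by (intro sum.cong) (auto simp: diagonal_mat_def)
      finally show ?thesis using k by simp
    qed
    have "A = P * (D * transpose_mat P)"
      using W by (metis assoc_mult_mat)
    then have "A $$ (i, j) = (P * (D * transpose_mat P)) $$ (i, j)"
      by simp
    also have "\<dots> = (\<Sum>k<n. P $$ (i, k) * (D * transpose_mat P) $$ (k, j))"
      using ij W(5,6) by (subst index_mult_mat) (auto simp: scalar_prod_def lessThan_atLeast0)
    also have "\<dots> = (\<Sum>k<n. D $$ (k, k) * P $$ (i, k) * P $$ (j, k))"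
      by (intro sum.cong) (auto simp: DP)
    also have "\<dots> = (\<Sum>k<n. D $$ (\<pi> k, \<pi> k) * P $$ (i, \<pi> k) * P $$ (j, \<pi> k))"
      using sum.permute[OF pi, of "\<lambda>k. D $$ (k, k) * P $$ (i, k) * P $$ (j, k)"]
      by (simp add: comp_def)
    also have "\<dots> = (\<Sum>k<n. eig A (Suc k) * Q i k * Q j k)"
      by (intro sum.cong) (auto simp: Q_def eig)
    finally show "A $$ (i, j) = (\<Sum>k<n. eig A (Suc k) * Q i k * Q j k)" .
  qed
qed

section \<open>Rotation invariance\<close>

interpretation lborel_product: product_sigma_finite "\<lambda>_::nat. lborel :: real measure" ..

lemma measurable_fun_upd_insert:
  assumes "f \<in> N \<rightarrow>\<^sub>M Pi\<^sub>M I M" and "g \<in> N \<rightarrow>\<^sub>M M i"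
  shows "(\<lambda>w. (f w)(i := g w)) \<in> N \<rightarrow>\<^sub>M Pi\<^sub>M (insert i I) M"
  using measurable_compose[OF measurable_Pair[OF assms] measurable_add_dim] by simp

lemma nn_integral_PiM_lborel_affine:
  fixes f :: "(nat \<Rightarrow> real) \<Rightarrow> ennreal"
  assumes "finite I" and f: "f \<in> borel_measurable (Pi\<^sub>M I (\<lambda>_. lborel))" and c: "c \<noteq> 0"
  shows "(\<integral>\<^sup>+x. f x \<partial>Pi\<^sub>M I (\<lambda>_. lborel)) =
    ennreal (\<bar>c\<bar> ^ card I) * (\<integral>\<^sup>+x. f (\<lambda>i\<in>I. a i + c * x i) \<partial>Pi\<^sub>M I (\<lambda>_. lborel))"
  using assms(1,2)
proof (induction I arbitrary: f)
  case empty
  show ?case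
    by (simp add: lborel_product.nn_integral_empty restrict_def) (simp add: space_PiM_empty)
next
  case (insert i I)
  let ?L = "\<lambda>_::nat. lborel :: real measure"
  note [measurable] = insert.prems
  interpret I: sigma_finite_measure "Pi\<^sub>M I ?L"
    by (rule lborel_product.sigma_finite) fact
  have [measurable]: "(\<lambda>w. f ((p w)(i := r w))) \<in> borel_measurable N"
    if "p \<in> N \<rightarrow>\<^sub>M Pi\<^sub>M I ?L" "r \<in> borel_measurable N" for p r and N :: "'b measure"
    using measurable_compose[OF measurable_fun_upd_insert insert.prems] that by simp
  have "(\<integral>\<^sup>+x. f x \<partial>Pi\<^sub>M (insert i I) ?L)
      = (\<integral>\<^sup>+y. (\<integral>\<^sup>+x. f (x(i := y)) \<partial>Pi\<^sub>M I ?L) \<partial>lborel)"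
    by (rule lborel_product.product_nn_integral_insert_rev) (use insert.hyps insert.prems in auto)
  also have "\<dots> = (\<integral>\<^sup>+y. ennreal (\<bar>c\<bar> ^ card I) *
      (\<integral>\<^sup>+x. f ((\<lambda>j\<in>I. a j + c * x j)(i := y)) \<partial>Pi\<^sub>M I ?L) \<partial>lborel)"
    by (intro nn_integral_cong insert.IH) measurable
  also have "\<dots> = ennreal (\<bar>c\<bar> ^ card I) *
      (\<integral>\<^sup>+y. (\<integral>\<^sup>+x. f ((\<lambda>j\<in>I. a j + c * x j)(i := y)) \<partial>Pi\<^sub>M I ?L) \<partial>lborel)"
    by (rule nn_integral_cmult) measurable
  also have "\<dots> = ennreal (\<bar>c\<bar> ^ card I) * (ennreal \<bar>c\<bar> *
      (\<integral>\<^sup>+y. (\<integral>\<^sup>+x. f ((\<lambda>j\<in>I. a j + c * x j)(i := a i + c * y)) \<partial>Pi\<^sub>M I ?L) \<partial>lborel))"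
  proof (subst nn_integral_real_affine[OF _ c, of _ "a i"])
    have "(\<lambda>y. \<integral>\<^sup>+x. f ((\<lambda>j\<in>I. a j + c * x j)(i := y)) \<partial>Pi\<^sub>M I ?L) \<in> borel_measurable lborel"
      by measurable
    then show "(\<lambda>y. \<integral>\<^sup>+x. f ((\<lambda>j\<in>I. a j + c * x j)(i := y)) \<partial>Pi\<^sub>M I ?L) \<in> borel_measurable borel"
      by simp
  qed simp
  also have "(\<integral>\<^sup>+y. (\<integral>\<^sup>+x. f ((\<lambda>j\<in>I. a j + c * x j)(i := a i + c * y)) \<partial>Pi\<^sub>M I ?L) \<partial>lborel)
      = (\<integral>\<^sup>+y. (\<integral>\<^sup>+x. f (\<lambda>j\<in>insert i I. a j + c * (x(i := y)) j) \<partial>Pi\<^sub>M I ?L) \<partial>lborel)"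
    using insert.hyps
    by (intro nn_integral_cong arg_cong[where f = f]) (auto simp: fun_eq_iff)
  also have "\<dots> = (\<integral>\<^sup>+x. f (\<lambda>j\<in>insert i I. a j + c * x j) \<partial>Pi\<^sub>M (insert i I) ?L)"
    by (rule lborel_product.product_nn_integral_insert_rev[symmetric]) (use insert.hyps insert.prems in auto)
  finally show ?case
    unfolding card_insert_disjoint[OF insert.hyps] power_Suc
    by (simp only: ennreal_mult'' mult_ac abs_ge_zero zero_le_power)
qed

text \<open>
  The linear map with matrix \<open>Q\<close>, as a map between spaces of extensional functions on \<open>{..<n}\<close>.
\<close>

definition lin_n :: "nat \<Rightarrow> (nat \<Rightarrow> nat \<Rightarrow> real) \<Rightarrow> (nat \<Rightarrow> real) \<Rightarrow> nat \<Rightarrow> real" where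
  "lin_n n Q x = (\<lambda>i\<in>{..<n}. \<Sum>k<n. Q i k * x k)"

lemma measurable_lin_n [measurable]: "lin_n n Q \<in> Rn n \<rightarrow>\<^sub>M Rn n"
  unfolding lin_n_def by measurable

lemma sum_lin_n_mult:
  assumes "orthogonal_n n Q"
  shows "(\<Sum>i<n. lin_n n Q x i * lin_n n Q y i) = (\<Sum>k<n. x k * y k)"
proof -
  have "(\<Sum>i<n. lin_n n Q x i * lin_n n Q y i) = (\<Sum>i<n. \<Sum>k<n. \<Sum>l<n. x k * y l * (Q i k * Q i l))"
    by (simp add: lin_n_def sum_product mult_ac)
  also have "\<dots> = (\<Sum>k<n. \<Sum>l<n. x k * y l * (\<Sum>i<n. Q i k * Q i l))"
    unfolding sum_distrib_left
    by (subst sum.swap, rule sum.cong[OF refl], rule sum.swap)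
  also have "\<dots> = (\<Sum>k<n. \<Sum>l<n. if k = l then x k * y k else 0)"
    using assms by (intro sum.cong refl) (auto simp: orthogonal_n_def)
  finally show ?thesis by simp
qed

lemma norm_n_lin_n: "orthogonal_n n Q \<Longrightarrow> norm_n n (lin_n n Q x) = norm_n n x"
  using sum_lin_n_mult[of n Q x x] by (simp add: norm_n_def power2_eq_square)

lemma lin_n_transpose:
  assumes Q: "orthogonal_n n Q" and x: "x \<in> space (Rn n)"
  shows "lin_n n Q (lin_n n (\<lambda>i j. Q j i) x) = x"
proof
  fix i
  show "lin_n n Q (lin_n n (\<lambda>i j. Q j i) x) i = x i"
  proof (cases "i < n")
    case True
    then have "lin_n n Q (lin_n n (\<lambda>i j. Q j i) x) i = (\<Sum>k<n. Q i k * (\<Sum>l<n. Q l k * x l))"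
      by (simp add: lin_n_def)
    also have "\<dots> = (\<Sum>k<n. \<Sum>l<n. Q i k * Q l k * x l)"
      by (simp add: sum_distrib_left mult_ac)
    also have "\<dots> = (\<Sum>l<n. (\<Sum>k<n. Q i k * Q l k) * x l)"
      by (subst sum.swap) (simp add: sum_distrib_right)
    also have "\<dots> = (\<Sum>l<n. if l = i then x i else 0)"
    proof (rule sum.cong)
      fix l assume "l \<in> {..<n}"
      then have "(\<Sum>k<n. Q i k * Q l k) = (if i = l then 1 else 0)"
        using Q True unfolding orthogonal_n_def by blast
      then show "(\<Sum>k<n. Q i k * Q l k) * x l = (if l = i then x i else 0)"
        by simp
    qed simp
    finally show ?thesis using True by simp
  next
    case False
    then have "x i = undefined"
      using x PiE_arb[of x "{..<n}" "\<lambda>_. UNIV" i] by (simp add: space_PiM)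
    then show ?thesis using False by (simp add: lin_n_def)
  qed
qed

text \<open>
  Orthogonal maps preserve Lebesgue measure on \<open>\<real>\<^sup>n\<close>.  The image \<open>\<nu>\<close> of Lebesgue measure \<open>\<mu>\<close>
  is again translation invariant, so two applications of Fubini to
  \<open>\<integral>\<integral> f(x + y) g(y)\<close> give \<open>\<integral>f d\<mu> \<integral>g d\<nu> = \<integral>f d\<nu> \<integral>g(-x) d\<mu>(x)\<close>; with the indicator of the unit
  ball for \<open>g\<close>, which \<open>\<mu>\<close> and \<open>\<nu>\<close> measure alike, \<open>\<mu> = \<nu>\<close> follows.
\<close>

lemma nn_integral_Rn_orthogonal:
  fixes f :: "(nat \<Rightarrow> real) \<Rightarrow> ennreal"
  assumes Q: "orthogonal_n n Q" and f [measurable]: "f \<in> borel_measurable (Rn n)"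
  shows "(\<integral>\<^sup>+x. f (lin_n n Q x) \<partial>Rn n) = (\<integral>\<^sup>+x. f x \<partial>Rn n)"
proof -
  let ?R = "Rn n"
  define T where "T = lin_n n Q"
  let ?T' = "lin_n n (\<lambda>i j. Q j i)"
  have T_m [measurable]: "T \<in> ?R \<rightarrow>\<^sub>M ?R"
    unfolding T_def by measurable
  have T_space [simp]: "T y \<in> space ?R" for y
    by (auto simp: T_def lin_n_def space_PiM)
  interpret R: sigma_finite_measure ?R
    by (rule lborel_product.sigma_finite) simp
  interpret RR: pair_sigma_finite ?R ?R ..
  define add where "add x y = (\<lambda>i\<in>{..<n}. x i + y i :: real)" for x y :: "nat \<Rightarrow> real"
  define neg where "neg x = (\<lambda>i\<in>{..<n}. - x i :: real)" for x :: "nat \<Rightarrow> real"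
  have add_m [measurable]: "(\<lambda>w. add (p w) (r w)) \<in> N \<rightarrow>\<^sub>M ?R"
    if "p \<in> N \<rightarrow>\<^sub>M ?R" "r \<in> N \<rightarrow>\<^sub>M ?R" for p r and N :: "'b measure"
    unfolding add_def
  proof (rule measurable_restrict)
    fix i assume "i \<in> {..<n}"
    then have "(\<lambda>w. p w i) \<in> borel_measurable N" "(\<lambda>w. r w i) \<in> borel_measurable N"
      using measurable_compose[OF that(1) measurable_component_singleton[of i]]
        measurable_compose[OF that(2) measurable_component_singleton[of i]] by auto
    then show "(\<lambda>w. p w i + r w i) \<in> N \<rightarrow>\<^sub>M lborel" by simp
  qed
  have neg_m [measurable]: "neg \<in> ?R \<rightarrow>\<^sub>M ?R"
    unfolding neg_def by measurable
  have transl: "(\<integral>\<^sup>+x. h x \<partial>?R) = (\<integral>\<^sup>+x. h (add a x) \<partial>?R)"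
    if "h \<in> borel_measurable ?R" for h :: "(nat \<Rightarrow> real) \<Rightarrow> ennreal" and a
    using nn_integral_PiM_lborel_affine[of "{..<n}" h 1 a] that by (simp add: add_def)
  have reflect: "(\<integral>\<^sup>+x. h x \<partial>?R) = (\<integral>\<^sup>+x. h (neg x) \<partial>?R)"
    if "h \<in> borel_measurable ?R" for h :: "(nat \<Rightarrow> real) \<Rightarrow> ennreal"
    using nn_integral_PiM_lborel_affine[of "{..<n}" h "-1" "\<lambda>_. 0"] that by (simp add: neg_def)
  have T_add: "T (add a y) = add (T a) (T y)" for a y
    unfolding T_def lin_n_def add_def by (auto simp: fun_eq_iff distrib_left sum.distrib)
  define g :: "(nat \<Rightarrow> real) \<Rightarrow> ennreal"
    where "g x = indicator {..1} (norm_n n x)" for x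
  have g_m [measurable]: "g \<in> borel_measurable ?R"
    unfolding g_def by measurable
  have g_neg: "g (neg x) = g x" for x
    by (simp add: g_def norm_n_def neg_def)
  have g_T: "g (T x) = g x" for x
    by (simp add: g_def T_def norm_n_lin_n[OF Q])
  define G where "G = (\<integral>\<^sup>+x. g x \<partial>?R)"
  have "G = (\<integral>\<^sup>+x. indicator {x \<in> space ?R. norm_n n x \<le> 1} x \<partial>?R)"
    unfolding G_def g_def by (intro nn_integral_cong) (auto split: split_indicator)
  also have "\<dots> = ennreal (unit_ball_vol (real n))"
    by (subst nn_integral_indicator) (auto simp: emeasure_unit_ball_n)
  finally have G: "G = ennreal (unit_ball_vol (real n))" .
  have "unit_ball_vol (real n) > 0"
    by (rule unit_ball_vol_pos) simp
  then have G0: "G \<noteq> 0" "G \<noteq> \<infinity>"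
    unfolding G by (auto simp del: unit_ball_vol_pos)
  \<comment> \<open>Fubini, with the translation \<open>x \<mapsto> T y + x\<close> for \<open>\<mu>\<close> and a translation by a
  preimage of \<open>- x\<close> under \<open>T\<close> for the image measure\<close>
  have "(\<integral>\<^sup>+x. f x \<partial>?R) * G = (\<integral>\<^sup>+y. g (T y) * (\<integral>\<^sup>+x. f x \<partial>?R) \<partial>?R)"
    by (subst nn_integral_multc) (simp_all add: g_T G_def mult.commute)
  also have "\<dots> = (\<integral>\<^sup>+y. (\<integral>\<^sup>+x. g (T y) * f (add (T y) x) \<partial>?R) \<partial>?R)"
  proof (rule nn_integral_cong)
    fix y assume "y \<in> space ?R"
    have "g (T y) * (\<integral>\<^sup>+x. f x \<partial>?R) = g (T y) * (\<integral>\<^sup>+x. f (add (T y) x) \<partial>?R)"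
      by (subst transl[OF f, of "T y"]) (rule refl)
    also have "\<dots> = (\<integral>\<^sup>+x. g (T y) * f (add (T y) x) \<partial>?R)"
      by (rule nn_integral_cmult[symmetric]) measurable
    finally show "g (T y) * (\<integral>\<^sup>+x. f x \<partial>?R) = (\<integral>\<^sup>+x. g (T y) * f (add (T y) x) \<partial>?R)" .
  qed
  also have "\<dots> = (\<integral>\<^sup>+x. (\<integral>\<^sup>+y. g (T y) * f (add (T y) x) \<partial>?R) \<partial>?R)"
    by (rule RR.Fubini') measurable
  also have "\<dots> = (\<integral>\<^sup>+x. (\<integral>\<^sup>+y. g (add (neg x) (T y)) * f (T y) \<partial>?R) \<partial>?R)"
  proof (rule nn_integral_cong)
    fix x assume x: "x \<in> space ?R"
    let ?a = "?T' (neg x)"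
    have negx: "neg x \<in> space ?R"
      by (rule measurable_space[OF neg_m x])
    have 1: "T (add ?a y) = add (neg x) (T y)" for y
      using T_add[of ?a y] lin_n_transpose[OF Q negx] by (simp add: T_def)
    have 2: "add (add (neg x) (T y)) x = T y" for y
      using x by (auto simp: add_def neg_def T_def lin_n_def fun_eq_iff)
    have "(\<integral>\<^sup>+y. g (T y) * f (add (T y) x) \<partial>?R)
        = (\<integral>\<^sup>+y. g (T (add ?a y)) * f (add (T (add ?a y)) x) \<partial>?R)"
      by (rule transl) (use x in measurable)
    also have "\<dots> = (\<integral>\<^sup>+y. g (add (neg x) (T y)) * f (T y) \<partial>?R)"
      unfolding 1 2 ..
    finally show "(\<integral>\<^sup>+y. g (T y) * f (add (T y) x) \<partial>?R)
        = (\<integral>\<^sup>+y. g (add (neg x) (T y)) * f (T y) \<partial>?R)" .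
  qed
  also have "\<dots> = (\<integral>\<^sup>+y. (\<integral>\<^sup>+x. g (add (neg x) (T y)) * f (T y) \<partial>?R) \<partial>?R)"
    by (rule RR.Fubini') measurable
  also have "\<dots> = (\<integral>\<^sup>+y. G * f (T y) \<partial>?R)"
  proof (rule nn_integral_cong)
    fix y
    have "(\<integral>\<^sup>+x. g (add (neg x) (T y)) \<partial>?R) = (\<integral>\<^sup>+x. g (add x (T y)) \<partial>?R)"
      by (intro reflect[symmetric]) measurable
    also have "\<dots> = (\<integral>\<^sup>+x. g (add (T y) x) \<partial>?R)"
      by (simp add: add_def add.commute)
    also have "\<dots> = G"
      unfolding G_def by (rule transl[symmetric]) measurable
    finally have inner: "(\<integral>\<^sup>+x. g (add (neg x) (T y)) \<partial>?R) = G" .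
    have "(\<integral>\<^sup>+x. g (add (neg x) (T y)) * f (T y) \<partial>?R)
        = (\<integral>\<^sup>+x. g (add (neg x) (T y)) \<partial>?R) * f (T y)"
      by (intro nn_integral_multc) measurable
    then show "(\<integral>\<^sup>+x. g (add (neg x) (T y)) * f (T y) \<partial>?R) = G * f (T y)"
      unfolding inner .
  qed
  also have "\<dots> = G * (\<integral>\<^sup>+y. f (T y) \<partial>?R)"
    by (rule nn_integral_cmult) measurable
  finally have eq: "(\<integral>\<^sup>+x. f x \<partial>?R) * G = G * (\<integral>\<^sup>+y. f (T y) \<partial>?R)" .
  have "(\<integral>\<^sup>+x. f x \<partial>?R) = (\<integral>\<^sup>+x. f x \<partial>?R) * G / G"
    using G0 by (simp add: ennreal_mult_divide_eq)
  also have "\<dots> = (\<integral>\<^sup>+y. f (T y) \<partial>?R)"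
    unfolding eq using G0 by (subst mult.commute) (simp add: ennreal_mult_divide_eq)
  finally show ?thesis
    unfolding T_def by (rule sym)
qed

lemma nn_integral_uniform_sphere:
  assumes [measurable]: "F \<in> borel_measurable (Rn n)"
  shows "(\<integral>\<^sup>+x. F x \<partial>uniform_sphere n) =
    (\<integral>\<^sup>+x. F (\<lambda>i\<in>{..<n}. x i / norm_n n x) * indicator {..1} (norm_n n x) \<partial>Rn n)
      / ennreal (unit_ball_vol (real n))"
proof -
  let ?B = "{x \<in> space (Rn n). norm_n n x \<le> 1}"
  have "(\<integral>\<^sup>+x. F x \<partial>uniform_sphere n)
      = (\<integral>\<^sup>+x. F (\<lambda>i\<in>{..<n}. x i / norm_n n x) \<partial>uniform_measure (Rn n) ?B)"
    unfolding uniform_sphere_def by (rule nn_integral_distr) measurable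
  also have "\<dots> = (\<integral>\<^sup>+x. F (\<lambda>i\<in>{..<n}. x i / norm_n n x) * indicator ?B x \<partial>Rn n) / emeasure (Rn n) ?B"
    by (rule nn_integral_uniform_measure) measurable
  also have "(\<integral>\<^sup>+x. F (\<lambda>i\<in>{..<n}. x i / norm_n n x) * indicator ?B x \<partial>Rn n)
      = (\<integral>\<^sup>+x. F (\<lambda>i\<in>{..<n}. x i / norm_n n x) * indicator {..1} (norm_n n x) \<partial>Rn n)"
    by (intro nn_integral_cong) (auto split: split_indicator)
  finally show ?thesis by (simp add: emeasure_unit_ball_n)
qed

lemma sets_uniform_sphere [measurable_cong]: "sets (uniform_sphere n) = sets (Rn n)"
  by (simp add: uniform_sphere_def)

lemma nn_integral_uniform_sphere_orthogonal:
  fixes F :: "(nat \<Rightarrow> real) \<Rightarrow> ennreal"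
  assumes Q: "orthogonal_n n Q" and [measurable]: "F \<in> borel_measurable (Rn n)"
  shows "(\<integral>\<^sup>+x. F (lin_n n Q x) \<partial>uniform_sphere n) = (\<integral>\<^sup>+x. F x \<partial>uniform_sphere n)"
proof -
  let ?p = "\<lambda>x. \<lambda>i\<in>{..<n}. x i / norm_n n x"
  have p: "lin_n n Q (?p x) = ?p (lin_n n Q x)" for x
    by (auto simp: norm_n_lin_n[OF Q] fun_eq_iff)
       (auto simp: lin_n_def sum_divide_distrib)
  have "(\<integral>\<^sup>+x. F (lin_n n Q (?p x)) * indicator {..1} (norm_n n x) \<partial>Rn n)
      = (\<integral>\<^sup>+x. (\<lambda>x. F (?p x) * indicator {..1} (norm_n n x)) (lin_n n Q x) \<partial>Rn n)"
    unfolding p by (simp add: norm_n_lin_n[OF Q])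
  also have "\<dots> = (\<integral>\<^sup>+x. F (?p x) * indicator {..1} (norm_n n x) \<partial>Rn n)"
    by (rule nn_integral_Rn_orthogonal[OF Q]) measurable
  finally show ?thesis
    by (simp add: nn_integral_uniform_sphere)
qed

section \<open>The uniform measure on the sphere in cylindrical coordinates\<close>

text \<open>
  The density of \<open>x\<^sup>2\<close> when \<open>x\<close> ranges over the positive half-line with Lebesgue measure.
\<close>

definition half_weight :: "real \<Rightarrow> real" where
  "half_weight a = indicator {0<..} a / (2 * sqrt a)"

text \<open>
  The density of the arcsine law on the open unit interval, without the normalising factor
  \<open>1 / \<pi>\<close>.
\<close>

definition arc_weight :: "real \<Rightarrow> real" where
  "arc_weight p = indicator {0<..<1} p / sqrt (p * (1 - p))"

lemma measurable_half_weight [measurable]: "half_weight \<in> borel_measurable borel"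
  unfolding half_weight_def by measurable

lemma measurable_arc_weight [measurable]: "arc_weight \<in> borel_measurable borel"
  unfolding arc_weight_def by measurable

lemma half_weight_nonneg [simp]: "half_weight a \<ge> 0"
  by (auto simp: half_weight_def split: split_indicator)

lemma half_weight_nonpos: "a \<le> 0 \<Longrightarrow> half_weight a = 0"
  by (simp add: half_weight_def)

lemma arc_weight_nonneg [simp]: "arc_weight p \<ge> 0"
  by (auto simp: arc_weight_def split: split_indicator)

lemma nn_integral_LIMSEQ_atMost:
  fixes h :: "real \<Rightarrow> ennreal" and b :: "nat \<Rightarrow> real"
  assumes [measurable]: "h \<in> borel_measurable borel" and "mono b" and b: "filterlim b at_top sequentially"
  shows "(\<lambda>n. \<integral>\<^sup>+x. h x * indicator {..b n} x \<partial>lborel) \<longlonglongrightarrow> (\<integral>\<^sup>+x. h x \<partial>lborel)"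
proof (rule nn_integral_LIMSEQ)
  show "incseq (\<lambda>n x. h x * indicator {..b n} x)"
    using monoD[OF \<open>mono b\<close>]
    by (auto simp: incseq_def le_fun_def split: split_indicator intro: order_trans)
  show "(\<lambda>n. h x * indicator {..b n} x) \<longlonglongrightarrow> h x" for x
  proof (rule tendsto_eventually)
    have "\<forall>\<^sub>F n in sequentially. x \<le> b n"
      using b by (simp add: filterlim_at_top)
    then show "\<forall>\<^sub>F n in sequentially. h x * indicator {..b n} x = h x"
      by eventually_elim simp
  qed
qed measurable

lemma nn_integral_half_line_sqrt:
  fixes f :: "real \<Rightarrow> ennreal"
  assumes [measurable]: "f \<in> borel_measurable borel"
  shows "(\<integral>\<^sup>+x. f x * indicator {0<..} x \<partial>lborel) = (\<integral>\<^sup>+a. half_weight a * f (sqrt a) \<partial>lborel)"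
proof -
  let ?h = "\<lambda>a. ennreal (half_weight a) * f (sqrt a)"
  have eq: "(\<integral>\<^sup>+x. ?h x * indicator {..b\<^sup>2} x \<partial>lborel)
      = (\<integral>\<^sup>+x. (f x * indicator {0<..} x) * indicator {..b} x \<partial>lborel)" if b: "b > 0" for b
  proof -
    have "(\<integral>\<^sup>+x. ?h x * indicator {..b\<^sup>2} x \<partial>lborel) = (\<integral>\<^sup>+x. ?h x * indicator {0\<^sup>2..b\<^sup>2} x \<partial>lborel)"
      by (intro nn_integral_cong) (auto simp: half_weight_def split: split_indicator)
    also have "\<dots> = (\<integral>\<^sup>+x. ?h (x\<^sup>2) * ennreal (2 * x) * indicator {0..b} x \<partial>lborel)"
      by (rule nn_integral_substitution_aux)
         (use b in \<open>auto intro!: derivative_eq_intros continuous_intros\<close>)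
    also have "\<dots> = (\<integral>\<^sup>+x. (f x * indicator {0<..} x) * indicator {..b} x \<partial>lborel)"
    proof (rule nn_integral_cong)
      fix x :: real
      show "?h (x\<^sup>2) * ennreal (2 * x) * indicator {0..b} x = f x * indicator {0<..} x * indicator {..b} x"
      proof (cases "0 < x \<and> x \<le> b")
        case True
        have "ennreal (half_weight (x\<^sup>2)) * f x * ennreal (2 * x)
            = ennreal (half_weight (x\<^sup>2) * (2 * x)) * f x"
          using True by (subst ennreal_mult) (auto simp: mult_ac)
        also have "half_weight (x\<^sup>2) * (2 * x) = 1"
          using True by (simp add: half_weight_def)
        finally show ?thesis using True by simp
      next
        case False
        then show ?thesis by (cases "x = 0") (auto simp: half_weight_def split: split_indicator)
      qed
    qed
    finally show ?thesis .
  qed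
  have lim1: "(\<lambda>n. \<integral>\<^sup>+x. ?h x * indicator {..(real (Suc n))\<^sup>2} x \<partial>lborel) \<longlonglongrightarrow> (\<integral>\<^sup>+x. ?h x \<partial>lborel)"
  proof (rule nn_integral_LIMSEQ_atMost)
    show "mono (\<lambda>n. (real (Suc n))\<^sup>2)" by (auto simp: mono_def intro!: power_mono)
    show "filterlim (\<lambda>n. (real (Suc n))\<^sup>2) at_top sequentially"
      by (intro filterlim_pow_at_top filterlim_compose[OF filterlim_real_sequentially filterlim_Suc]) simp
  qed measurable
  have lim2: "(\<lambda>n. \<integral>\<^sup>+x. (f x * indicator {0<..} x) * indicator {..real (Suc n)} x \<partial>lborel)
      \<longlonglongrightarrow> (\<integral>\<^sup>+x. f x * indicator {0<..} x \<partial>lborel)"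
  proof (rule nn_integral_LIMSEQ_atMost)
    show "mono (\<lambda>n. real (Suc n))" by (auto simp: mono_def)
    show "filterlim (\<lambda>n. real (Suc n)) at_top sequentially"
      by (rule filterlim_compose[OF filterlim_real_sequentially filterlim_Suc])
  qed measurable
  show ?thesis
    using LIMSEQ_unique[OF lim1[unfolded eq[OF of_nat_0_less_iff[THEN iffD2, OF zero_less_Suc]]] lim2] by simp
qed

lemma nn_integral_lborel_sqrt:
  fixes f :: "real \<Rightarrow> ennreal"
  assumes [measurable]: "f \<in> borel_measurable borel"
  shows "(\<integral>\<^sup>+x. f x \<partial>lborel) = (\<Sum>e\<in>{-1, 1}. \<integral>\<^sup>+a. half_weight a * f (e * sqrt a) \<partial>lborel)"
proof -
  have "(\<integral>\<^sup>+x. f x \<partial>lborel) = (\<integral>\<^sup>+x. f x * indicator {0<..} x + f x * indicator {..<0} x \<partial>lborel)"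
  proof (rule nn_integral_cong_AE)
    show "AE x in lborel. f x = f x * indicator {0<..} x + f x * indicator {..<0} x"
      using AE_lborel_singleton[of 0] by eventually_elim (auto split: split_indicator)
  qed
  also have "\<dots> = (\<integral>\<^sup>+x. f x * indicator {0<..} x \<partial>lborel) + (\<integral>\<^sup>+x. f x * indicator {..<0} x \<partial>lborel)"
    by (rule nn_integral_add) measurable
  also have "(\<integral>\<^sup>+x. f x * indicator {..<0} x \<partial>lborel) = (\<integral>\<^sup>+x. f (- x) * indicator {..<0} (- x) \<partial>lborel)"
    by (subst nn_integral_real_affine[of _ "-1" 0]) auto
  also have "\<dots> = (\<integral>\<^sup>+x. f (- x) * indicator {0<..} x \<partial>lborel)"
    by (intro nn_integral_cong) (auto split: split_indicator)
  finally show ?thesis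
    by (simp add: nn_integral_half_line_sqrt add.commute)
qed

text \<open>
  Polar coordinates in the plane, with the angle replaced by the signs of the two coordinates and
  the fraction \<open>p\<close> of the squared radius \<open>\<tau>\<close> that the first one contributes.
\<close>

lemma nn_integral_plane:
  fixes h :: "real \<Rightarrow> real \<Rightarrow> ennreal"
  assumes h [measurable]: "case_prod h \<in> borel_measurable (borel \<Otimes>\<^sub>M borel)"
  shows "(\<integral>\<^sup>+x. \<integral>\<^sup>+y. h x y \<partial>lborel \<partial>lborel) =
    (\<Sum>e\<in>{-1, 1}. \<Sum>e'\<in>{-1, 1}. \<integral>\<^sup>+p. \<integral>\<^sup>+\<tau>. ennreal (arc_weight p / 4 * indicator {0<..} \<tau>) *
        h (e * sqrt (\<tau> * p)) (e' * sqrt (\<tau> * (1 - p))) \<partial>lborel \<partial>lborel)"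
proof -
  let ?L = "\<lambda>e e'. \<integral>\<^sup>+a. half_weight a * (\<integral>\<^sup>+b. half_weight b * h (e * sqrt a) (e' * sqrt b) \<partial>lborel) \<partial>lborel"
  let ?T = "\<lambda>e e' p \<tau>. ennreal (arc_weight p / 4 * indicator {0<..} \<tau>) *
        h (e * sqrt (\<tau> * p)) (e' * sqrt (\<tau> * (1 - p)))"
  let ?K = "\<lambda>e e' a \<tau>. half_weight a * (half_weight (\<tau> - a) * h (e * sqrt a) (e' * sqrt (\<tau> - a)))"
  have [measurable]: "(\<lambda>w. h (f w) (g w)) \<in> borel_measurable N"
    if "f \<in> borel_measurable N" "g \<in> borel_measurable N" for f g and N :: "'b measure"
    using measurable_compose[OF measurable_Pair[OF that] h] by simp
  have "(\<integral>\<^sup>+x. \<integral>\<^sup>+y. h x y \<partial>lborel \<partial>lborel) =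
      (\<Sum>e\<in>{-1, 1}. \<integral>\<^sup>+a. half_weight a * (\<integral>\<^sup>+y. h (e * sqrt a) y \<partial>lborel) \<partial>lborel)"
    by (rule nn_integral_lborel_sqrt) measurable
  also have "\<dots> = (\<Sum>e\<in>{-1, 1}. \<Sum>e'\<in>{-1, 1}. \<integral>\<^sup>+p. \<integral>\<^sup>+\<tau>. ?T e e' p \<tau> \<partial>lborel \<partial>lborel)"
  proof (rule sum.cong[OF refl])
    fix e :: real
    have "(\<integral>\<^sup>+a. half_weight a * (\<integral>\<^sup>+y. h (e * sqrt a) y \<partial>lborel) \<partial>lborel)
        = (\<integral>\<^sup>+a. (\<Sum>e'\<in>{-1, 1}. half_weight a * (\<integral>\<^sup>+b. half_weight b * h (e * sqrt a) (e' * sqrt b) \<partial>lborel)) \<partial>lborel)"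
      by (intro nn_integral_cong, subst nn_integral_lborel_sqrt) (measurable, rule sum_distrib_left)
    also have "\<dots> = (\<Sum>e'\<in>{-1, 1}. ?L e e')"
      by (rule nn_integral_sum) measurable
    also have "\<dots> = (\<Sum>e'\<in>{-1, 1}. \<integral>\<^sup>+p. \<integral>\<^sup>+\<tau>. ?T e e' p \<tau> \<partial>lborel \<partial>lborel)"
    proof (rule sum.cong[OF refl])
      fix e' :: real
      have "(?L e e')
          = (\<integral>\<^sup>+a. (\<integral>\<^sup>+\<tau>. ?K e e' a \<tau> \<partial>lborel) \<partial>lborel)"
      proof (rule nn_integral_cong)
        fix a :: real
        have "(\<integral>\<^sup>+b. half_weight b * h (e * sqrt a) (e' * sqrt b) \<partial>lborel)
            = (\<integral>\<^sup>+\<tau>. half_weight (\<tau> - a) * h (e * sqrt a) (e' * sqrt (\<tau> - a)) \<partial>lborel)"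
          by (subst nn_integral_real_affine[of _ 1 "- a"]) (auto simp: algebra_simps)
        then show "half_weight a * (\<integral>\<^sup>+b. half_weight b * h (e * sqrt a) (e' * sqrt b) \<partial>lborel)
            = (\<integral>\<^sup>+\<tau>. ?K e e' a \<tau> \<partial>lborel)"
          by (simp add: nn_integral_cmult)
      qed
      also have "\<dots> = (\<integral>\<^sup>+\<tau>. (\<integral>\<^sup>+a. ?K e e' a \<tau> \<partial>lborel) \<partial>lborel)"
        by (rule lborel_pair.Fubini') measurable
      also have "\<dots> = (\<integral>\<^sup>+\<tau>. (\<integral>\<^sup>+p. ?T e e' p \<tau> \<partial>lborel) \<partial>lborel)"
      proof (rule nn_integral_cong)
        fix \<tau> :: real
        show "(\<integral>\<^sup>+a. ?K e e' a \<tau> \<partial>lborel)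
          = (\<integral>\<^sup>+p. ?T e e' p \<tau> \<partial>lborel)"
        proof (cases "\<tau> > 0")
          case False
          then have *: "?K e e' a \<tau> = 0" for a
            by (auto simp: half_weight_def split: split_indicator)
          show ?thesis unfolding * using False by simp
        next
          case True
          have "(\<integral>\<^sup>+a. ?K e e' a \<tau> \<partial>lborel)
            = ennreal \<tau> * (\<integral>\<^sup>+p. ?K e e' (\<tau> * p) \<tau> \<partial>lborel)"
            using True by (subst nn_integral_real_affine[of _ \<tau> 0]) auto
          also have "\<dots> = (\<integral>\<^sup>+p. ennreal \<tau> * (?K e e' (\<tau> * p) \<tau>) \<partial>lborel)"
            by (rule nn_integral_cmult[symmetric]) measurable
          also have "\<dots> = (\<integral>\<^sup>+p. ?T e e' p \<tau> \<partial>lborel)"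
          proof (rule nn_integral_cong)
            fix p :: real
            have "\<tau> * (half_weight (\<tau> * p) * half_weight (\<tau> - \<tau> * p)) = arc_weight p / 4"
            proof (cases "0 < p \<and> p < 1")
              case p: True
              have pos: "\<tau> * p > 0" "\<tau> - \<tau> * p > 0"
                using True p by auto
              have "half_weight (\<tau> * p) * half_weight (\<tau> - \<tau> * p)
                  = 1 / (4 * (sqrt (\<tau> * p) * sqrt (\<tau> * (1 - p))))"
                using pos by (simp add: half_weight_def algebra_simps)
              also have "sqrt (\<tau> * p) * sqrt (\<tau> * (1 - p)) = \<tau> * sqrt (p * (1 - p))"
                using True by (simp add: real_sqrt_mult)
              finally show ?thesis
                using p True by (simp add: arc_weight_def)
            next
              case p: False
              have "\<tau> * p \<le> 0 \<or> \<tau> - \<tau> * p \<le> 0"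
                using True p mult_left_mono[of 1 p \<tau>] by (cases "p \<le> 0") (auto simp: mult_le_0_iff)
              then have "half_weight (\<tau> * p) * half_weight (\<tau> - \<tau> * p) = 0"
                using half_weight_nonpos by auto
              then show ?thesis
                using p by (simp add: arc_weight_def)
            qed
            then have w: "ennreal \<tau> * (ennreal (half_weight (\<tau> * p)) * (ennreal (half_weight (\<tau> - \<tau> * p)) * z))
                = ennreal (arc_weight p / 4) * z" for z
              using True by (metis ennreal_mult'' half_weight_nonneg mult.assoc)
            show "ennreal \<tau> * (?K e e' (\<tau> * p) \<tau>)
              = ?T e e' p \<tau>"
              unfolding w using True by (simp add: right_diff_distrib)
          qed
          finally show ?thesis .
        qed
      qed
      also have "\<dots> = (\<integral>\<^sup>+p. \<integral>\<^sup>+\<tau>. ?T e e' p \<tau> \<partial>lborel \<partial>lborel)"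
        by (rule lborel_pair.Fubini') measurable
      finally show "(?L e e')
          = (\<integral>\<^sup>+p. \<integral>\<^sup>+\<tau>. ?T e e' p \<tau> \<partial>lborel \<partial>lborel)" .
    qed
    finally show "(\<integral>\<^sup>+a. half_weight a * (\<integral>\<^sup>+y. h (e * sqrt a) y \<partial>lborel) \<partial>lborel)
      = (\<Sum>e'\<in>{-1, 1}. \<integral>\<^sup>+p. \<integral>\<^sup>+\<tau>. ?T e e' p \<tau> \<partial>lborel \<partial>lborel)" .
  qed
  finally show ?thesis .
qed

text \<open>
  The squared norm of the last \<open>n - 2\<close> coordinates. Vectors of these coordinates are points of the
  product space \<open>Rtail n\<close> over the index set \<open>{2..<n}\<close>.
\<close>

definition tail_sq :: "nat \<Rightarrow> (nat \<Rightarrow> real) \<Rightarrow> real" where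
  "tail_sq n v = (\<Sum>i\<in>{2..<n}. (v i)\<^sup>2)"

text \<open>
  The point of the unit sphere with tail \<open>v\<close>, signs \<open>e\<close> and \<open>e'\<close> of the coordinates 1 and 0, and a
  fraction \<open>p\<close> of the squared norm left over by \<open>v\<close> in coordinate 1. It is meant for signs
  \<open>\<plusminus>1\<close>, \<open>tail_sq n v \<le> 1\<close> and \<open>0 \<le> p \<le> 1\<close>; otherwise it need not lie on the sphere.
\<close>

definition sphere_pt :: "nat \<Rightarrow> real \<Rightarrow> real \<Rightarrow> real \<Rightarrow> (nat \<Rightarrow> real) \<Rightarrow> nat \<Rightarrow> real" where
  "sphere_pt n e e' p v =
     v(1 := e * sqrt ((1 - tail_sq n v) * p), 0 := e' * sqrt ((1 - tail_sq n v) * (1 - p)))"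

abbreviation Rtail :: "nat \<Rightarrow> (nat \<Rightarrow> real) measure" where
  "Rtail n \<equiv> Pi\<^sub>M {2..<n} (\<lambda>_. lborel)"

lemma tail_sq_nonneg [simp]: "tail_sq n v \<ge> 0"
  by (simp add: tail_sq_def sum_nonneg)

lemma measurable_tail_sq [measurable]: "tail_sq n \<in> borel_measurable (Rtail n)"
  unfolding tail_sq_def by measurable

lemma lessThan_index_split: "n \<ge> 2 \<Longrightarrow> {..<n} = insert 0 (insert 1 {2..<n::nat})"
  by auto

lemma sum_index_split:
  fixes f :: "nat \<Rightarrow> real"
  shows "n \<ge> 2 \<Longrightarrow> (\<Sum>i<n. f i) = f 0 + f 1 + (\<Sum>i\<in>{2..<n}. f i)"
  unfolding lessThan_index_split by simp

lemma measurable_upd2: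
  assumes "n \<ge> 2" and "v \<in> N \<rightarrow>\<^sub>M Rtail n" and "a \<in> borel_measurable N" and "b \<in> borel_measurable N"
  shows "(\<lambda>w. (v w)(1 := a w, 0 := b w)) \<in> N \<rightarrow>\<^sub>M Rn n"
  unfolding lessThan_index_split[OF assms(1)]
  by (intro measurable_fun_upd_insert assms(2)) (simp_all add: assms(3,4))

lemma nn_integral_Rn_split:
  assumes n: "n \<ge> 2" and G [measurable]: "G \<in> borel_measurable (Rn n)"
  shows "(\<integral>\<^sup>+x. G x \<partial>Rn n)
    = (\<integral>\<^sup>+v. \<integral>\<^sup>+x. \<integral>\<^sup>+y. G (v(1 := x, 0 := y)) \<partial>lborel \<partial>lborel \<partial>Rtail n)"
proof -
  let ?L = "\<lambda>_::nat. lborel :: real measure"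
  have G': "G \<in> borel_measurable (Pi\<^sub>M (insert 0 (insert 1 {2..<n})) ?L)"
    using G unfolding lessThan_index_split[OF n] .
  have "(\<integral>\<^sup>+x. G x \<partial>Rn n) = (\<integral>\<^sup>+w. \<integral>\<^sup>+y. G (w(0 := y)) \<partial>lborel \<partial>Pi\<^sub>M (insert 1 {2..<n}) ?L)"
    unfolding lessThan_index_split[OF n] by (rule lborel_product.product_nn_integral_insert[OF _ _ G']) auto
  also have "\<dots> = (\<integral>\<^sup>+v. \<integral>\<^sup>+x. \<integral>\<^sup>+y. G (v(1 := x, 0 := y)) \<partial>lborel \<partial>lborel \<partial>Rtail n)"
  proof (rule lborel_product.product_nn_integral_insert)
    have "(\<lambda>p. G ((fst p)(0 := snd p))) \<in> borel_measurable (Pi\<^sub>M (insert 1 {2..<n}) ?L \<Otimes>\<^sub>M lborel)"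
      by (rule measurable_compose[OF measurable_fun_upd_insert G']) simp_all
    then show "(\<lambda>w. \<integral>\<^sup>+y. G (w(0 := y)) \<partial>lborel) \<in> borel_measurable (Pi\<^sub>M (insert 1 {2..<n}) ?L)"
      by (intro lborel.borel_measurable_nn_integral) (simp add: split_beta')
  qed auto
  finally show ?thesis .
qed

text \<open>
  Archimedes' theorem: the last \<open>n - 2\<close> coordinates of a uniform point of the unit sphere in
  \<open>\<real>\<^sup>n\<close> are uniformly distributed in the unit ball, and given them the first two coordinates are
  uniformly distributed on the remaining circle.
\<close>

lemma nn_integral_uniform_sphere_tail:
  assumes n: "n \<ge> 2"
  obtains C :: ennreal where "C \<noteq> 0" "C \<noteq> \<infinity>"
    "\<And>F. F \<in> borel_measurable (Rn n) \<Longrightarrow> (\<integral>\<^sup>+x. F x \<partial>uniform_sphere n) =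
      C * (\<Sum>e\<in>{-1, 1}. \<Sum>e'\<in>{-1, 1}. \<integral>\<^sup>+v. \<integral>\<^sup>+p.
        ennreal (arc_weight p * indicator {..<1} (tail_sq n v)) * F (sphere_pt n e e' p v)
        \<partial>lborel \<partial>Rtail n)"
proof -
  let ?D = "\<lambda>F e e'. \<integral>\<^sup>+v. \<integral>\<^sup>+p.
      ennreal (arc_weight p * indicator {..<1} (tail_sq n v)) * F (sphere_pt n e e' p v) \<partial>lborel \<partial>Rtail n"
  let ?V = "ennreal (unit_ball_vol (real n))"
  have "unit_ball_vol (real n) > 0"
    by (rule unit_ball_vol_pos) simp
  then have V: "?V \<noteq> 0" "?V \<noteq> \<infinity>" by (auto simp del: unit_ball_vol_pos)
  \<comment> \<open>the radial integral: \<open>\<tau>\<close> is the squared norm, and scaling the tail by \<open>sqrt \<tau>\<close> has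
  Jacobian \<open>sqrt \<tau> ^ (n - 2)\<close>\<close>
  define c0 where "c0 = (\<integral>\<^sup>+\<tau>. ennreal (indicator {0<..1} \<tau> * sqrt \<tau> ^ (n - 2)) \<partial>lborel)"
  have "c0 \<le> (\<integral>\<^sup>+\<tau>. indicator {0<..1} \<tau> \<partial>(lborel::real measure))"
    unfolding c0_def by (intro nn_integral_mono) (auto split: split_indicator simp: power_le_one)
  then have "c0 \<le> 1" by simp
  then have c0_fin: "c0 \<noteq> \<infinity>" by (auto simp: top_unique)
  have c0_pos: "c0 \<noteq> 0"
  proof
    assume "c0 = 0"
    then have "AE \<tau> in lborel. ennreal (indicator {0<..1} \<tau> * sqrt \<tau> ^ (n - 2)) = 0"
      unfolding c0_def by (subst (asm) nn_integral_0_iff_AE) auto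
    then have "AE \<tau> in lborel. \<tau> \<notin> {0<..1::real}"
    proof eventually_elim
      case (elim \<tau>)
      show ?case
      proof
        assume \<tau>: "\<tau> \<in> {0<..1}"
        then have "sqrt \<tau> ^ (n - 2) > 0" by simp
        moreover have "ennreal (sqrt \<tau> ^ (n - 2)) = 0" using elim \<tau> by simp
        ultimately show False by (simp only: ennreal_eq_0_iff)
      qed
    qed
    then have "{0<..1::real} \<in> null_sets lborel"
      by (subst (asm) AE_iff_null_sets[symmetric]) auto
    then show False by (auto simp: null_sets_def)
  qed
  define C where "C = c0 / 4 / ?V"
  have C: "C \<noteq> 0" "C \<noteq> \<infinity>"
    using V c0_fin c0_pos by (auto simp: C_def ennreal_divide_eq_0_iff ennreal_divide_eq_top_iff ennreal_mult_eq_top_iff)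
  interpret R: sigma_finite_measure "Rtail n"
    by (rule lborel_product.sigma_finite) simp
  interpret RL: pair_sigma_finite "Rtail n" "lborel :: real measure" ..
  interpret LR: pair_sigma_finite "lborel :: real measure" "Rtail n" ..
  have main: "(\<integral>\<^sup>+x. F x \<partial>uniform_sphere n) =
      C * (\<Sum>e\<in>{-1, 1}. \<Sum>e'\<in>{-1, 1}. ?D F e e')"
    if F: "F \<in> borel_measurable (Rn n)" for F
  proof -
    have Fm [measurable]: "(\<lambda>w. F ((v w)(1 := a w, 0 := b w))) \<in> borel_measurable N"
      if "v \<in> N \<rightarrow>\<^sub>M Rtail n" "a \<in> borel_measurable N" "b \<in> borel_measurable N"
      for v a b and N :: "'b measure"
      by (rule measurable_compose[OF measurable_upd2[OF n that] F])
    define G where "G x = F (\<lambda>i\<in>{..<n}. x i / norm_n n x) * indicator {..1} (norm_n n x)" for x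
    have G: "G \<in> borel_measurable (Rn n)"
      using F unfolding G_def by measurable
    have Gm [measurable]: "(\<lambda>w. G ((v w)(1 := a w, 0 := b w))) \<in> borel_measurable N"
      if "v \<in> N \<rightarrow>\<^sub>M Rtail n" "a \<in> borel_measurable N" "b \<in> borel_measurable N"
      for v a b and N :: "'b measure"
      by (rule measurable_compose[OF measurable_upd2[OF n that] G])
    have "(\<integral>\<^sup>+x. F x \<partial>uniform_sphere n) = (\<integral>\<^sup>+x. G x \<partial>Rn n) / ?V"
      unfolding G_def by (rule nn_integral_uniform_sphere[OF F])
    also have "(\<integral>\<^sup>+x. G x \<partial>Rn n)
      = (\<integral>\<^sup>+v. \<integral>\<^sup>+x. \<integral>\<^sup>+y. G (v(1 := x, 0 := y)) \<partial>lborel \<partial>lborel \<partial>Rtail n)"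
      by (rule nn_integral_Rn_split[OF n G])
    also have "\<dots> = (\<integral>\<^sup>+v. (\<Sum>e\<in>{-1, 1}. \<Sum>e'\<in>{-1, 1}. \<integral>\<^sup>+p. \<integral>\<^sup>+\<tau>.
        ennreal (arc_weight p / 4 * indicator {0<..} \<tau>) *
        G (v(1 := e * sqrt (\<tau> * p), 0 := e' * sqrt (\<tau> * (1 - p)))) \<partial>lborel \<partial>lborel) \<partial>Rtail n)"
    proof (intro nn_integral_cong nn_integral_plane)
      fix v assume "v \<in> space (Rtail n)"
      then show "(\<lambda>(x, y). G (v(1 := x, 0 := y))) \<in> borel_measurable (borel \<Otimes>\<^sub>M borel)"
        unfolding split_beta' by (intro Gm) auto
    qed
    also have "\<dots> = (\<Sum>e\<in>{-1, 1}. \<Sum>e'\<in>{-1, 1}. \<integral>\<^sup>+v. \<integral>\<^sup>+p. \<integral>\<^sup>+\<tau>.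
        ennreal (arc_weight p / 4 * indicator {0<..} \<tau>) *
        G (v(1 := e * sqrt (\<tau> * p), 0 := e' * sqrt (\<tau> * (1 - p)))) \<partial>lborel \<partial>lborel \<partial>Rtail n)"
      by (subst nn_integral_sum, measurable, rule sum.cong[OF refl], rule nn_integral_sum, measurable)
    also have "\<dots> = (\<Sum>e\<in>{-1, 1}. \<Sum>e'\<in>{-1, 1}. c0 / 4 * (?D F e e'))"
    proof (intro sum.cong refl)
      fix e e' :: real assume "e \<in> {-1, 1}" "e' \<in> {-1, 1}"
      then have ee: "e\<^sup>2 = 1" "e'\<^sup>2 = 1" by auto
      let ?g = "\<lambda>v p \<tau>. G (v(1 := e * sqrt (\<tau> * p), 0 := e' * sqrt (\<tau> * (1 - p))))"
      have inner: "(\<integral>\<^sup>+v. \<integral>\<^sup>+\<tau>. indicator {0<..} \<tau> * ?g v p \<tau> \<partial>lborel \<partial>Rtail n)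
        = c0 * (\<integral>\<^sup>+v. indicator {..<1} (tail_sq n v) * F (sphere_pt n e e' p v) \<partial>Rtail n)"
        if p: "0 < p" "p < 1" for p
      proof -
        let ?f = "\<lambda>v \<tau>. F ((\<lambda>i\<in>{2..<n}. v i / sqrt \<tau>)
            (1 := e * sqrt ((\<tau> - tail_sq n v) * p) / sqrt \<tau>,
             0 := e' * sqrt ((\<tau> - tail_sq n v) * (1 - p)) / sqrt \<tau>))"
        let ?I = "\<integral>\<^sup>+v. indicator {..<1} (tail_sq n v) * F (sphere_pt n e e' p v) \<partial>Rtail n"
        have Gpt: "indicator {0<..} \<tau> * ?g v p \<tau>
          = indicator {0<..} \<tau> * indicator {..1} (\<tau> + tail_sq n v) *
            F ((\<lambda>i\<in>{2..<n}. v i / sqrt (\<tau> + tail_sq n v))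
              (1 := e * sqrt (\<tau> * p) / sqrt (\<tau> + tail_sq n v),
               0 := e' * sqrt (\<tau> * (1 - p)) / sqrt (\<tau> + tail_sq n v)))" (is "_ = _ * _ * F ?z")
          for v \<tau>
        proof (cases "\<tau> > 0")
          case True
          let ?x = "v(1 := e * sqrt (\<tau> * p), 0 := e' * sqrt (\<tau> * (1 - p)))"
          have "(\<Sum>i<n. (?x i)\<^sup>2) = \<tau> + tail_sq n v"
            unfolding sum_index_split[OF n] tail_sq_def using True p ee
            by (simp add: power_mult_distrib algebra_simps)
          then have nx: "norm_n n ?x = sqrt (\<tau> + tail_sq n v)"
            by (simp add: norm_n_def)
          have "(\<lambda>i\<in>{..<n}. ?x i / norm_n n ?x) = ?z"
            using n unfolding nx by (auto simp: fun_eq_iff)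
          then show ?thesis
            unfolding G_def nx by (simp add: indicator_def)
        qed simp
        \<comment> \<open>shift \<open>\<tau>\<close> from the squared norm of the first two coordinates to that of the whole vector\<close>
        have "(\<integral>\<^sup>+v. \<integral>\<^sup>+\<tau>. indicator {0<..} \<tau> * ?g v p \<tau> \<partial>lborel \<partial>Rtail n)
          = (\<integral>\<^sup>+v. \<integral>\<^sup>+\<tau>. indicator {tail_sq n v<..1} \<tau> * ?f v \<tau> \<partial>lborel \<partial>Rtail n)"
          unfolding Gpt
        proof (rule nn_integral_cong)
          fix v assume [measurable]: "v \<in> space (Rtail n)"
          show "(\<integral>\<^sup>+\<tau>. indicator {0<..} \<tau> * indicator {..1} (\<tau> + tail_sq n v) *
            F ((\<lambda>i\<in>{2..<n}. v i / sqrt (\<tau> + tail_sq n v))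
              (1 := e * sqrt (\<tau> * p) / sqrt (\<tau> + tail_sq n v),
               0 := e' * sqrt (\<tau> * (1 - p)) / sqrt (\<tau> + tail_sq n v))) \<partial>lborel)
            = (\<integral>\<^sup>+\<tau>. indicator {tail_sq n v<..1} \<tau> * ?f v \<tau> \<partial>lborel)"
          proof (subst (2) nn_integral_real_affine[of _ 1 "tail_sq n v"])
            show "(\<lambda>\<tau>. indicator {tail_sq n v<..1} \<tau> * ?f v \<tau>) \<in> borel_measurable borel"
              by (intro borel_measurable_times_ennreal Fm) measurable
          qed (auto simp: add.commute intro!: nn_integral_cong split: split_indicator)
        qed
        also have "\<dots> = (\<integral>\<^sup>+\<tau>. \<integral>\<^sup>+v. indicator {tail_sq n v<..1} \<tau> * ?f v \<tau> \<partial>Rtail n \<partial>lborel)"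
          by (rule RL.Fubini'[symmetric]) (unfold greaterThanAtMost_def greaterThan_def atMost_def indicator_def split_beta', measurable)
        also have "\<dots> = (\<integral>\<^sup>+\<tau>. ennreal (indicator {0<..1} \<tau> * sqrt \<tau> ^ (n - 2)) * ?I \<partial>lborel)"
        proof (rule nn_integral_cong)
          fix \<tau> :: real
          show "(\<integral>\<^sup>+v. indicator {tail_sq n v<..1} \<tau> * ?f v \<tau> \<partial>Rtail n)
            = ennreal (indicator {0<..1} \<tau> * sqrt \<tau> ^ (n - 2)) *
            ?I"
          proof (cases "0 < \<tau> \<and> \<tau> \<le> 1")
            case False
            then have "indicator {tail_sq n v<..1} \<tau> = (0::ennreal)" for v
              using tail_sq_nonneg[of n v] by (auto split: split_indicator simp del: tail_sq_nonneg)
            then show ?thesis using False by simp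
          next
            case True
            let ?s = "sqrt \<tau>"
            have s: "?s > 0" "?s\<^sup>2 = \<tau>" using True by auto
            have scale: "tail_sq n (\<lambda>i\<in>{2..<n}. 0 + ?s * v i) = \<tau> * tail_sq n v" for v
              using s by (simp add: tail_sq_def power_mult_distrib sum_distrib_left)
            have pt: "(\<lambda>i\<in>{2..<n}. (\<lambda>i\<in>{2..<n}. 0 + ?s * v i) i / ?s)
              (1 := e * sqrt ((\<tau> - \<tau> * tail_sq n v) * p) / ?s,
               0 := e' * sqrt ((\<tau> - \<tau> * tail_sq n v) * (1 - p)) / ?s) = sphere_pt n e e' p v"
              if v: "v \<in> space (Rtail n)" for v
            proof -
              have "\<tau> - \<tau> * tail_sq n v = \<tau> * (1 - tail_sq n v)" by (simp add: algebra_simps)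
              moreover have "v i = undefined" if "i \<notin> {2..<n}" for i
                using v that PiE_arb[of v "{2..<n}" "\<lambda>_. UNIV" i] by (simp add: space_PiM)
              ultimately show ?thesis
                using s by (auto simp: fun_eq_iff sphere_pt_def real_sqrt_mult mult.assoc)
            qed
            \<comment> \<open>for fixed squared norm \<open>\<tau>\<close>, rescale the tail to that of a unit vector\<close>
            define H where "H v = indicator {tail_sq n v<..1} \<tau> *
              F ((\<lambda>i\<in>{2..<n}. v i / ?s)
                (1 := e * sqrt ((\<tau> - tail_sq n v) * p) / ?s,
                 0 := e' * sqrt ((\<tau> - tail_sq n v) * (1 - p)) / ?s))" for v
            have ind: "indicator {tail_sq n v<..1} \<tau> = (indicator {..<\<tau>} (tail_sq n v) :: ennreal)" for v
              using True by (auto split: split_indicator)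
            have H: "H \<in> borel_measurable (Rtail n)"
              unfolding H_def ind by (intro borel_measurable_times_ennreal Fm) measurable
            have HH: "H (\<lambda>i\<in>{2..<n}. 0 + ?s * v i) = indicator {..<1} (tail_sq n v) * F (sphere_pt n e e' p v)"
              if v: "v \<in> space (Rtail n)" for v
              unfolding H_def scale pt[OF v] using True by (simp add: indicator_def)
            have "(\<integral>\<^sup>+v. H v \<partial>Rtail n)
              = ennreal (\<bar>?s\<bar> ^ card {2..<n}) * (\<integral>\<^sup>+v. H (\<lambda>i\<in>{2..<n}. 0 + ?s * v i) \<partial>Rtail n)"
              using s by (intro nn_integral_PiM_lborel_affine H) auto
            also have "(\<integral>\<^sup>+v. H (\<lambda>i\<in>{2..<n}. 0 + ?s * v i) \<partial>Rtail n)
              = ?I"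
              by (rule nn_integral_cong) (rule HH)
            finally show ?thesis using True s by (simp add: H_def)
          qed
        qed
        also have "\<dots> = c0 * ?I"
          unfolding c0_def by (rule nn_integral_multc) measurable
        finally show ?thesis .
      qed
      have [measurable]: "(\<lambda>(v, p). F (sphere_pt n e e' p v)) \<in> borel_measurable (Rtail n \<Otimes>\<^sub>M lborel)"
        "(\<lambda>(p, v). F (sphere_pt n e e' p v)) \<in> borel_measurable (lborel \<Otimes>\<^sub>M Rtail n)"
        "(\<lambda>v. F (sphere_pt n e e' p v)) \<in> borel_measurable (Rtail n)" for p
        unfolding sphere_pt_def split_beta' by measurable
      have "(\<integral>\<^sup>+v. \<integral>\<^sup>+p. \<integral>\<^sup>+\<tau>. ennreal (arc_weight p / 4 * indicator {0<..} \<tau>) * ?g v p \<tau> \<partial>lborel \<partial>lborel \<partial>Rtail n)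
        = (\<integral>\<^sup>+p. \<integral>\<^sup>+v. \<integral>\<^sup>+\<tau>. ennreal (arc_weight p / 4 * indicator {0<..} \<tau>) * ?g v p \<tau> \<partial>lborel \<partial>Rtail n \<partial>lborel)"
        by (rule RL.Fubini'[symmetric]) (unfold split_beta', measurable)
      also have "\<dots> = (\<integral>\<^sup>+p. ennreal (arc_weight p / 4) * (\<integral>\<^sup>+v. \<integral>\<^sup>+\<tau>. indicator {0<..} \<tau> * ?g v p \<tau> \<partial>lborel \<partial>Rtail n) \<partial>lborel)"
      proof (rule nn_integral_cong)
        fix p :: real
        have "(\<integral>\<^sup>+v. \<integral>\<^sup>+\<tau>. ennreal (arc_weight p / 4 * indicator {0<..} \<tau>) * ?g v p \<tau> \<partial>lborel \<partial>Rtail n)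
          = (\<integral>\<^sup>+v. \<integral>\<^sup>+\<tau>. ennreal (arc_weight p / 4) * (indicator {0<..} \<tau> * ?g v p \<tau>) \<partial>lborel \<partial>Rtail n)"
          by (intro nn_integral_cong) (simp split: split_indicator)
        also have "\<dots> = (\<integral>\<^sup>+v. ennreal (arc_weight p / 4) * (\<integral>\<^sup>+\<tau>. indicator {0<..} \<tau> * ?g v p \<tau> \<partial>lborel) \<partial>Rtail n)"
          by (rule nn_integral_cong, rule nn_integral_cmult, measurable)
        also have "\<dots> = ennreal (arc_weight p / 4) * (\<integral>\<^sup>+v. \<integral>\<^sup>+\<tau>. indicator {0<..} \<tau> * ?g v p \<tau> \<partial>lborel \<partial>Rtail n)"
          by (rule nn_integral_cmult) measurable
        finally show "(\<integral>\<^sup>+v. \<integral>\<^sup>+\<tau>. ennreal (arc_weight p / 4 * indicator {0<..} \<tau>) * ?g v p \<tau> \<partial>lborel \<partial>Rtail n)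
          = ennreal (arc_weight p / 4) * (\<integral>\<^sup>+v. \<integral>\<^sup>+\<tau>. indicator {0<..} \<tau> * ?g v p \<tau> \<partial>lborel \<partial>Rtail n)" .
      qed
      also have "\<dots> = (\<integral>\<^sup>+p. c0 / 4 * (\<integral>\<^sup>+v. ennreal (arc_weight p * indicator {..<1} (tail_sq n v)) *
          F (sphere_pt n e e' p v) \<partial>Rtail n) \<partial>lborel)"
      proof (rule nn_integral_cong)
        fix p :: real
        show "ennreal (arc_weight p / 4) * (\<integral>\<^sup>+v. \<integral>\<^sup>+\<tau>. indicator {0<..} \<tau> * ?g v p \<tau> \<partial>lborel \<partial>Rtail n)
          = c0 / 4 * (\<integral>\<^sup>+v. ennreal (arc_weight p * indicator {..<1} (tail_sq n v)) *
          F (sphere_pt n e e' p v) \<partial>Rtail n)"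
        proof (cases "0 < p \<and> p < 1")
          case False
          then have "arc_weight p = 0" by (auto simp: arc_weight_def)
          then show ?thesis by simp
        next
          case True
          let ?I = "\<integral>\<^sup>+v. indicator {..<1} (tail_sq n v) * F (sphere_pt n e e' p v) \<partial>Rtail n"
          have "ennreal (arc_weight p / 4) = ennreal (arc_weight p) / 4"
            by (simp add: divide_ennreal[symmetric])
          then have "ennreal (arc_weight p / 4) * (c0 * ?I) = c0 / 4 * (ennreal (arc_weight p) * ?I)"
            by (simp add: ennreal_times_divide ennreal_divide_times mult_ac)
          also have "ennreal (arc_weight p) * ?I = (\<integral>\<^sup>+v. ennreal (arc_weight p) *
              (indicator {..<1} (tail_sq n v) * F (sphere_pt n e e' p v)) \<partial>Rtail n)"
            by (rule nn_integral_cmult[symmetric]) measurable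
          also have "\<dots> = (\<integral>\<^sup>+v. ennreal (arc_weight p * indicator {..<1} (tail_sq n v)) *
              F (sphere_pt n e e' p v) \<partial>Rtail n)"
            by (intro nn_integral_cong) (simp split: split_indicator)
          finally show ?thesis
            using inner[of p] True by simp
        qed
      qed
      also have "\<dots> = c0 / 4 * (\<integral>\<^sup>+p. \<integral>\<^sup>+v. ennreal (arc_weight p * indicator {..<1} (tail_sq n v)) *
          F (sphere_pt n e e' p v) \<partial>Rtail n \<partial>lborel)"
        by (rule nn_integral_cmult) measurable
      also have "(\<integral>\<^sup>+p. \<integral>\<^sup>+v. ennreal (arc_weight p * indicator {..<1} (tail_sq n v)) *
          F (sphere_pt n e e' p v) \<partial>Rtail n \<partial>lborel)
        = (?D F e e')"
        by (rule RL.Fubini') measurable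
      finally show "(\<integral>\<^sup>+v. \<integral>\<^sup>+p. \<integral>\<^sup>+\<tau>. ennreal (arc_weight p / 4 * indicator {0<..} \<tau>) * ?g v p \<tau> \<partial>lborel \<partial>lborel \<partial>Rtail n)
        = c0 / 4 * (?D F e e')" .
    qed
    also have "\<dots> / ?V = C * (\<Sum>e\<in>{-1, 1}. \<Sum>e'\<in>{-1, 1}. ?D F e e')"
    proof -
      have "c0 / 4 * S / ?V = C * S" for S
        unfolding C_def divide_ennreal_def by (simp add: mult_ac)
      then show ?thesis
        by (simp only: sum_distrib_left[symmetric])
    qed
    finally show ?thesis .
  qed
  show thesis by (rule that[OF C main])
qed

section \<open>Independent centred Gaussian coordinates\<close>

text \<open>
  The centred normal distribution with standard deviation \<open>s\<close>.
\<close>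

definition normal_measure :: "real \<Rightarrow> real measure" where
  "normal_measure s = density lborel (\<lambda>x. ennreal (normal_density 0 s x))"

text \<open>
  Independent centred normal coordinates, indexed by \<open>I\<close>, with standard deviations \<open>s i\<close>.
\<close>

definition gauss :: "nat set \<Rightarrow> (nat \<Rightarrow> real) \<Rightarrow> (nat \<Rightarrow> real) measure" where
  "gauss I s = Pi\<^sub>M I (\<lambda>i. normal_measure (s i))"

lemma sets_normal_measure [simp, measurable_cong]: "sets (normal_measure s) = sets borel"
  by (simp add: normal_measure_def)

lemma space_normal_measure [simp]: "space (normal_measure s) = UNIV"
  by (simp add: normal_measure_def)

lemma prob_space_normal_measure: "s > 0 \<Longrightarrow> prob_space (normal_measure s)"
  unfolding normal_measure_def by (rule prob_space_normal_density)

lemma sets_gauss [measurable_cong]: "sets (gauss I s) = sets (Pi\<^sub>M I (\<lambda>_. lborel))"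
  unfolding gauss_def by (intro sets_PiM_cong) auto

lemma prob_space_gauss: "(\<And>i. s i > 0) \<Longrightarrow> prob_space (gauss I s)"
  unfolding gauss_def by (intro prob_space_PiM prob_space_normal_measure)

lemma gauss_eq_density:
  assumes I: "finite I" and s: "\<And>i. s i > 0"
  shows "gauss I s = density (Pi\<^sub>M I (\<lambda>_. lborel)) (\<lambda>v. \<Prod>i\<in>I. ennreal (normal_density 0 (s i) (v i)))"
proof -
  interpret N: product_prob_space "\<lambda>i. normal_measure (s i)" I
    by (intro product_prob_spaceI prob_space_normal_measure s)
  let ?d = "\<lambda>v. \<Prod>i\<in>I. ennreal (normal_density 0 (s i) (v i))"
  have "density (Pi\<^sub>M I (\<lambda>_. lborel)) ?d = Pi\<^sub>M I (\<lambda>i. normal_measure (s i))"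
  proof (rule N.PiM_eqI[OF I])
    show "sets (density (Pi\<^sub>M I (\<lambda>_. lborel)) ?d) = sets (Pi\<^sub>M I (\<lambda>i. normal_measure (s i)))"
      by (simp, intro sets_PiM_cong) auto
    fix A assume A: "\<And>i. i \<in> I \<Longrightarrow> A i \<in> sets (normal_measure (s i))"
    have AI: "Pi\<^sub>E I A \<in> sets (Pi\<^sub>M I (\<lambda>_. lborel :: real measure))"
      using A I by (intro sets_PiM_I_finite) auto
    have "emeasure (density (Pi\<^sub>M I (\<lambda>_. lborel)) ?d) (Pi\<^sub>E I A)
        = (\<integral>\<^sup>+v. ?d v * indicator (Pi\<^sub>E I A) v \<partial>Pi\<^sub>M I (\<lambda>_. lborel))"
      by (rule emeasure_density[OF _ AI]) measurable
    also have "\<dots> = (\<integral>\<^sup>+v. (\<Prod>i\<in>I. ennreal (normal_density 0 (s i) (v i)) * indicator (A i) (v i)) \<partial>Pi\<^sub>M I (\<lambda>_. lborel))"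
    proof (rule nn_integral_cong)
      fix v :: "_ \<Rightarrow> real" assume "v \<in> space (Pi\<^sub>M I (\<lambda>_. lborel))"
      then have "v \<in> Pi\<^sub>E I A \<longleftrightarrow> (\<forall>i\<in>I. v i \<in> A i)"
        by (auto simp: space_PiM PiE_iff)
      then have "indicator (Pi\<^sub>E I A) v = (\<Prod>i\<in>I. indicator (A i) (v i) :: ennreal)"
        using I by (auto simp: indicator_def prod_zero_iff)
      then show "?d v * indicator (Pi\<^sub>E I A) v
          = (\<Prod>i\<in>I. ennreal (normal_density 0 (s i) (v i)) * indicator (A i) (v i))"
        by (simp add: prod.distrib)
    qed
    also have "\<dots> = (\<Prod>i\<in>I. \<integral>\<^sup>+x. ennreal (normal_density 0 (s i) x) * indicator (A i) x \<partial>lborel)"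
      using A by (intro lborel_product.product_nn_integral_prod I) auto
    also have "\<dots> = (\<Prod>i\<in>I. emeasure (normal_measure (s i)) (A i))"
      unfolding normal_measure_def using A
      by (intro prod.cong refl emeasure_density[symmetric]) auto
    finally show "emeasure (density (Pi\<^sub>M I (\<lambda>_. lborel)) ?d) (Pi\<^sub>E I A)
        = (\<Prod>i\<in>I. emeasure (normal_measure (s i)) (A i))" .
  qed
  then show ?thesis by (simp add: gauss_def)
qed

lemma nn_integral_gauss:
  assumes I: "finite I" and s: "\<And>i. s i > 0"
    and [measurable]: "f \<in> borel_measurable (Pi\<^sub>M I (\<lambda>_. lborel))"
  shows "(\<integral>\<^sup>+v. f v \<partial>gauss I s) = ennreal (\<Prod>i\<in>I. 1 / sqrt (2 * pi * (s i)\<^sup>2)) *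
    (\<integral>\<^sup>+v. ennreal (exp (- (\<Sum>i\<in>I. (v i)\<^sup>2 / (2 * (s i)\<^sup>2)))) * f v \<partial>Pi\<^sub>M I (\<lambda>_. lborel))"
proof -
  have d: "(\<Prod>i\<in>I. ennreal (normal_density 0 (s i) (v i)))
      = ennreal (\<Prod>i\<in>I. 1 / sqrt (2 * pi * (s i)\<^sup>2)) * ennreal (exp (- (\<Sum>i\<in>I. (v i)\<^sup>2 / (2 * (s i)\<^sup>2))))" for v
  proof -
    have "(\<Prod>i\<in>I. ennreal (normal_density 0 (s i) (v i))) = ennreal (\<Prod>i\<in>I. normal_density 0 (s i) (v i))"
      by (rule prod_ennreal) simp
    also have "(\<Prod>i\<in>I. normal_density 0 (s i) (v i))
        = (\<Prod>i\<in>I. 1 / sqrt (2 * pi * (s i)\<^sup>2)) * exp (- (\<Sum>i\<in>I. (v i)\<^sup>2 / (2 * (s i)\<^sup>2)))"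
      using I by (simp add: normal_density_def prod.distrib exp_sum sum_negf[symmetric] prod_dividef)
    finally show ?thesis
      by (simp add: ennreal_mult prod_nonneg)
  qed
  show ?thesis
    unfolding gauss_eq_density[OF I s] d
    by (subst nn_integral_density)
       (measurable, simp add: nn_integral_cmult[symmetric] mult.assoc)
qed

text \<open>
  The variance of a sum of independent centred variables is the sum of the variances.
\<close>

lemma product_sum_second_moment:
  fixes M :: "'i \<Rightarrow> 'a measure" and g :: "'i \<Rightarrow> 'a \<Rightarrow> real"
  assumes I: "finite I" and M: "\<And>i. prob_space (M i)"
    and int: "\<And>i. i \<in> I \<Longrightarrow> integrable (M i) (g i)"
    and int2: "\<And>i. i \<in> I \<Longrightarrow> integrable (M i) (\<lambda>x. (g i x)\<^sup>2)"
    and mean: "\<And>i. i \<in> I \<Longrightarrow> (\<integral>x. g i x \<partial>M i) = 0"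
  shows "integrable (Pi\<^sub>M I M) (\<lambda>x. (\<Sum>i\<in>I. g i (x i))\<^sup>2)"
    and "(\<integral>x. (\<Sum>i\<in>I. g i (x i))\<^sup>2 \<partial>Pi\<^sub>M I M) = (\<Sum>i\<in>I. \<integral>x. (g i x)\<^sup>2 \<partial>M i)"
proof -
  interpret P: product_prob_space M I
    by (intro product_prob_spaceI M)
  \<comment> \<open>\<open>g i (x i) * g k (x k)\<close> as a product over all coordinates \<open>j\<close>\<close>
  define h where "h i k j x = (if j = i then g i x else 1) * (if j = k then g k x else 1)" for i k j x
  have prod_h: "(\<Prod>j\<in>I. h i k j (x j)) = g i (x i) * g k (x k)" if "i \<in> I" "k \<in> I" for i k x
    using that I by (simp add: h_def prod.distrib prod.delta if_distrib[of "\<lambda>f. f _"] cong: if_cong)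
  have int_h: "integrable (M j) (h i k j)" if "j \<in> I" "i \<in> I" "k \<in> I" for i j k
  proof -
    interpret prob_space "M j" by (rule M)
    show ?thesis
      using int[OF that(1)] int2[OF that(1)]
      by (cases "j = i"; cases "j = k") (auto simp: h_def[abs_def] power2_eq_square)
  qed
  have E: "integrable (Pi\<^sub>M I M) (\<lambda>x. g i (x i) * g k (x k)) \<and>
      (\<integral>x. g i (x i) * g k (x k) \<partial>Pi\<^sub>M I M) = (if i = k then \<integral>x. (g i x)\<^sup>2 \<partial>M i else 0)"
    if ik: "i \<in> I" "k \<in> I" for i k
  proof -
    have "integrable (Pi\<^sub>M I M) (\<lambda>x. \<Prod>j\<in>I. h i k j (x j))"
      using int_h ik by (intro P.product_integrable_prod I) auto
    moreover have "(\<integral>x. (\<Prod>j\<in>I. h i k j (x j)) \<partial>Pi\<^sub>M I M) = (\<Prod>j\<in>I. \<integral>x. h i k j x \<partial>M j)"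
      using int_h ik by (intro P.product_integral_prod I) auto
    moreover have "(\<Prod>j\<in>I. \<integral>x. h i k j x \<partial>M j) = (if i = k then \<integral>x. (g i x)\<^sup>2 \<partial>M i else 0)"
    proof (cases "i = k")
      case True
      have "(\<Prod>j\<in>I. \<integral>x. h i k j x \<partial>M j) = (\<Prod>j\<in>I. if j = i then \<integral>x. (g i x)\<^sup>2 \<partial>M i else 1)"
        using True P.M.prob_space by (intro prod.cong) (auto simp: h_def power2_eq_square)
      then show ?thesis using True ik I by simp
    next
      case False
      then have "(\<integral>x. h i k i x \<partial>M i) = 0"
        using mean[OF ik(1)] by (simp add: h_def)
      then show ?thesis using False ik I by (simp add: prod_zero_iff) (use ik in blast)
    qed
    ultimately show ?thesis
      using ik by (simp add: prod_h)
  qed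
  have sq: "(\<Sum>i\<in>I. g i (x i))\<^sup>2 = (\<Sum>i\<in>I. \<Sum>k\<in>I. g i (x i) * g k (x k))" for x
    by (simp add: power2_eq_square sum_product)
  show "integrable (Pi\<^sub>M I M) (\<lambda>x. (\<Sum>i\<in>I. g i (x i))\<^sup>2)"
    unfolding sq using E by (intro Bochner_Integration.integrable_sum) auto
  have "(\<integral>x. (\<Sum>i\<in>I. g i (x i))\<^sup>2 \<partial>Pi\<^sub>M I M)
      = (\<Sum>i\<in>I. \<Sum>k\<in>I. \<integral>x. g i (x i) * g k (x k) \<partial>Pi\<^sub>M I M)"
    unfolding sq using E
    by (subst Bochner_Integration.integral_sum; (intro sum.cong refl Bochner_Integration.integral_sum Bochner_Integration.integrable_sum)?) auto
  also have "\<dots> = (\<Sum>i\<in>I. \<Sum>k\<in>I. if i = k then \<integral>x. (g i x)\<^sup>2 \<partial>M i else 0)"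
    using E by (intro sum.cong) auto
  also have "\<dots> = (\<Sum>i\<in>I. \<integral>x. (g i x)\<^sup>2 \<partial>M i)"
    using I by simp
  finally show "(\<integral>x. (\<Sum>i\<in>I. g i (x i))\<^sup>2 \<partial>Pi\<^sub>M I M) = (\<Sum>i\<in>I. \<integral>x. (g i x)\<^sup>2 \<partial>M i)" .
qed

lemma normal_measure_moments:
  assumes s: "s > 0"
  shows "has_bochner_integral (normal_measure s) (\<lambda>x. x) 0"
    and "has_bochner_integral (normal_measure s) (\<lambda>x. x\<^sup>2) (s\<^sup>2)"
    and "has_bochner_integral (normal_measure s) (\<lambda>x. x ^ 4) (3 * s ^ 4)"
proof -
  have *: "has_bochner_integral (normal_measure s) f r"
    if "has_bochner_integral lborel (\<lambda>x. normal_density 0 s x * f x) r"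
      and "f \<in> borel_measurable borel" for f r
    unfolding normal_measure_def using that
    by (auto simp: has_bochner_integral_iff integrable_density integral_density)
  show "has_bochner_integral (normal_measure s) (\<lambda>x. x) 0"
    by (rule *) (use normal_moment_odd[OF s, of 0 0] in simp_all)
  show "has_bochner_integral (normal_measure s) (\<lambda>x. x\<^sup>2) (s\<^sup>2)"
    by (rule *) (use normal_moment_even[OF s, of 0 1] s in \<open>simp_all add: fact_numeral\<close>)
  have "fact (2 * 2) / ((2 / s\<^sup>2)\<^sup>2 * fact 2) = 3 * s ^ 4"
    using s by (simp add: fact_numeral power_divide field_simps flip: power_mult power_add)
  then show "has_bochner_integral (normal_measure s) (\<lambda>x. x ^ 4) (3 * s ^ 4)"
    by (intro *) (use normal_moment_even[OF s, of 0 2] in simp_all)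
qed

lemma gauss_norm_deviation:
  assumes I: "finite I" and s: "\<And>i. s i > 0"
  shows "(\<integral>\<^sup>+v. ennreal (((\<Sum>i\<in>I. (v i)\<^sup>2) - (\<Sum>i\<in>I. (s i)\<^sup>2))\<^sup>2) \<partial>gauss I s)
    = ennreal (2 * (\<Sum>i\<in>I. (s i) ^ 4))"
proof -
  let ?g = "\<lambda>i x. x\<^sup>2 - (s i)\<^sup>2"
  have g1: "has_bochner_integral (normal_measure (s i)) (?g i) 0" for i
  proof -
    interpret prob_space "normal_measure (s i)" by (rule prob_space_normal_measure[OF s])
    have "has_bochner_integral (normal_measure (s i)) (\<lambda>x. x\<^sup>2 - (s i)\<^sup>2) ((s i)\<^sup>2 - (s i)\<^sup>2)"
      by (intro has_bochner_integral_diff normal_measure_moments s) (simp add: has_bochner_integral_iff prob_space[simplified])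
    then show ?thesis by simp
  qed
  have g2: "has_bochner_integral (normal_measure (s i)) (\<lambda>x. (?g i x)\<^sup>2) (2 * s i ^ 4)" for i
  proof -
    interpret prob_space "normal_measure (s i)" by (rule prob_space_normal_measure[OF s])
    have "has_bochner_integral (normal_measure (s i)) (\<lambda>x. x ^ 4 - 2 * (s i)\<^sup>2 * x\<^sup>2 + s i ^ 4)
        (3 * s i ^ 4 - 2 * (s i)\<^sup>2 * (s i)\<^sup>2 + s i ^ 4)"
      by (intro has_bochner_integral_diff has_bochner_integral_add has_bochner_integral_mult_right
           normal_measure_moments s) (simp add: has_bochner_integral_iff prob_space[simplified])
    then show ?thesis by (simp add: power2_diff power_mult[symmetric] algebra_simps flip: power_add)
  qed
  note P = product_sum_second_moment[OF I, of "\<lambda>i. normal_measure (s i)" ?g]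
  have "(\<Sum>i\<in>I. (v i)\<^sup>2) - (\<Sum>i\<in>I. (s i)\<^sup>2) = (\<Sum>i\<in>I. ?g i (v i))" for v
    by (simp add: sum_subtractf)
  then have "(\<integral>\<^sup>+v. ennreal (((\<Sum>i\<in>I. (v i)\<^sup>2) - (\<Sum>i\<in>I. (s i)\<^sup>2))\<^sup>2) \<partial>gauss I s)
      = ennreal (\<integral>v. (\<Sum>i\<in>I. ?g i (v i))\<^sup>2 \<partial>gauss I s)"
    unfolding gauss_def using g1 g2
    by (simp, intro nn_integral_eq_integral P)
       (auto simp: has_bochner_integral_iff intro: prob_space_normal_measure s)
  also have "(\<integral>v. (\<Sum>i\<in>I. ?g i (v i))\<^sup>2 \<partial>gauss I s) = (\<Sum>i\<in>I. \<integral>x. (?g i x)\<^sup>2 \<partial>normal_measure (s i))"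
    unfolding gauss_def using g1 g2
    by (intro P) (auto simp: has_bochner_integral_iff intro: prob_space_normal_measure s)
  also have "\<dots> = 2 * (\<Sum>i\<in>I. (s i) ^ 4)"
    using g2 by (simp add: has_bochner_integral_iff sum_distrib_left)
  finally show ?thesis .
qed

lemma gauss_linear_second_moment:
  assumes I: "finite I" and s: "\<And>i. s i > 0"
  shows "(\<integral>\<^sup>+v. ennreal ((\<Sum>i\<in>I. w i * v i)\<^sup>2) \<partial>gauss I s) = ennreal (\<Sum>i\<in>I. (w i)\<^sup>2 * (s i)\<^sup>2)"
proof -
  let ?g = "\<lambda>i x. w i * x"
  have g1: "has_bochner_integral (normal_measure (s i)) (?g i) 0" for i
    using has_bochner_integral_mult_right[OF normal_measure_moments(1)[OF s], where c = "w i"] by simp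
  have g2: "has_bochner_integral (normal_measure (s i)) (\<lambda>x. (?g i x)\<^sup>2) ((w i)\<^sup>2 * (s i)\<^sup>2)" for i
    using has_bochner_integral_mult_right[OF normal_measure_moments(2)[OF s], where c = "(w i)\<^sup>2"]
    by (simp add: power_mult_distrib)
  note P = product_sum_second_moment[OF I, of "\<lambda>i. normal_measure (s i)" ?g]
  have "(\<integral>\<^sup>+v. ennreal ((\<Sum>i\<in>I. ?g i (v i))\<^sup>2) \<partial>gauss I s) = ennreal (\<integral>v. (\<Sum>i\<in>I. ?g i (v i))\<^sup>2 \<partial>gauss I s)"
    unfolding gauss_def using g1 g2
    by (intro nn_integral_eq_integral P)
       (auto simp: has_bochner_integral_iff intro: prob_space_normal_measure s)
  also have "(\<integral>v. (\<Sum>i\<in>I. ?g i (v i))\<^sup>2 \<partial>gauss I s) = (\<Sum>i\<in>I. \<integral>x. (?g i x)\<^sup>2 \<partial>normal_measure (s i))"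
    unfolding gauss_def using g1 g2
    by (intro P) (auto simp: has_bochner_integral_iff intro: prob_space_normal_measure s)
  also have "\<dots> = (\<Sum>i\<in>I. (w i)\<^sup>2 * (s i)\<^sup>2)"
    using g2 by (simp add: has_bochner_integral_iff)
  finally show ?thesis .
qed

lemma gauss_inner_second_moment:
  assumes I: "finite I" and s: "\<And>i. s i > 0"
  shows "(\<integral>\<^sup>+w. \<integral>\<^sup>+v. ennreal ((\<Sum>i\<in>I. w i * v i)\<^sup>2) \<partial>gauss I s \<partial>gauss I s) = ennreal (\<Sum>i\<in>I. (s i) ^ 4)"
proof -
  interpret G: prob_space "gauss I s" by (rule prob_space_gauss[OF s])
  have "(\<integral>\<^sup>+w. \<integral>\<^sup>+v. ennreal ((\<Sum>i\<in>I. w i * v i)\<^sup>2) \<partial>gauss I s \<partial>gauss I s)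
      = (\<integral>\<^sup>+w. (\<Sum>i\<in>I. ennreal ((s i)\<^sup>2) * ennreal ((w i)\<^sup>2)) \<partial>gauss I s)"
    unfolding gauss_linear_second_moment[OF I s]
    by (intro nn_integral_cong) (simp add: sum_ennreal[symmetric] ennreal_mult mult.commute)
  also have "\<dots> = (\<Sum>i\<in>I. ennreal ((s i)\<^sup>2) * (\<integral>\<^sup>+w. ennreal ((w i)\<^sup>2) \<partial>gauss I s))"
    by (subst nn_integral_sum) (auto intro!: sum.cong nn_integral_cmult)
  also have "\<dots> = (\<Sum>i\<in>I. ennreal ((s i)\<^sup>2) * ennreal ((s i)\<^sup>2))"
  proof (rule sum.cong[OF refl])
    fix i assume i: "i \<in> I"
    have "(\<integral>\<^sup>+w. ennreal ((w i)\<^sup>2) \<partial>gauss I s) = (\<integral>\<^sup>+w. ennreal ((\<Sum>j\<in>I. (if j = i then 1 else 0) * w j)\<^sup>2) \<partial>gauss I s)"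
      using I i by (simp add: if_distrib[of "\<lambda>a. a * _"] cong: if_cong)
    also have "\<dots> = ennreal (\<Sum>j\<in>I. (if j = i then 1 else 0)\<^sup>2 * (s j)\<^sup>2)"
      by (rule gauss_linear_second_moment[OF I s])
    also have "(\<Sum>j\<in>I. (if j = i then 1 else 0)\<^sup>2 * (s j)\<^sup>2) = (\<Sum>j\<in>I. if j = i then (s j)\<^sup>2 else 0)"
      by (intro sum.cong) auto
    also have "\<dots> = (s i)\<^sup>2" using I i by simp
    finally show "ennreal ((s i)\<^sup>2) * (\<integral>\<^sup>+w. ennreal ((w i)\<^sup>2) \<partial>gauss I s) = ennreal ((s i)\<^sup>2) * ennreal ((s i)\<^sup>2)"
      by simp
  qed
  also have "\<dots> = ennreal (\<Sum>i\<in>I. (s i) ^ 4)"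
  proof -
    have "ennreal ((s i)\<^sup>2) * ennreal ((s i)\<^sup>2) = ennreal ((s i) ^ 4)" for i
      by (simp add: ennreal_mult[symmetric] flip: power_add)
    then show ?thesis by (simp add: sum_ennreal)
  qed
  finally show ?thesis .
qed

section \<open>The Stieltjes transform of the semicircular law\<close>

lemma nn_integral_FTC_interior:
  fixes f F :: "real \<Rightarrow> real"
  assumes "a \<le> b" and "\<And>x. x \<in> {a..b} \<Longrightarrow> f x \<ge> 0" and "continuous_on {a..b} F"
    and "\<And>x. x \<in> {a<..<b} \<Longrightarrow> (F has_real_derivative f x) (at x)"
  shows "(\<integral>\<^sup>+x. ennreal (indicator {a..b} x * f x) \<partial>lborel) = ennreal (F b - F a)"
  using assms
  by (intro nn_integral_has_integral_lebesgue fundamental_theorem_of_calculus_interior)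
     (auto simp: has_real_derivative_iff_has_vector_derivative)

lemma sqrt_4_minus_sq_pos: "x \<in> {-2<..<2} \<Longrightarrow> 4 - x\<^sup>2 > (0::real)"
proof -
  assume "x \<in> {-2<..<2}"
  then have "(2 - x) * (2 + x) > 0" by (intro mult_pos_pos) auto
  then show ?thesis by (simp add: algebra_simps power2_eq_square)
qed

lemma sq_le_4: "x \<in> {-2..2} \<Longrightarrow> x\<^sup>2 \<le> (4::real)"
proof -
  assume "x \<in> {-2..2}"
  then have "(2 - x) * (2 + x) \<ge> 0" by (intro mult_nonneg_nonneg) auto
  then show ?thesis by (simp add: algebra_simps power2_eq_square)
qed

lemma sqrt_1_minus_half_sq: "sqrt (1 - (x / 2)\<^sup>2) = sqrt (4 - x\<^sup>2) / 2" for x :: real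
proof -
  have eq: "1 - (x / 2)\<^sup>2 = (4 - x\<^sup>2) / 4" by (simp add: power_divide diff_divide_distrib)
  show ?thesis unfolding eq real_sqrt_divide by simp
qed

lemma emeasure_semicircle_space: "emeasure semicircle (space semicircle) = 1"
proof -
  \<comment> \<open>an antiderivative of the semicircular density\<close>
  let ?F = "\<lambda>x::real. (x * sqrt (4 - x\<^sup>2) / 2 + 2 * arcsin (x / 2)) / (2 * pi)"
  have "(\<integral>\<^sup>+x. ennreal (indicator {-2..2} x * (sqrt (4 - x\<^sup>2) / (2 * pi))) \<partial>lborel) = ennreal (?F 2 - ?F (-2))"
  proof (rule nn_integral_FTC_interior)
    show "continuous_on {-2..2} ?F"
      by (intro continuous_intros) auto
    fix x :: real assume x: "x \<in> {-2<..<2}"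
    define R where "R = sqrt (4 - x\<^sup>2)"
    have pos: "4 - x\<^sup>2 > 0" using sqrt_4_minus_sq_pos[OF x] .
    have R: "R > 0" "R\<^sup>2 = 4 - x\<^sup>2" using pos by (auto simp: R_def)
    have "sqrt (1 - (x / 2)\<^sup>2) = R / 2"
      unfolding R_def by (rule sqrt_1_minus_half_sq)
    then have D1: "((\<lambda>x. 2 * arcsin (x / 2)) has_real_derivative 2 / R) (at x)"
      using x R by (auto intro!: derivative_eq_intros simp: field_simps)
    have D2: "((\<lambda>x. x * sqrt (4 - x\<^sup>2) / 2) has_real_derivative (R - x * x / R) / 2) (at x)"
      using pos R by (auto intro!: derivative_eq_intros simp: R_def field_simps)
    have "(?F has_real_derivative ((R - x * x / R) / 2 + 2 / R) / (2 * pi)) (at x)"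
      by (rule DERIV_cdivide[OF DERIV_add[OF D2 D1]])
    moreover have "(R - x * x / R) / 2 + 2 / R = R"
      using R by (simp add: field_simps power2_eq_square)
    ultimately show "(?F has_real_derivative sqrt (4 - x\<^sup>2) / (2 * pi)) (at x)"
      by (simp add: R_def)
  qed (use sq_le_4 in auto)
  also have "?F 2 - ?F (-2) = 1" by (simp add: arcsin_minus field_simps)
  finally show ?thesis
    by (simp add: semicircle_def emeasure_density)
qed

lemma add_inverse_gt_2: "J > 1 \<Longrightarrow> J + 1 / J > (2::real)"
proof -
  assume J: "J > 1"
  have "J + 1 / J - 2 = (J - 1)\<^sup>2 / J" using J by (simp add: power2_eq_square field_simps)
  also have "\<dots> > 0" using J by simp
  finally show ?thesis by simp
qed

text \<open>
  With \<open>z = J + 1 / J\<close> the equation \<open>z\<^sup>2 - 4 = (J - 1 / J)\<^sup>2\<close> makes the antiderivative of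
  \<open>sqrt (4 - x\<^sup>2) / (z - x)\<close> explicit.
\<close>

lemma semicircle_stieltjes:
  assumes J: "J > 1"
  shows "(\<integral>x. indicator {-2..2} x / (J + 1 / J - x) \<partial>semicircle) = 1 / J"
proof -
  define z where "z = J + 1 / J"
  define d where "d = J - 1 / J"
  have d: "d > 0" using J by (simp add: d_def field_simps less_1_mult)
  have zd: "z\<^sup>2 - 4 = d\<^sup>2" using J by (simp add: z_def d_def power2_eq_square field_simps)
  have z: "z > 2"
    unfolding z_def by (rule add_inverse_gt_2[OF J])
  let ?f = "\<lambda>x::real. sqrt (4 - x\<^sup>2) / (2 * pi) / (z - x)"
  \<comment> \<open>an antiderivative of \<open>?f\<close> in the interior of the interval\<close>
  let ?F = "\<lambda>x::real. (z * arcsin (x / 2) - sqrt (4 - x\<^sup>2) - d * arcsin ((z * x - 4) / (2 * (z - x)))) / (2 * pi)"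
  have ysq: "1 - ((z * x - 4) / (2 * (z - x)))\<^sup>2 = (4 - x\<^sup>2) * d\<^sup>2 / (2 * (z - x))\<^sup>2" if "x < z" for x
  proof -
    have "(2 * (z - x))\<^sup>2 - (z * x - 4)\<^sup>2 = (4 - x\<^sup>2) * d\<^sup>2"
      unfolding zd[symmetric] by (simp add: power2_eq_square algebra_simps)
    then show ?thesis
      using that by (simp add: power_divide diff_divide_distrib[symmetric] field_simps)
  qed
  have y_le: "\<bar>(z * x - 4) / (2 * (z - x))\<bar> \<le> 1" if x: "x \<in> {-2..2}" for x
  proof -
    have "1 - ((z * x - 4) / (2 * (z - x)))\<^sup>2 \<ge> 0"
      using ysq[of x] x z sq_le_4[OF x] by simp
    then show ?thesis by (simp add: abs_square_le_1)
  qed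
  have nn: "(\<integral>\<^sup>+x. ennreal (indicator {-2..2} x * ?f x) \<partial>lborel) = ennreal (?F 2 - ?F (-2))"
  proof (rule nn_integral_FTC_interior)
    show "continuous_on {-2..2} ?F"
    proof -
      have "continuous_on {-2..2} (\<lambda>x. (z * x - 4) / (2 * (z - x)))"
        using z by (intro continuous_intros) auto
      moreover have "\<forall>x\<in>{-2..2}. -1 \<le> (z * x - 4) / (2 * (z - x)) \<and> (z * x - 4) / (2 * (z - x)) \<le> 1"
        using y_le by (metis abs_le_iff minus_le_iff)
      ultimately have "continuous_on {-2..2} (\<lambda>x. arcsin ((z * x - 4) / (2 * (z - x))))"
        by (rule continuous_on_arcsin)
      moreover define w where "w x = arcsin ((z * x - 4) / (2 * (z - x)))" for x
      ultimately show ?thesis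
        unfolding w_def[symmetric] by (intro continuous_intros) auto
    qed
    fix x :: real assume x: "x \<in> {-2<..<2}"
    define R where "R = sqrt (4 - x\<^sup>2)"
    define y where "y = (z * x - 4) / (2 * (z - x))"
    have pos: "4 - x\<^sup>2 > 0" using sqrt_4_minus_sq_pos[OF x] .
    have R: "R > 0" "R\<^sup>2 = 4 - x\<^sup>2" using pos by (auto simp: R_def)
    have zx: "z - x > 0" using x z by auto
    have "sqrt (1 - (x / 2)\<^sup>2) = R / 2"
      unfolding R_def by (rule sqrt_1_minus_half_sq)
    then have D1: "((\<lambda>x. z * arcsin (x / 2)) has_real_derivative z / R) (at x)"
      using x R by (auto intro!: derivative_eq_intros simp: field_simps)
    have D2: "((\<lambda>x. sqrt (4 - x\<^sup>2)) has_real_derivative - x / R) (at x)"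
      using pos R by (auto intro!: derivative_eq_intros simp: R_def field_simps)
    have y1: "1 - y\<^sup>2 = (R * d / (2 * (z - x)))\<^sup>2"
      unfolding y_def using ysq[of x] zx R(2) by (simp add: power_divide power_mult_distrib)
    have "R * d / (2 * (z - x)) > 0" using R d zx by simp
    then have "1 - y\<^sup>2 > 0" and sy: "sqrt (1 - y\<^sup>2) = R * d / (2 * (z - x))"
      unfolding y1 by (simp_all only: real_sqrt_abs abs_of_pos zero_less_power)
    then have yb: "-1 < y" "y < 1" by (auto simp: abs_square_less_1)
    have Dy: "((\<lambda>x. (z * x - 4) / (2 * (z - x))) has_real_derivative d\<^sup>2 / (2 * (z - x)\<^sup>2)) (at x)"
    proof -
      have "((\<lambda>x. (z * x - 4) / (2 * (z - x))) has_real_derivative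
          (z * (2 * (z - x)) - (z * x - 4) * (- 2)) / ((2 * (z - x)) * (2 * (z - x)))) (at x)"
        using zx by (auto intro!: derivative_eq_intros)
      also have "(z * (2 * (z - x)) - (z * x - 4) * (- 2)) = 2 * d\<^sup>2"
        unfolding zd[symmetric] by (simp add: power2_eq_square algebra_simps)
      also have "2 * d\<^sup>2 / ((2 * t) * (2 * t)) = d\<^sup>2 / (2 * t\<^sup>2)" for t
        by (simp add: power2_eq_square)
      finally show ?thesis .
    qed
    have "((\<lambda>x. arcsin ((z * x - 4) / (2 * (z - x)))) has_real_derivative
        d\<^sup>2 / (2 * (z - x)\<^sup>2) * inverse (sqrt (1 - y\<^sup>2))) (at x)"
      using DERIV_chain2[OF DERIV_arcsin[OF yb, unfolded y_def] Dy]
      unfolding y_def by (simp only: mult.commute)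
    also have "d\<^sup>2 / (2 * (z - x)\<^sup>2) * inverse (sqrt (1 - y\<^sup>2)) = d / (R * (z - x))"
    proof -
      have "d\<^sup>2 / (2 * t\<^sup>2) * inverse (R * d / (2 * t)) = d / (R * t)" if "t > 0" for t
        using that R d by (simp add: field_simps power2_eq_square)
      from this[OF zx] show ?thesis unfolding sy .
    qed
    finally have D3: "((\<lambda>x. d * arcsin ((z * x - 4) / (2 * (z - x)))) has_real_derivative d * (d / (R * (z - x)))) (at x)"
      by (rule DERIV_cmult)
    have "(?F has_real_derivative (z / R - (- x / R) - d * (d / (R * (z - x)))) / (2 * pi)) (at x)"
      by (rule DERIV_cdivide[OF DERIV_diff[OF DERIV_diff[OF D1 D2] D3]])
    moreover have "z / R - (- x / R) - d * (d / (R * (z - x))) = R / (z - x)"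
    proof -
      have "z / R - (- x / R) - d * (d / (R * (z - x))) = ((z + x) * (z - x) - d\<^sup>2) / (R * (z - x))"
        using R zx by (simp add: field_simps power2_eq_square)
      also have "(z + x) * (z - x) - d\<^sup>2 = R\<^sup>2"
        unfolding R(2) zd[symmetric] by (simp add: power2_eq_square algebra_simps)
      finally show ?thesis using R zx by (simp add: power2_eq_square)
    qed
    ultimately show "(?F has_real_derivative ?f x) (at x)"
      by (simp add: R_def mult.commute)
  qed (use z sq_le_4 in \<open>auto intro!: divide_nonneg_pos\<close>)
  have "(z * 2 - 4) / (2 * (z - 2)) = 1" "(z * (-2) - 4) / (2 * (z - (-2))) = -1"
    using z by (auto simp: field_simps)
  then have "?F 2 - ?F (-2) = (z - d) / 2"
    by (simp add: arcsin_minus field_simps)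
  also have "\<dots> = 1 / J" by (simp add: z_def d_def)
  finally have F: "?F 2 - ?F (-2) = 1 / J" .
  have "(\<integral>\<^sup>+x. ennreal (indicator {-2..2} x / (z - x)) \<partial>semicircle) = ennreal (1 / J)"
    unfolding semicircle_def
  proof (subst nn_integral_density)
    show "(\<integral>\<^sup>+x. ennreal (indicator {-2..2} x * sqrt (4 - x\<^sup>2) / (2 * pi)) *
        ennreal (indicator {-2..2} x / (z - x)) \<partial>lborel) = ennreal (1 / J)"
      unfolding F[symmetric] nn[symmetric] using sq_le_4 z
      by (intro nn_integral_cong) (auto simp: ennreal_mult[symmetric] split: split_indicator)
  qed measurable
  then have "(\<integral>x. indicator {-2..2} x / (z - x) \<partial>semicircle) = 1 / J"
    using J z by (intro integral_eq_nn_integral[THEN trans] ) (auto simp: semicircle_def split: split_indicator)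
  then show ?thesis by (simp add: z_def)
qed

section \<open>The bulk of the spectrum\<close>

lemma real_distribution_semicircle: "real_distribution semicircle"
proof -
  interpret prob_space semicircle
    by (rule prob_spaceI) (rule emeasure_semicircle_space)
  show ?thesis by unfold_locales (simp add: semicircle_def)
qed

lemma real_distribution_empirical_measure:
  assumes "n \<ge> 2"
  shows "real_distribution (empirical_measure n A)"
proof -
  interpret prob_space "uniform_count_measure {2..n}"
    by (rule prob_space_uniform_count_measure) (use assms in auto)
  show ?thesis
    unfolding empirical_measure_def by (rule real_distribution_distr) simp
qed

lemma integral_empirical_measure:
  fixes f :: "real \<Rightarrow> real"
  assumes "n \<ge> 2" and [measurable]: "f \<in> borel_measurable borel"
  shows "(\<integral>x. f x \<partial>empirical_measure n A) = (\<Sum>j\<in>{2..n}. f (eig A j)) / (real n - 1)"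
proof -
  have "(\<integral>x. f x \<partial>empirical_measure n A) = (\<integral>j. f (eig A j) \<partial>uniform_count_measure {2..n})"
    unfolding empirical_measure_def by (rule integral_distr) auto
  also have "\<dots> = (\<Sum>j\<in>{2..n}. f (eig A j)) / card {2..n}"
    by (rule integral_uniform_count_measure) simp
  finally show ?thesis using assms(1) by (simp add: of_nat_diff)
qed

lemma weak_conv_empirical_sum:
  fixes f :: "real \<Rightarrow> real"
  assumes conv: "weak_conv_m (\<lambda>n. empirical_measure n (A n)) semicircle"
    and f: "\<And>x. isCont f x" "\<And>x. norm (f x) \<le> B"
  shows "(\<lambda>n. (\<Sum>j\<in>{2..n}. f (eig (A n) j)) / (real n - 1)) \<longlonglongrightarrow> (\<integral>x. f x \<partial>semicircle)"
proof (rule LIMSEQ_offset)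
  let ?M = "\<lambda>n. empirical_measure (n + 2) (A (n + 2))"
  have fm: "f \<in> borel_measurable borel"
    using f(1) by (intro borel_measurable_continuous_onI continuous_at_imp_continuous_on) auto
  have "weak_conv_m ?M semicircle"
    unfolding weak_conv_m_def weak_conv_def
  proof (intro allI impI)
    fix x assume "isCont (cdf semicircle) x"
    then have "(\<lambda>n. cdf (empirical_measure n (A n)) x) \<longlonglongrightarrow> cdf semicircle x"
      using conv by (simp add: weak_conv_m_def weak_conv_def)
    then show "(\<lambda>n. cdf (?M n) x) \<longlonglongrightarrow> cdf semicircle x"
      by (rule LIMSEQ_ignore_initial_segment)
  qed
  then have "(\<lambda>n. \<integral>x. f x \<partial>?M n) \<longlonglongrightarrow> (\<integral>x. f x \<partial>semicircle)"
    by (rule weak_conv_imp_integral_bdd_continuous_conv[OF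
        real_distribution_empirical_measure real_distribution_semicircle _ f, rotated]) simp
  then show "(\<lambda>n. (\<Sum>j\<in>{2..n + 2}. f (eig (A (n + 2)) j)) / (real (n + 2) - 1)) \<longlonglongrightarrow> (\<integral>x. f x \<partial>semicircle)"
    by (subst (asm) integral_empirical_measure[OF _ fm]) simp_all
qed

text \<open>
  Rigidity for a single \<open>K\<close>, with \<open>i = 1\<close> and \<open>j = 3\<close>, since the first quantile is 2.
\<close>

lemma rigid_third_eigenvalue:
  assumes rigid: "rigid q A" and q: "\<And>K. K \<ge> 1 \<Longrightarrow> sc_quantiles K (q K)" and a: "a > 2"
  shows "\<forall>\<^sub>F n in sequentially. eig (A n) 3 \<le> a"
proof -
  have "a - 2 > 0" using a by simp
  note rigid[unfolded rigid_def, rule_format, OF this]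
  then obtain K where K: "K \<ge> 1" and
    ev: "\<forall>\<^sub>F n in sequentially. \<forall>i\<in>{1..K}. \<forall>j::nat.
          (real i - 1) * (real n - 2) / real K + 3 \<le> real j \<and>
          real j \<le> real i * (real n - 2) / real K + 2 \<longrightarrow> \<bar>eig (A n) j - q K i\<bar> \<le> a - 2"
    by blast
  have q1: "q K 1 = 2" using q[OF K] by (simp add: sc_quantiles_def)
  show ?thesis
    using ev eventually_ge_at_top[of "K + 2"]
  proof eventually_elim
    case (elim n)
    have "(real n - 2) / real K \<ge> 1"
      using elim(2) K by (simp add: field_simps)
    then have "\<bar>eig (A n) 3 - q K 1\<bar> \<le> a - 2"
      using elim(1)[rule_format, of 1 3] K by simp
    then show ?case unfolding q1 by linarith
  qed
qed

text \<open>
  The bound on the third eigenvalue suffices because the eigenvalues are decreasing.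
\<close>

lemma bulk_eigenvalues_le:
  assumes carrier: "\<And>n. n \<ge> 2 \<Longrightarrow> A n \<in> carrier_mat n n"
    and sym: "\<And>n. n \<ge> 2 \<Longrightarrow> transpose_mat (A n) = A n"
    and rigid: "rigid q A" and q: "\<And>K. K \<ge> 1 \<Longrightarrow> sc_quantiles K (q K)" and a: "a > 2"
  shows "\<forall>\<^sub>F n in sequentially. \<forall>j\<in>{3..n}. eig (A n) j \<le> a"
proof -
  have "\<forall>\<^sub>F n in sequentially. eig (A n) 3 \<le> a"
    using rigid q a by (rule rigid_third_eigenvalue)
  then show ?thesis
    using eventually_ge_at_top[of 3]
  proof eventually_elim
    case (elim n)
    show ?case
    proof
      fix j assume j: "j \<in> {3..n}"
      have "eig (A n) j \<le> eig (A n) 3"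
        by (rule eig_mono[of _ n]) (use elim(2) j carrier[of n] sym[of n] in auto)
      with elim(1) show "eig (A n) j \<le> a" by simp
    qed
  qed
qed

lemma bulk_resolvent_sum:
  assumes carrier: "\<And>n. n \<ge> 2 \<Longrightarrow> A n \<in> carrier_mat n n"
    and sym: "\<And>n. n \<ge> 2 \<Longrightarrow> transpose_mat (A n) = A n"
    and rigid: "rigid q A" and q: "\<And>K. K \<ge> 1 \<Longrightarrow> sc_quantiles K (q K)"
    and conv: "weak_conv_m (\<lambda>n. empirical_measure n (A n)) semicircle"
    and J: "J > 1"
  shows "(\<lambda>n. (\<Sum>j\<in>{3..n}. 1 / (J + 1 / J - eig (A n) j)) / real n) \<longlonglongrightarrow> 1 / J"
proof -
  define z where "z = J + 1 / J"
  have z: "z > 2"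
    unfolding z_def by (rule add_inverse_gt_2[OF J])
  define a where "a = (2 + z) / 2"
  have a: "2 < a" "a < z" using z by (auto simp: a_def)
  \<comment> \<open>a bounded continuous test function that agrees with the resolvent on the bulk; its value
  at the outlier \<open>eig (A n) 2\<close> is bounded and contributes only \<open>O(1 / n)\<close>\<close>
  define f where "f x = 1 / (z - min x a)" for x
  have zf: "z - min x a \<ge> z - a" for x by auto
  have f_bound: "norm (f x) \<le> 1 / (z - a)" for x
    using zf[of x] a by (simp add: f_def frac_le)
  have f_cont: "isCont f x" for x
    unfolding f_def using zf[of x] a by (intro continuous_intros) auto
  have "(\<integral>x. f x \<partial>semicircle) = (\<integral>x. indicator {-2..2} x / (z - x) \<partial>semicircle)"
  proof (rule integral_cong_AE)
    show "AE x in semicircle. f x = indicator {-2..2} x / (z - x)"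
      unfolding semicircle_def
      by (subst AE_density) (use a in \<open>auto simp: f_def indicator_def min_def\<close>)
    have "f \<in> borel_measurable borel"
      using f_cont by (intro borel_measurable_continuous_onI continuous_at_imp_continuous_on) auto
    then show "f \<in> borel_measurable semicircle" by (simp add: semicircle_def)
    show "(\<lambda>x. indicator {-2..2} x / (z - x)) \<in> borel_measurable semicircle"
      by (simp add: semicircle_def)
  qed
  also have "\<dots> = 1 / J"
    unfolding z_def by (rule semicircle_stieltjes[OF J])
  finally have int: "(\<integral>x. f x \<partial>semicircle) = 1 / J" .
  let ?S = "\<lambda>n. \<Sum>j\<in>{2..n}. f (eig (A n) j)"
  have lim1: "(\<lambda>n. ?S n / (real n - 1)) \<longlonglongrightarrow> 1 / J"
    using weak_conv_empirical_sum[OF conv f_cont f_bound] by (simp add: int)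
  have lim2: "(\<lambda>n. (real n - 1) / real n) \<longlonglongrightarrow> 1"
  proof -
    have "(\<lambda>n. 1 - 1 / real n) \<longlonglongrightarrow> 1 - 0"
      by (intro tendsto_diff tendsto_const lim_1_over_n)
    then have "(\<lambda>n. 1 - 1 / real n) \<longlonglongrightarrow> 1" by simp
    then show ?thesis
      by (rule Lim_transform_eventually)
         (use eventually_gt_at_top[of 0] in \<open>eventually_elim, simp add: field_simps\<close>)
  qed
  have lim3: "(\<lambda>n. f (eig (A n) 2) / real n) \<longlonglongrightarrow> 0"
  proof (rule Lim_null_comparison)
    show "\<forall>\<^sub>F n in sequentially. norm (f (eig (A n) 2) / real n) \<le> (1 / (z - a)) * (1 / real n)"
    proof (intro always_eventually allI)
      fix n
      have "norm (f (eig (A n) 2)) * (1 / real n) \<le> (1 / (z - a)) * (1 / real n)"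
        by (rule mult_right_mono[OF f_bound]) simp
      then show "norm (f (eig (A n) 2) / real n) \<le> (1 / (z - a)) * (1 / real n)" by simp
    qed
    show "(\<lambda>n. 1 / (z - a) * (1 / real n)) \<longlonglongrightarrow> 0"
      using tendsto_mult_right_zero[OF lim_1_over_n] by blast
  qed
  have "(\<lambda>n. ?S n / (real n - 1) * ((real n - 1) / real n) - f (eig (A n) 2) / real n) \<longlonglongrightarrow> 1 / J * 1 - 0"
    by (intro tendsto_diff tendsto_mult lim1 lim2 lim3)
  then have "(\<lambda>n. ?S n / (real n - 1) * ((real n - 1) / real n) - f (eig (A n) 2) / real n) \<longlonglongrightarrow> 1 / J"
    by simp
  moreover have "\<forall>\<^sub>F n in sequentially. \<forall>j\<in>{3..n}. eig (A n) j \<le> a"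
    using carrier sym rigid q a(1) by (rule bulk_eigenvalues_le)
  then have "\<forall>\<^sub>F n in sequentially. ?S n / (real n - 1) * ((real n - 1) / real n) - f (eig (A n) 2) / real n
      = (\<Sum>j\<in>{3..n}. 1 / (J + 1 / J - eig (A n) j)) / real n"
    using eventually_ge_at_top[of 3]
  proof eventually_elim
    case (elim n)
    have "{2..n} = insert 2 {3..n}" using elim(2) by auto
    then have S: "?S n = f (eig (A n) 2) + (\<Sum>j\<in>{3..n}. f (eig (A n) j))" by simp
    have eq: "(\<Sum>j\<in>{3..n}. f (eig (A n) j)) = (\<Sum>j\<in>{3..n}. 1 / (J + 1 / J - eig (A n) j))"
      using elim(1) by (intro sum.cong) (auto simp: f_def z_def)
    moreover have "T / m * (m / k) = T / k" if "m \<noteq> 0" for T m k :: real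
      using that by simp
    moreover have "real n - 1 \<noteq> 0" using elim(2) by linarith
    ultimately have "?S n / (real n - 1) * ((real n - 1) / real n) = ?S n / real n" by blast
    with eq show ?case
      unfolding S by (simp only: add_divide_distrib)
  qed
  ultimately show ?thesis
    by (rule Lim_transform_eventually)
qed

section \<open>Averaging over the first two coordinates\<close>

text \<open>
  The arcsine law, not normalised.
\<close>

definition arcsine :: "real measure" where
  "arcsine = density lborel (\<lambda>p. ennreal (arc_weight p))"

lemma sets_arcsine [simp, measurable_cong]: "sets arcsine = sets borel"
  by (simp add: arcsine_def)

lemma space_arcsine [simp]: "space arcsine = UNIV"
  by (simp add: arcsine_def)

lemma nn_integral_arcsine:
  "f \<in> borel_measurable borel \<Longrightarrow> (\<integral>\<^sup>+p. f p \<partial>arcsine) = (\<integral>\<^sup>+p. ennreal (arc_weight p) * f p \<partial>lborel)"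
  unfolding arcsine_def by (rule nn_integral_density) auto

lemma AE_arcsine: "AE p in arcsine. 0 < p \<and> p < 1"
  unfolding arcsine_def
  by (subst AE_density, simp, rule AE_I2) (auto simp: arc_weight_def indicator_def split: if_splits)

text \<open>
  The arcsine weight has finite positive mass because it arises from the uniform probability
  measure on the circle.
\<close>

lemma emeasure_arcsine: "emeasure arcsine UNIV \<noteq> 0" "emeasure arcsine UNIV \<noteq> \<infinity>"
proof -
  obtain C where C: "C \<noteq> 0" "C \<noteq> \<infinity>"
    "\<And>F. F \<in> borel_measurable (Rn 2) \<Longrightarrow> (\<integral>\<^sup>+x. F x \<partial>uniform_sphere 2) =
      C * (\<Sum>e\<in>{-1, 1}. \<Sum>e'\<in>{-1, 1}. \<integral>\<^sup>+v. \<integral>\<^sup>+p.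
        ennreal (arc_weight p * indicator {..<1} (tail_sq 2 v)) * F (sphere_pt 2 e e' p v)
        \<partial>lborel \<partial>Rtail 2)"
    by (rule nn_integral_uniform_sphere_tail[OF order_refl]) (rule that; assumption)
  interpret U: prob_space "uniform_sphere 2" by (rule prob_space_uniform_sphere)
  have m: "emeasure arcsine UNIV = (\<integral>\<^sup>+p. ennreal (arc_weight p) \<partial>lborel)"
    using nn_integral_arcsine[of "\<lambda>_. 1"] by (simp add: nn_integral_const)
  have "1 = (\<integral>\<^sup>+x. 1 \<partial>uniform_sphere 2)"
    by (simp add: U.emeasure_space_1)
  also have "\<dots> = C * (4 * emeasure arcsine UNIV)"
    by (subst C(3)) (simp_all add: tail_sq_def m lborel_product.nn_integral_empty space_PiM_empty)
  finally have "C * (4 * emeasure arcsine UNIV) = 1" by simp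
  then show "emeasure arcsine UNIV \<noteq> 0" "emeasure arcsine UNIV \<noteq> \<infinity>"
    using C(1,2) by (auto simp: ennreal_mult_eq_top_iff ennreal_mult_top)
qed

interpretation arcsine: finite_measure arcsine
  by (rule finite_measureI) (use emeasure_arcsine in simp)

text \<open>
  The possible signs of the coordinates 1 and 0, in this order.
\<close>

definition signs :: "(real \<times> real) set" where
  "signs = {-1, 1} \<times> {-1, 1}"

lemma finite_signs [simp]: "finite signs"
  by (simp add: signs_def)

lemma sum_signs: "(\<Sum>\<epsilon>\<in>signs. f (fst \<epsilon>) (snd \<epsilon>)) = (\<Sum>e\<in>{-1, 1}. \<Sum>e'\<in>{-1, 1}. f e e')"
  unfolding signs_def by (subst sum.cartesian_product) (simp add: split_beta')

text \<open>
  The overlap of two points of the sphere, whose tails have squared norms \<open>a\<close> and \<open>b\<close> and inner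
  product \<open>x\<close>, in terms of their signs \<open>\<epsilon>\<close>, \<open>\<delta>\<close> and fractions \<open>p\<close>, \<open>p'\<close>.
\<close>

definition overlap_kernel ::
  "real \<Rightarrow> real \<Rightarrow> real \<Rightarrow> real \<times> real \<Rightarrow> real \<times> real \<Rightarrow> real \<Rightarrow> real \<Rightarrow> real" where
  "overlap_kernel a b x \<epsilon> \<delta> p p' =
     fst \<epsilon> * fst \<delta> * (sqrt ((1 - a) * p) * sqrt ((1 - b) * p')) +
     snd \<epsilon> * snd \<delta> * (sqrt ((1 - a) * (1 - p)) * sqrt ((1 - b) * (1 - p'))) + x"

text \<open>
  The Boltzmann weight of the fraction \<open>p\<close> when the tail has squared norm \<open>a\<close>. It vanishes unless
  the tail lies in the open unit ball.
\<close>

definition tilt :: "real \<Rightarrow> real \<Rightarrow> real \<Rightarrow> real" where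
  "tilt k a p = indicator {..<1} a * exp (- (k * (1 - a) * p))"

text \<open>
  The test function \<open>\<phi>\<close> of the overlap, averaged with Boltzmann weights over the signs and fractions
  of both points, as a function of the squared norms \<open>a\<close>, \<open>b\<close> and the inner product \<open>x\<close> of the
  tails.
\<close>

definition Psi :: "(real \<Rightarrow> real) \<Rightarrow> real \<Rightarrow> real \<Rightarrow> real \<Rightarrow> real \<Rightarrow> real" where
  "Psi \<phi> k a b x = (\<integral>y. tilt k a (fst y) * tilt k b (snd y) *
     (\<Sum>\<epsilon>\<in>signs. \<Sum>\<delta>\<in>signs. \<phi> (overlap_kernel a b x \<epsilon> \<delta> (fst y) (snd y))) \<partial>(arcsine \<Otimes>\<^sub>M arcsine))"

lemma measurable_tilt [measurable (raw)]:
  assumes [measurable]: "f \<in> borel_measurable N" "g \<in> borel_measurable N"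
  shows "(\<lambda>w. tilt k (f w) (g w)) \<in> borel_measurable N"
  unfolding tilt_def by measurable

lemma measurable_overlap_kernel [measurable (raw)]:
  assumes [measurable]: "f \<in> borel_measurable N" "g \<in> borel_measurable N" "h \<in> borel_measurable N"
    "i \<in> borel_measurable N" "j \<in> borel_measurable N"
  shows "(\<lambda>w. overlap_kernel (f w) (g w) (h w) \<epsilon> \<delta> (i w) (j w)) \<in> borel_measurable N"
  unfolding overlap_kernel_def by measurable

lemma tilt_nonneg [simp]: "tilt k a p \<ge> 0"
  by (simp add: tilt_def)

lemma tilt_le_1: "k \<ge> 0 \<Longrightarrow> p \<ge> 0 \<Longrightarrow> tilt k a p \<le> 1"
  by (auto simp: tilt_def split: split_indicator)

lemma AE_arcsine_pair: "AE y in arcsine \<Otimes>\<^sub>M arcsine. (0 < fst y \<and> fst y < 1) \<and> (0 < snd y \<and> snd y < 1)"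
proof -
  interpret pair_sigma_finite arcsine arcsine ..
  have "AE p in arcsine. AE p' in arcsine. (0 < p \<and> p < 1) \<and> (0 < p' \<and> p' < (1::real))"
    using AE_arcsine
  proof eventually_elim
    case (elim p)
    show ?case using AE_arcsine by eventually_elim (use elim in auto)
  qed
  then show ?thesis
  proof (intro AE_pair_measure)
    show "{y \<in> space (arcsine \<Otimes>\<^sub>M arcsine). (0 < fst y \<and> fst y < 1) \<and> 0 < snd y \<and> snd y < 1}
        \<in> sets (arcsine \<Otimes>\<^sub>M arcsine)"
      by measurable
  qed simp
qed

context
  fixes \<phi> :: "real \<Rightarrow> real" and k :: real
  assumes \<phi>_cont: "continuous_on UNIV \<phi>" and \<phi>_bounds: "\<And>x. 0 \<le> \<phi> x" "\<And>x. \<phi> x \<le> 1" and k: "k \<ge> 0"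
begin

lemma measurable_phi: "\<phi> \<in> borel_measurable borel"
  using \<phi>_cont by (rule borel_measurable_continuous_onI)

lemma Psi_sum_bounds:
  "0 \<le> (\<Sum>\<epsilon>\<in>signs. \<Sum>\<delta>\<in>signs. \<phi> (g \<epsilon> \<delta>))" "(\<Sum>\<epsilon>\<in>signs. \<Sum>\<delta>\<in>signs. \<phi> (g \<epsilon> \<delta>)) \<le> 16"
proof -
  show "0 \<le> (\<Sum>\<epsilon>\<in>signs. \<Sum>\<delta>\<in>signs. \<phi> (g \<epsilon> \<delta>))"
    using \<phi>_bounds by (intro sum_nonneg)
  have "(\<Sum>\<epsilon>\<in>signs. \<Sum>\<delta>\<in>signs. \<phi> (g \<epsilon> \<delta>)) \<le> (\<Sum>\<epsilon>\<in>signs. \<Sum>\<delta>\<in>signs. 1)"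
    using \<phi>_bounds by (intro sum_mono)
  then show "(\<Sum>\<epsilon>\<in>signs. \<Sum>\<delta>\<in>signs. \<phi> (g \<epsilon> \<delta>)) \<le> 16" by (simp add: signs_def)
qed

lemma Psi_integrand_bounds:
  assumes "0 \<le> p" "0 \<le> p'"
  shows "0 \<le> tilt k a p * tilt k b p' * (\<Sum>\<epsilon>\<in>signs. \<Sum>\<delta>\<in>signs. \<phi> (g \<epsilon> \<delta>))"
    "tilt k a p * tilt k b p' * (\<Sum>\<epsilon>\<in>signs. \<Sum>\<delta>\<in>signs. \<phi> (g \<epsilon> \<delta>)) \<le> 16"
proof -
  show "0 \<le> tilt k a p * tilt k b p' * (\<Sum>\<epsilon>\<in>signs. \<Sum>\<delta>\<in>signs. \<phi> (g \<epsilon> \<delta>))"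
    using Psi_sum_bounds(1) by simp
  have "tilt k a p * tilt k b p' \<le> 1 * 1"
    using assms k by (intro mult_mono tilt_le_1) auto
  then have "tilt k a p * tilt k b p' * (\<Sum>\<epsilon>\<in>signs. \<Sum>\<delta>\<in>signs. \<phi> (g \<epsilon> \<delta>)) \<le> 1 * 16"
    using Psi_sum_bounds by (intro mult_mono) auto
  then show "tilt k a p * tilt k b p' * (\<Sum>\<epsilon>\<in>signs. \<Sum>\<delta>\<in>signs. \<phi> (g \<epsilon> \<delta>)) \<le> 16" by simp
qed

lemma integrable_Psi:
  "integrable (arcsine \<Otimes>\<^sub>M arcsine) (\<lambda>y. tilt k a (fst y) * tilt k b (snd y) *
     (\<Sum>\<epsilon>\<in>signs. \<Sum>\<delta>\<in>signs. \<phi> (overlap_kernel a b x \<epsilon> \<delta> (fst y) (snd y))))"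
proof -
  note measurable_phi [measurable]
  interpret finite_measure "arcsine \<Otimes>\<^sub>M arcsine"
    by (rule finite_measure_pair_measure) unfold_locales
  show ?thesis
  proof (rule integrable_const_bound[where B = 16])
    show "AE y in arcsine \<Otimes>\<^sub>M arcsine. norm (tilt k a (fst y) * tilt k b (snd y) *
     (\<Sum>\<epsilon>\<in>signs. \<Sum>\<delta>\<in>signs. \<phi> (overlap_kernel a b x \<epsilon> \<delta> (fst y) (snd y)))) \<le> 16"
      using AE_arcsine_pair
    proof eventually_elim
      case (elim y)
      then have p: "0 \<le> fst y" "0 \<le> snd y" by auto
      show ?case using Psi_integrand_bounds[OF p] by simp
    qed
  qed measurable
qed

lemma Psi_nonneg: "Psi \<phi> k a b x \<ge> 0"
  unfolding Psi_def using Psi_sum_bounds(1) by (intro integral_nonneg_AE) simp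

lemma Psi_le: "Psi \<phi> k a b x \<le> 16 * measure (arcsine \<Otimes>\<^sub>M arcsine) UNIV"
proof -
  interpret A: finite_measure "arcsine \<Otimes>\<^sub>M arcsine"
    by (rule finite_measure_pair_measure) unfold_locales
  have "Psi \<phi> k a b x \<le> (\<integral>y. 16 \<partial>(arcsine \<Otimes>\<^sub>M arcsine))"
    unfolding Psi_def
  proof (rule integral_mono_AE[OF integrable_Psi])
    show "AE y in arcsine \<Otimes>\<^sub>M arcsine. tilt k a (fst y) * tilt k b (snd y) *
     (\<Sum>\<epsilon>\<in>signs. \<Sum>\<delta>\<in>signs. \<phi> (overlap_kernel a b x \<epsilon> \<delta> (fst y) (snd y))) \<le> 16"
      using AE_arcsine_pair
    proof eventually_elim
      case (elim y)
      then have p: "0 \<le> fst y" "0 \<le> snd y" by auto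
      show ?case using Psi_integrand_bounds(2)[OF p] .
    qed
  qed simp
  then show ?thesis by (simp add: space_pair_measure mult.commute)
qed

lemma ennreal_Psi:
  "ennreal (Psi \<phi> k a b x) = (\<integral>\<^sup>+p. \<integral>\<^sup>+p'. ennreal (tilt k a p * tilt k b p' *
     (\<Sum>\<epsilon>\<in>signs. \<Sum>\<delta>\<in>signs. \<phi> (overlap_kernel a b x \<epsilon> \<delta> p p'))) \<partial>arcsine \<partial>arcsine)"
proof -
  note measurable_phi [measurable]
  have "ennreal (Psi \<phi> k a b x) = (\<integral>\<^sup>+y. ennreal (tilt k a (fst y) * tilt k b (snd y) *
     (\<Sum>\<epsilon>\<in>signs. \<Sum>\<delta>\<in>signs. \<phi> (overlap_kernel a b x \<epsilon> \<delta> (fst y) (snd y)))) \<partial>(arcsine \<Otimes>\<^sub>M arcsine))"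
    unfolding Psi_def
    by (rule nn_integral_eq_integral[symmetric, OF integrable_Psi]) (simp add: Psi_sum_bounds)
  also have "\<dots> = (\<integral>\<^sup>+p. \<integral>\<^sup>+p'. ennreal (tilt k a (fst (p, p')) * tilt k b (snd (p, p')) *
     (\<Sum>\<epsilon>\<in>signs. \<Sum>\<delta>\<in>signs. \<phi> (overlap_kernel a b x \<epsilon> \<delta> (fst (p, p')) (snd (p, p'))))) \<partial>arcsine \<partial>arcsine)"
    by (rule arcsine.nn_integral_fst[symmetric]) measurable
  finally show ?thesis by simp
qed

lemma Psi_tendsto:
  assumes lim: "u \<longlonglongrightarrow> a" "v \<longlonglongrightarrow> a'" "w \<longlonglongrightarrow> x" and a: "a < 1" "a' < 1"
  shows "(\<lambda>n. Psi \<phi> k (u n) (v n) (w n)) \<longlonglongrightarrow> Psi \<phi> k a a' x"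
  unfolding Psi_def
proof (rule integral_dominated_convergence[where w = "\<lambda>_. 16"])
  interpret A: finite_measure "arcsine \<Otimes>\<^sub>M arcsine"
    by (rule finite_measure_pair_measure) unfold_locales
  show "integrable (arcsine \<Otimes>\<^sub>M arcsine) (\<lambda>_. 16::real)" by simp
  show "AE y in arcsine \<Otimes>\<^sub>M arcsine. norm (tilt k (u n) (fst y) * tilt k (v n) (snd y) *
     (\<Sum>\<epsilon>\<in>signs. \<Sum>\<delta>\<in>signs. \<phi> (overlap_kernel (u n) (v n) (w n) \<epsilon> \<delta> (fst y) (snd y)))) \<le> 16" for n
    using AE_arcsine_pair
  proof eventually_elim
    case (elim y)
    then have p: "0 \<le> fst y" "0 \<le> snd y" by auto
    show ?case using Psi_integrand_bounds[OF p] by simp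
  qed
  have tilt_lim: "(\<lambda>n. tilt k (u n) p) \<longlonglongrightarrow> tilt k a p" if "u \<longlonglongrightarrow> a" "a < 1" for u a p
  proof -
    have ev: "\<forall>\<^sub>F n in sequentially. u n < 1"
      using that by (rule order_tendstoD(2))
    have "(\<lambda>n. exp (- (k * (1 - u n) * p))) \<longlonglongrightarrow> exp (- (k * (1 - a) * p))"
      using that by (intro tendsto_intros)
    then show ?thesis
      unfolding tilt_def using that(2)
      by (simp, elim Lim_transform_eventually) (use ev in \<open>eventually_elim, simp\<close>)
  qed
  have phi_lim: "(\<lambda>n. \<phi> (f n)) \<longlonglongrightarrow> \<phi> l" if "f \<longlonglongrightarrow> l" for f l
    using \<phi>_cont that by (auto intro: continuous_on_tendsto_compose)
  show "AE y in arcsine \<Otimes>\<^sub>M arcsine. (\<lambda>n. tilt k (u n) (fst y) * tilt k (v n) (snd y) *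
     (\<Sum>\<epsilon>\<in>signs. \<Sum>\<delta>\<in>signs. \<phi> (overlap_kernel (u n) (v n) (w n) \<epsilon> \<delta> (fst y) (snd y))))
    \<longlonglongrightarrow> tilt k a (fst y) * tilt k a' (snd y) *
     (\<Sum>\<epsilon>\<in>signs. \<Sum>\<delta>\<in>signs. \<phi> (overlap_kernel a a' x \<epsilon> \<delta> (fst y) (snd y)))"
    unfolding overlap_kernel_def
    by (intro AE_I2 tendsto_mult tilt_lim lim a tendsto_sum phi_lim tendsto_add tendsto_const
        tendsto_real_sqrt tendsto_diff)
qed (use measurable_phi [measurable] in measurable)

end

text \<open>
  A bounded function that is continuous at \<open>y0\<close> is at most \<open>\<epsilon> + C \<cdot> dist(y, y0)\<^sup>2\<close> away from its
  value there, so convergence to \<open>y0\<close> in quadratic mean, on varying probability spaces, suffices.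
\<close>

lemma tendsto_expectation_of_L2:
  fixes Y :: "nat \<Rightarrow> 'a \<Rightarrow> real \<times> real \<times> real" and M :: "nat \<Rightarrow> 'a measure"
    and h :: "real \<times> real \<times> real \<Rightarrow> real"
  assumes M: "\<And>n. prob_space (M n)" and Y [measurable]: "\<And>n. Y n \<in> borel_measurable (M n)"
    and h [measurable]: "h \<in> borel_measurable borel" and B: "\<And>y. \<bar>h y\<bar> \<le> B" and cont: "isCont h y0"
    and L2: "(\<lambda>n. \<integral>\<^sup>+\<omega>. ennreal ((dist (Y n \<omega>) y0)\<^sup>2) \<partial>M n) \<longlonglongrightarrow> 0"
  shows "(\<lambda>n. \<integral>\<omega>. h (Y n \<omega>) \<partial>M n) \<longlonglongrightarrow> h y0"
proof (rule LIMSEQ_I)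
  fix e :: real assume e: "e > 0"
  obtain d where d: "d > 0" and hd: "\<And>y. dist y y0 < d \<Longrightarrow> \<bar>h y - h y0\<bar> < e / 2"
    using cont e unfolding continuous_at_eps_delta dist_real_def
    by (metis half_gt_zero)
  define c where "c = 2 * B / d\<^sup>2"
  have B0: "B \<ge> 0" using B[of y0] by linarith
  have c: "c \<ge> 0" using B0 by (simp add: c_def)
  have point: "\<bar>h y - h y0\<bar> \<le> e / 2 + c * (dist y y0)\<^sup>2" for y
  proof (cases "dist y y0 < d")
    case True
    then show ?thesis using hd[OF True] c by (intro order_trans[OF less_imp_le[OF hd[OF True]]]) simp
  next
    case False
    then have "1 \<le> (dist y y0)\<^sup>2 / d\<^sup>2" using d by (simp add: power_mono)
    then have "2 * B * 1 \<le> 2 * B * ((dist y y0)\<^sup>2 / d\<^sup>2)"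
      using B0 by (intro mult_left_mono) auto
    moreover have "\<bar>h y - h y0\<bar> \<le> 2 * B" using B[of y] B[of y0] by linarith
    ultimately show ?thesis using e by (simp add: c_def)
  qed
  have "\<forall>\<^sub>F n in sequentially. (\<integral>\<^sup>+\<omega>. ennreal ((dist (Y n \<omega>) y0)\<^sup>2) \<partial>M n) < ennreal (e / (2 * c + 2))"
    using L2 e c by (intro order_tendstoD(2)) (auto intro!: divide_pos_pos add_nonneg_pos)
  then obtain N where N: "\<And>n. n \<ge> N \<Longrightarrow> (\<integral>\<^sup>+\<omega>. ennreal ((dist (Y n \<omega>) y0)\<^sup>2) \<partial>M n) < ennreal (e / (2 * c + 2))"
    by (auto simp: eventually_sequentially)
  show "\<exists>no. \<forall>n\<ge>no. norm ((\<integral>\<omega>. h (Y n \<omega>) \<partial>M n) - h y0) < e"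
  proof (intro exI allI impI)
    fix n assume n: "n \<ge> N"
    interpret P: prob_space "M n" by (rule M)
    have int_h: "integrable (M n) (\<lambda>\<omega>. h (Y n \<omega>))"
      by (rule P.integrable_const_bound[where B = B]) (use B in auto)
    let ?D = "\<lambda>\<omega>. (dist (Y n \<omega>) y0)\<^sup>2"
    have fin: "(\<integral>\<^sup>+\<omega>. ennreal (?D \<omega>) \<partial>M n) < \<infinity>"
      using less_trans[OF N[OF n] ennreal_less_top] by simp
    have int_D: "integrable (M n) ?D"
      by (rule integrableI_nonneg) (use fin in auto)
    have "ennreal (\<integral>\<omega>. ?D \<omega> \<partial>M n) < ennreal (e / (2 * c + 2))"
      using N[OF n] by (subst (asm) nn_integral_eq_integral[OF int_D]) auto
    then have D: "(\<integral>\<omega>. ?D \<omega> \<partial>M n) < e / (2 * c + 2)"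
      by (subst (asm) ennreal_less_iff) auto
    have D0: "(\<integral>\<omega>. ?D \<omega> \<partial>M n) \<ge> 0" by (rule integral_nonneg_AE) simp
    have "(\<integral>\<omega>. h (Y n \<omega>) \<partial>M n) - h y0 = (\<integral>\<omega>. h (Y n \<omega>) - h y0 \<partial>M n)"
      using int_h by (subst Bochner_Integration.integral_diff) (auto simp: P.prob_space)
    then have "norm ((\<integral>\<omega>. h (Y n \<omega>) \<partial>M n) - h y0) \<le> (\<integral>\<omega>. norm (h (Y n \<omega>) - h y0) \<partial>M n)"
      by (simp only: integral_norm_bound)
    also have "\<dots> \<le> (\<integral>\<omega>. e / 2 + c * ?D \<omega> \<partial>M n)"
      using int_h int_D point by (intro integral_mono) auto
    also have "\<dots> = e / 2 + c * (\<integral>\<omega>. ?D \<omega> \<partial>M n)"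
      using int_D by (subst Bochner_Integration.integral_add) (auto simp: P.prob_space)
    also have "c * (\<integral>\<omega>. ?D \<omega> \<partial>M n) \<le> c * (e / (2 * c + 2))"
      using D c by (intro mult_left_mono) auto
    also have "c * (e / (2 * c + 2)) < e / 2"
      using c e by (simp add: field_simps)
    finally show "norm ((\<integral>\<omega>. h (Y n \<omega>) \<partial>M n) - h y0) < e" by simp
  qed
qed

section \<open>The limit law\<close>

lemma s_weight_nonneg: "s_weight r c \<beta> x \<ge> 0"
  by (auto simp: s_weight_def indicator_def)

lemma measurable_s_weight [measurable]: "s_weight r c \<beta> \<in> borel_measurable borel"
  unfolding s_weight_def by measurable

text \<open>
  The substitution \<open>x = r p\<close> turns the density of \<open>s\<close> into a tilted arcsine law. At \<open>p = 0\<close> and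
  \<open>p = 1\<close> both densities are 0 because of \<open>1 / 0 = 0\<close>.
\<close>

lemma nn_integral_s_weight:
  assumes r: "r > 0" and [measurable]: "g \<in> borel_measurable borel"
  shows "(\<integral>\<^sup>+x. ennreal (s_weight r c \<beta> x) * g x \<partial>lborel)
    = (\<integral>\<^sup>+p. ennreal (exp (- (c * \<beta> / 2 * r * p))) * g (r * p) \<partial>arcsine)"
proof -
  have w: "r * s_weight r c \<beta> (r * p) = arc_weight p * exp (- (c * \<beta> / 2 * r * p))" for p
  proof (cases "0 < p \<and> p < 1")
    case True
    have eq: "r * p * (r - r * p) = r\<^sup>2 * (p * (1 - p))" by (simp add: power2_eq_square algebra_simps)
    have "sqrt (r * p * (r - r * p)) = sqrt (r\<^sup>2) * sqrt (p * (1 - p))"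
      unfolding eq by (rule real_sqrt_mult)
    also have "sqrt (r\<^sup>2) = r" using r by simp
    finally show ?thesis
      using True r by (simp add: s_weight_def arc_weight_def mult_le_cancel_left1 mult.assoc)
  next
    case False
    then consider "p = 0" | "p = 1" | "p < 0" | "p > 1" by linarith
    then show ?thesis
      using r by cases (auto simp: s_weight_def arc_weight_def zero_le_mult_iff mult_le_cancel_left1)
  qed
  have "(\<integral>\<^sup>+x. ennreal (s_weight r c \<beta> x) * g x \<partial>lborel)
      = ennreal r * (\<integral>\<^sup>+p. ennreal (s_weight r c \<beta> (r * p)) * g (r * p) \<partial>lborel)"
    using r by (subst nn_integral_real_affine[of _ r 0]) auto
  also have "\<dots> = (\<integral>\<^sup>+p. ennreal r * (ennreal (s_weight r c \<beta> (r * p)) * g (r * p)) \<partial>lborel)"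
    by (rule nn_integral_cmult[symmetric]) measurable
  also have "\<dots> = (\<integral>\<^sup>+p. ennreal (arc_weight p) * (ennreal (exp (- (c * \<beta> / 2 * r * p))) * g (r * p)) \<partial>lborel)"
  proof (rule nn_integral_cong)
    fix p
    have "ennreal r * (ennreal (s_weight r c \<beta> (r * p)) * g (r * p))
        = ennreal (r * s_weight r c \<beta> (r * p)) * g (r * p)"
      using r by (simp add: ennreal_mult s_weight_nonneg mult.assoc)
    also have "\<dots> = ennreal (arc_weight p) * (ennreal (exp (- (c * \<beta> / 2 * r * p))) * g (r * p))"
      unfolding w by (simp add: ennreal_mult mult.assoc)
    finally show "ennreal r * (ennreal (s_weight r c \<beta> (r * p)) * g (r * p))
        = ennreal (arc_weight p) * (ennreal (exp (- (c * \<beta> / 2 * r * p))) * g (r * p))" .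
  qed
  also have "\<dots> = (\<integral>\<^sup>+p. ennreal (exp (- (c * \<beta> / 2 * r * p))) * g (r * p) \<partial>arcsine)"
    by (rule nn_integral_arcsine[symmetric]) measurable
  finally show ?thesis .
qed

text \<open>
  The normalising constant of \<open>s_law\<close>.
\<close>

definition s_mass :: "real \<Rightarrow> real \<Rightarrow> real \<Rightarrow> real" where
  "s_mass r c \<beta> = (\<integral>y. s_weight r c \<beta> y \<partial>lborel)"

lemma s_mass_nn_integral:
  assumes r: "r > 0" and c: "c * \<beta> \<ge> 0"
  shows "s_mass r c \<beta> > 0" "ennreal (s_mass r c \<beta>) = (\<integral>\<^sup>+x. ennreal (s_weight r c \<beta> x) \<partial>lborel)"
proof -
  let ?N = "\<integral>\<^sup>+x. ennreal (s_weight r c \<beta> x) \<partial>lborel"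
  have N: "?N = (\<integral>\<^sup>+p. ennreal (exp (- (c * \<beta> / 2 * r * p))) \<partial>arcsine)"
    using nn_integral_s_weight[OF r, of "\<lambda>_. 1"] by simp
  have "?N \<le> (\<integral>\<^sup>+p. 1 \<partial>arcsine)"
    unfolding N
  proof (rule nn_integral_mono_AE)
    show "AE p in arcsine. ennreal (exp (- (c * \<beta> / 2 * r * p))) \<le> 1"
      using AE_arcsine by eventually_elim (use r c in simp)
  qed
  also have "\<dots> < \<infinity>" using emeasure_arcsine(2) by (simp add: less_top[symmetric])
  finally have fin: "?N < \<infinity>" .
  have "?N \<noteq> 0"
  proof
    assume "?N = 0"
    then have "AE p in arcsine. ennreal (exp (- (c * \<beta> / 2 * r * p))) = 0"
      unfolding N by (subst (asm) nn_integral_0_iff_AE) auto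
    then have "AE p in arcsine. False" by simp
    then have "emeasure arcsine UNIV = 0"
      by (subst (asm) AE_iff_measurable[OF _ refl]) auto
    with emeasure_arcsine(1) show False by simp
  qed
  have "integrable lborel (s_weight r c \<beta>)"
    by (rule integrableI_nonneg) (use fin in \<open>auto simp: s_weight_nonneg\<close>)
  then show *: "ennreal (s_mass r c \<beta>) = ?N"
    unfolding s_mass_def by (intro nn_integral_eq_integral[symmetric]) (auto simp: s_weight_nonneg)
  show "s_mass r c \<beta> > 0"
    using \<open>?N \<noteq> 0\<close> unfolding *[symmetric] by (simp add: ennreal_eq_0_iff not_le)
qed

lemma sets_s_law [simp, measurable_cong]: "sets (s_law r c \<beta>) = sets borel"
  by (simp add: s_law_def)

lemma nn_integral_s_law:
  assumes r: "r > 0" and c: "c * \<beta> \<ge> 0" and [measurable]: "g \<in> borel_measurable borel"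
  shows "ennreal (s_mass r c \<beta>) * (\<integral>\<^sup>+x. g x \<partial>s_law r c \<beta>)
    = (\<integral>\<^sup>+p. ennreal (exp (- (c * \<beta> / 2 * r * p))) * g (r * p) \<partial>arcsine)"
proof -
  note pos = s_mass_nn_integral(1)[OF r c]
  have "(\<integral>\<^sup>+x. g x \<partial>s_law r c \<beta>) = (\<integral>\<^sup>+x. ennreal (s_weight r c \<beta> x / s_mass r c \<beta>) * g x \<partial>lborel)"
    unfolding s_law_def s_mass_def by (rule nn_integral_density) auto
  then have "ennreal (s_mass r c \<beta>) * (\<integral>\<^sup>+x. g x \<partial>s_law r c \<beta>)
      = (\<integral>\<^sup>+x. ennreal (s_mass r c \<beta>) * (ennreal (s_weight r c \<beta> x / s_mass r c \<beta>) * g x) \<partial>lborel)"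
    by (simp add: nn_integral_cmult)
  also have "\<dots> = (\<integral>\<^sup>+x. ennreal (s_weight r c \<beta> x) * g x \<partial>lborel)"
    using pos by (intro nn_integral_cong)
      (simp add: mult.assoc[symmetric] ennreal_mult[symmetric] s_weight_nonneg)
  finally show ?thesis by (simp add: nn_integral_s_weight[OF r])
qed

lemma prob_space_s_law:
  assumes r: "r > 0" and c: "c * \<beta> \<ge> 0"
  shows "prob_space (s_law r c \<beta>)"
proof (rule prob_spaceI)
  have "ennreal (s_mass r c \<beta>) * emeasure (s_law r c \<beta>) (space (s_law r c \<beta>)) = ennreal (s_mass r c \<beta>)"
    using nn_integral_s_law[OF r c, of "\<lambda>_. 1"] nn_integral_s_weight[OF r, of "\<lambda>_. 1" c \<beta>] s_mass_nn_integral(2)[OF r c]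
    by (simp add: nn_integral_const)
  then show "emeasure (s_law r c \<beta>) (space (s_law r c \<beta>)) = 1"
    using s_mass_nn_integral(1)[OF r c] by (metis ennreal_mult_cancel_left mult.right_neutral ennreal_eq_0_iff
        ennreal_neq_top infinity_ennreal_def not_le)
qed

lemma sets_rademacher [simp, measurable_cong]: "sets rademacher = sets borel"
  by (simp add: rademacher_def)

lemma measurable_uniform_count_measure_borel: "f \<in> borel_measurable (uniform_count_measure A)"
  by (simp add: measurable_cong_sets[OF sets_uniform_count_measure_count_space refl])

lemma prob_space_rademacher: "prob_space rademacher"
  unfolding rademacher_def
  by (intro prob_space.prob_space_distr prob_space_uniform_count_measure
      measurable_uniform_count_measure_borel) auto

lemma nn_integral_rademacher:
  assumes "g \<in> borel_measurable borel"
  shows "(\<integral>\<^sup>+z. g z \<partial>rademacher) = (\<Sum>z\<in>{-1, 1}. g z / 2)"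
proof -
  have "(\<integral>\<^sup>+z. g z \<partial>rademacher) = (\<integral>\<^sup>+z. g z \<partial>uniform_count_measure {-1, 1})"
    unfolding rademacher_def by (rule nn_integral_distr[OF measurable_uniform_count_measure_borel]) (simp add: assms)
  also have "\<dots> = (\<Sum>z\<in>{-1, 1}. g z / 2)"
    unfolding uniform_count_measure_def
    by (subst nn_integral_point_measure_finite) (auto simp: divide_ennreal_def ennreal_divide_numeral mult.commute simp flip: inverse_ennreal)
  finally show ?thesis .
qed

lemma ennreal_divide_2_2: "a / 2 / 2 = a / (4 :: ennreal)"
proof -
  have "inverse (2 :: ennreal) * inverse 2 = inverse 4"
    using inverse_ennreal[of 2] inverse_ennreal[of 4] ennreal_mult[of "1/2" "1/2"] by simp
  then show ?thesis by (simp add: divide_ennreal_def mult.assoc)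
qed

lemma nn_integral_rademacher_pair:
  assumes [measurable]: "h \<in> borel_measurable (borel \<Otimes>\<^sub>M borel)"
  shows "(\<integral>\<^sup>+z. h z \<partial>(rademacher \<Otimes>\<^sub>M rademacher)) = (\<Sum>z1\<in>{-1, 1}. \<Sum>z2\<in>{-1, 1}. h (z1, z2) / 4)"
proof -
  interpret Z: prob_space rademacher by (rule prob_space_rademacher)
  have "(\<integral>\<^sup>+z. h z \<partial>(rademacher \<Otimes>\<^sub>M rademacher)) = (\<integral>\<^sup>+z1. \<integral>\<^sup>+z2. h (z1, z2) \<partial>rademacher \<partial>rademacher)"
    by (rule Z.nn_integral_fst[symmetric]) measurable
  also have "\<dots> = (\<integral>\<^sup>+z1. (\<Sum>z2\<in>{-1, 1}. h (z1, z2) / 2) \<partial>rademacher)"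
    by (intro nn_integral_cong nn_integral_rademacher) measurable
  also have "\<dots> = (\<Sum>z1\<in>{-1, 1}. (\<Sum>z2\<in>{-1, 1}. h (z1, z2) / 2) / 2)"
    by (rule nn_integral_rademacher) measurable
  also have "\<dots> = (\<Sum>z1\<in>{-1, 1}. \<Sum>z2\<in>{-1, 1}. h (z1, z2) / 4)"
  proof -
    have "(a + b) / 2 = a / 2 + b / 2" for a b :: ennreal
      by (simp add: divide_ennreal_def distrib_right)
    then show ?thesis by (simp add: ennreal_divide_2_2)
  qed
  finally show ?thesis .
qed

text \<open>
  The function of \<open>(s\<^sub>1, s\<^sub>2)\<close> and the two random signs whose distribution is \<open>limit_law\<close>.
\<close>

definition limit_map :: "real \<Rightarrow> (real \<times> real) \<times> (real \<times> real) \<Rightarrow> real" where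
  "limit_map r = (\<lambda>((s1, s2), (z1, z2)). sqrt (s1 * s2) * z1 + sqrt ((r - s1) * (r - s2)) * z2)"

lemma measurable_limit_map:
  "limit_map r \<in> borel_measurable ((s_law r' c \<beta> \<Otimes>\<^sub>M s_law r' c \<beta>) \<Otimes>\<^sub>M (rademacher \<Otimes>\<^sub>M rademacher))"
proof -
  have "limit_map r = (\<lambda>w. sqrt (fst (fst w) * snd (fst w)) * fst (snd w)
      + sqrt ((r - fst (fst w)) * (r - snd (fst w))) * snd (snd w))"
    by (simp add: limit_map_def fun_eq_iff split_beta')
  then show ?thesis by simp
qed

lemma real_distribution_limit_law:
  assumes r: "r > 0" and c: "c * \<beta> \<ge> 0"
  shows "real_distribution (limit_law r c \<beta>)"
proof -
  interpret S: prob_space "s_law r c \<beta>" by (rule prob_space_s_law[OF r c])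
  interpret Z: prob_space rademacher by (rule prob_space_rademacher)
  interpret SS: pair_prob_space "s_law r c \<beta>" "s_law r c \<beta>" ..
  interpret ZZ: pair_prob_space rademacher rademacher ..
  interpret P: pair_prob_space "s_law r c \<beta> \<Otimes>\<^sub>M s_law r c \<beta>" "rademacher \<Otimes>\<^sub>M rademacher" ..
  show ?thesis
    unfolding limit_law_def using measurable_limit_map[of r r c \<beta>]
    by (intro P.real_distribution_distr) (simp add: limit_map_def)
qed

lemma nn_integral_limit_law:
  assumes r: "r > 0" and c: "c * \<beta> \<ge> 0" and g [measurable]: "g \<in> borel_measurable borel"
  shows "16 * (ennreal (s_mass r c \<beta>) * (ennreal (s_mass r c \<beta>) * (\<integral>\<^sup>+x. g x \<partial>limit_law r c \<beta>)))
    = (\<integral>\<^sup>+p. \<integral>\<^sup>+p'. ennreal (exp (- (c * \<beta> / 2 * r * p))) * (ennreal (exp (- (c * \<beta> / 2 * r * p'))) *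
        (\<Sum>z1\<in>{-1, 1}. \<Sum>z2\<in>{-1, 1}. 4 * g (sqrt (r * p * (r * p')) * z1 + sqrt ((r - r * p) * (r - r * p')) * z2)))
        \<partial>arcsine \<partial>arcsine)"
proof -
  interpret S: prob_space "s_law r c \<beta>" by (rule prob_space_s_law[OF r c])
  interpret Z: prob_space rademacher by (rule prob_space_rademacher)
  interpret SS: pair_prob_space "s_law r c \<beta>" "s_law r c \<beta>" ..
  interpret ZZ: pair_prob_space rademacher rademacher ..
  interpret P: pair_prob_space "s_law r c \<beta> \<Otimes>\<^sub>M s_law r c \<beta>" "rademacher \<Otimes>\<^sub>M rademacher" ..
  let ?S = "s_law r c \<beta>" and ?Z = rademacher and ?m = "ennreal (s_mass r c \<beta>)"
  let ?G = "\<lambda>s1 s2 z1 z2. g (sqrt (s1 * s2) * z1 + sqrt ((r - s1) * (r - s2)) * z2)"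
  let ?E = "\<lambda>p. ennreal (exp (- (c * \<beta> / 2 * r * p)))"
  have lm: "(\<lambda>w. g (limit_map r w)) \<in> borel_measurable ((?S \<Otimes>\<^sub>M ?S) \<Otimes>\<^sub>M (?Z \<Otimes>\<^sub>M ?Z))"
    by (rule measurable_compose[OF measurable_limit_map g])
  have Gm [measurable]: "(\<lambda>w. ?G (f1 w) (f2 w) (f3 w) (f4 w)) \<in> borel_measurable N"
    if [measurable]: "f1 \<in> borel_measurable N" "f2 \<in> borel_measurable N" "f3 \<in> borel_measurable N" "f4 \<in> borel_measurable N"
    for f1 f2 f3 f4 and N :: "'b measure"
    by measurable
  have "(\<integral>\<^sup>+x. g x \<partial>limit_law r c \<beta>) = (\<integral>\<^sup>+w. g (limit_map r w) \<partial>((?S \<Otimes>\<^sub>M ?S) \<Otimes>\<^sub>M (?Z \<Otimes>\<^sub>M ?Z)))"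
    unfolding limit_law_def limit_map_def[symmetric]
    by (rule nn_integral_distr[OF measurable_limit_map]) (simp add: g)
  also have "\<dots> = (\<integral>\<^sup>+s. \<integral>\<^sup>+z. g (limit_map r (s, z)) \<partial>(?Z \<Otimes>\<^sub>M ?Z) \<partial>(?S \<Otimes>\<^sub>M ?S))"
    by (rule ZZ.nn_integral_fst[OF lm, symmetric])
  also have "\<dots> = (\<integral>\<^sup>+s. (\<Sum>z1\<in>{-1, 1}. \<Sum>z2\<in>{-1, 1}. ?G (fst s) (snd s) z1 z2 / 4) \<partial>(?S \<Otimes>\<^sub>M ?S))"
  proof (rule nn_integral_cong)
    fix s
    show "(\<integral>\<^sup>+z. g (limit_map r (s, z)) \<partial>(?Z \<Otimes>\<^sub>M ?Z))
        = (\<Sum>z1\<in>{-1, 1}. \<Sum>z2\<in>{-1, 1}. ?G (fst s) (snd s) z1 z2 / 4)"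
      by (subst nn_integral_rademacher_pair) (simp_all add: limit_map_def split_beta')
  qed
  also have "\<dots> = (\<integral>\<^sup>+s1. \<integral>\<^sup>+s2. (\<Sum>z1\<in>{-1, 1}. \<Sum>z2\<in>{-1, 1}. ?G (fst (s1, s2)) (snd (s1, s2)) z1 z2 / 4) \<partial>?S \<partial>?S)"
    by (rule S.nn_integral_fst[symmetric]) measurable
  finally have lim: "(\<integral>\<^sup>+x. g x \<partial>limit_law r c \<beta>)
      = (\<integral>\<^sup>+s1. \<integral>\<^sup>+s2. (\<Sum>z1\<in>{-1, 1}. \<Sum>z2\<in>{-1, 1}. ?G s1 s2 z1 z2 / 4) \<partial>?S \<partial>?S)" by simp
  have step: "?m * (\<integral>\<^sup>+x. g x \<partial>limit_law r c \<beta>)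
      = (\<integral>\<^sup>+p. ?E p * (\<integral>\<^sup>+s2. (\<Sum>z1\<in>{-1, 1}. \<Sum>z2\<in>{-1, 1}. ?G (r * p) s2 z1 z2 / 4) \<partial>?S) \<partial>arcsine)"
    unfolding lim by (rule nn_integral_s_law[OF r c]) measurable
  define Y where "Y p = ?E p * (\<integral>\<^sup>+s2. (\<Sum>z1\<in>{-1, 1}. \<Sum>z2\<in>{-1, 1}. ?G (r * p) s2 z1 z2 / 4) \<partial>?S)" for p
  have Ym: "Y \<in> borel_measurable arcsine"
    unfolding Y_def by measurable
  have "16 * (?m * (?m * (\<integral>\<^sup>+x. g x \<partial>limit_law r c \<beta>))) = 16 * ?m * (\<integral>\<^sup>+p. Y p \<partial>arcsine)"
    unfolding step Y_def by (rule mult.assoc[symmetric])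
  also have "\<dots> = (\<integral>\<^sup>+p. 16 * ?m * Y p \<partial>arcsine)"
    by (rule nn_integral_cmult[symmetric, OF Ym])
  also have "\<dots> = (\<integral>\<^sup>+p. 16 * (?m * (?E p * (\<integral>\<^sup>+s2. (\<Sum>z1\<in>{-1, 1}. \<Sum>z2\<in>{-1, 1}. ?G (r * p) s2 z1 z2 / 4) \<partial>?S))) \<partial>arcsine)"
    unfolding Y_def by (simp only: mult.assoc)
  also have "\<dots> = (\<integral>\<^sup>+p. \<integral>\<^sup>+p'. ?E p * (?E p' *
        (\<Sum>z1\<in>{-1, 1}. \<Sum>z2\<in>{-1, 1}. 4 * ?G (r * p) (r * p') z1 z2)) \<partial>arcsine \<partial>arcsine)"
  proof (rule nn_integral_cong)
    fix p :: real
    let ?H = "\<lambda>s2. (\<Sum>z1\<in>{-1, 1}. \<Sum>z2\<in>{-1, 1}. ?G (r * p) s2 z1 z2 / 4)"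
    have H16: "16 * ?H s2 = (\<Sum>z1\<in>{-1, 1}. \<Sum>z2\<in>{-1, 1}. 4 * ?G (r * p) s2 z1 z2)" for s2
    proof -
      have "16 * (a / 4) = 4 * a" for a :: ennreal
      proof -
        have "16 * (a / 4) = 4 * (4 * a / 4)" by (simp add: ennreal_times_divide mult.assoc[symmetric])
        also have "4 * a / 4 = a" by (simp add: mult.commute ennreal_mult_divide_eq)
        finally show ?thesis .
      qed
      then show ?thesis by (simp only: sum_distrib_left)
    qed
    have "16 * (?m * (?E p * (\<integral>\<^sup>+s2. ?H s2 \<partial>?S))) = ?E p * (16 * (?m * (\<integral>\<^sup>+s2. ?H s2 \<partial>?S)))"
      by (simp add: mult_ac)
    also have "?m * (\<integral>\<^sup>+s2. ?H s2 \<partial>?S) = (\<integral>\<^sup>+p'. ?E p' * ?H (r * p') \<partial>arcsine)"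
      by (rule nn_integral_s_law[OF r c]) measurable
    also have "16 * \<dots> = (\<integral>\<^sup>+p'. 16 * (?E p' * ?H (r * p')) \<partial>arcsine)"
      by (rule nn_integral_cmult[symmetric]) measurable
    also have "?E p * \<dots> = (\<integral>\<^sup>+p'. ?E p * (16 * (?E p' * ?H (r * p'))) \<partial>arcsine)"
      by (rule nn_integral_cmult[symmetric]) measurable
    also have "\<dots> = (\<integral>\<^sup>+p'. ?E p * (?E p' *
        (\<Sum>z1\<in>{-1, 1}. \<Sum>z2\<in>{-1, 1}. 4 * ?G (r * p) (r * p') z1 z2)) \<partial>arcsine)"
      unfolding H16[symmetric] by (simp only: mult.left_commute)
    finally show "16 * (?m * (?E p * (\<integral>\<^sup>+s2. ?H s2 \<partial>?S))) = (\<integral>\<^sup>+p'. ?E p * (?E p' *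
        (\<Sum>z1\<in>{-1, 1}. \<Sum>z2\<in>{-1, 1}. 4 * ?G (r * p) (r * p') z1 z2)) \<partial>arcsine)" .
  qed
  finally show ?thesis .
qed

lemma signs_eq: "signs = {(-1, -1), (-1, 1), (1, -1), (1, 1)}"
  by (auto simp: signs_def)

text \<open>
  For tails of squared norm \<open>a\<close> that are orthogonal to each other, \<open>Psi\<close> is the expectation under
  the limit law up to a factor that does not depend on \<open>\<phi>\<close>. The products of the signs of the two
  points take each value four times, which accounts for the two Rademacher variables.
\<close>

lemma Psi_eq_limit_law:
  assumes \<phi>: "continuous_on UNIV \<phi>" "\<And>x. 0 \<le> \<phi> x" "\<And>x. \<phi> x \<le> 1"
    and a: "a < 1" and c: "c * \<beta> \<ge> 0"
  shows "Psi \<phi> (c * \<beta> / 2) a a 0 = 16 * (s_mass (1 - a) c \<beta>)\<^sup>2 * (\<integral>x. \<phi> x \<partial>limit_law (1 - a) c \<beta>)"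
proof -
  define r where "r = 1 - a"
  have r: "r > 0" using a by (simp add: r_def)
  have [measurable]: "\<phi> \<in> borel_measurable borel"
    using \<phi>(1) by (rule borel_measurable_continuous_onI)
  have k: "c * \<beta> / 2 \<ge> 0" using c by simp
  interpret L: real_distribution "limit_law r c \<beta>"
    by (rule real_distribution_limit_law[OF r c])
  have int: "integrable (limit_law r c \<beta>) \<phi>"
    by (rule L.integrable_const_bound[where B = 1]) (use \<phi> in auto)
  have "ennreal (Psi \<phi> (c * \<beta> / 2) a a 0)
      = (\<integral>\<^sup>+p. \<integral>\<^sup>+p'. ennreal (tilt (c * \<beta> / 2) a p * tilt (c * \<beta> / 2) a p' *
         (\<Sum>\<epsilon>\<in>signs. \<Sum>\<delta>\<in>signs. \<phi> (overlap_kernel a a 0 \<epsilon> \<delta> p p'))) \<partial>arcsine \<partial>arcsine)"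
    by (rule ennreal_Psi[OF \<phi> k])
  also have "\<dots> = (\<integral>\<^sup>+p. \<integral>\<^sup>+p'. ennreal (exp (- (c * \<beta> / 2 * r * p))) * (ennreal (exp (- (c * \<beta> / 2 * r * p'))) *
        (\<Sum>z1\<in>{-1, 1}. \<Sum>z2\<in>{-1, 1}. 4 * ennreal (\<phi> (sqrt (r * p * (r * p')) * z1 + sqrt ((r - r * p) * (r - r * p')) * z2))))
        \<partial>arcsine \<partial>arcsine)"
  proof (intro nn_integral_cong)
    fix p p' :: real
    let ?x = "sqrt (r * p * (r * p'))" and ?y = "sqrt ((r - r * p) * (r - r * p'))"
    have xy: "sqrt ((1 - a) * p) * sqrt ((1 - a) * p') = ?x"
      "sqrt ((1 - a) * (1 - p)) * sqrt ((1 - a) * (1 - p')) = ?y"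
      by (simp_all add: r_def real_sqrt_mult[symmetric] right_diff_distrib)
    have "(\<Sum>\<epsilon>\<in>signs. \<Sum>\<delta>\<in>signs. \<phi> (fst \<epsilon> * fst \<delta> * x + snd \<epsilon> * snd \<delta> * y + 0))
        = (\<Sum>z1\<in>{-1, 1}. \<Sum>z2\<in>{-1, 1}. 4 * \<phi> (x * z1 + y * z2))" for x y
      by (simp add: signs_eq algebra_simps minus_diff_commute)
    then have sum: "(\<Sum>\<epsilon>\<in>signs. \<Sum>\<delta>\<in>signs. \<phi> (overlap_kernel a a 0 \<epsilon> \<delta> p p'))
        = (\<Sum>z1\<in>{-1, 1}. \<Sum>z2\<in>{-1, 1}. 4 * \<phi> (?x * z1 + ?y * z2))"
      unfolding overlap_kernel_def xy .
    have "ennreal (\<Sum>z1\<in>{-1, 1}. \<Sum>z2\<in>{-1, 1}. 4 * \<phi> (?x * z1 + ?y * z2))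
        = (\<Sum>z1\<in>{-1, 1}. \<Sum>z2\<in>{-1, 1}. 4 * ennreal (\<phi> (?x * z1 + ?y * z2)))"
      using \<phi>(2) by (simp add: ennreal_mult'' ennreal_plus sum_nonneg flip: ennreal_numeral)
    then show "ennreal (tilt (c * \<beta> / 2) a p * tilt (c * \<beta> / 2) a p' *
         (\<Sum>\<epsilon>\<in>signs. \<Sum>\<delta>\<in>signs. \<phi> (overlap_kernel a a 0 \<epsilon> \<delta> p p')))
      = ennreal (exp (- (c * \<beta> / 2 * r * p))) * (ennreal (exp (- (c * \<beta> / 2 * r * p'))) *
        (\<Sum>z1\<in>{-1, 1}. \<Sum>z2\<in>{-1, 1}. 4 * ennreal (\<phi> (?x * z1 + ?y * z2))))"
      unfolding sum using a \<phi>(2)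
      by (simp add: ennreal_mult sum_nonneg tilt_def r_def mult.assoc del: sum.insert)
  qed
  also have "\<dots> = 16 * (ennreal (s_mass r c \<beta>) * (ennreal (s_mass r c \<beta>) * (\<integral>\<^sup>+x. ennreal (\<phi> x) \<partial>limit_law r c \<beta>)))"
    by (rule nn_integral_limit_law[symmetric, OF r c]) measurable
  also have "(\<integral>\<^sup>+x. ennreal (\<phi> x) \<partial>limit_law r c \<beta>) = ennreal (\<integral>x. \<phi> x \<partial>limit_law r c \<beta>)"
    by (rule nn_integral_eq_integral[OF int]) (use \<phi> in auto)
  also have "16 * (ennreal (s_mass r c \<beta>) * (ennreal (s_mass r c \<beta>) * ennreal (\<integral>x. \<phi> x \<partial>limit_law r c \<beta>)))
      = ennreal (16 * (s_mass r c \<beta>)\<^sup>2 * (\<integral>x. \<phi> x \<partial>limit_law r c \<beta>))"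
    using s_mass_nn_integral(1)[OF r c] \<phi>(2)
    by (simp add: ennreal_mult'' power2_eq_square mult.assoc integral_nonneg flip: ennreal_numeral)
  finally have "ennreal (Psi \<phi> (c * \<beta> / 2) a a 0) = ennreal (16 * (s_mass r c \<beta>)\<^sup>2 * (\<integral>x. \<phi> x \<partial>limit_law r c \<beta>))" .
  moreover have "Psi \<phi> (c * \<beta> / 2) a a 0 \<ge> 0"
    by (rule Psi_nonneg[OF \<phi> k])
  moreover have "16 * (s_mass r c \<beta>)\<^sup>2 * (\<integral>x. \<phi> x \<partial>limit_law r c \<beta>) \<ge> 0"
    using \<phi>(2) by (intro mult_nonneg_nonneg integral_nonneg) auto
  ultimately show ?thesis by (simp add: r_def ennreal_inj)
qed

section \<open>The Gibbs measure in eigencoordinates\<close>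

lemma sum_orthogonal_lin_n:
  assumes Q: "orthogonal_n n Q" and k: "k < n"
  shows "(\<Sum>i<n. Q i k * lin_n n Q x i) = x k"
proof -
  have "(\<Sum>i<n. Q i k * lin_n n Q x i) = (\<Sum>i<n. \<Sum>l<n. Q i k * Q i l * x l)"
    by (simp add: lin_n_def sum_distrib_left mult.assoc)
  also have "\<dots> = (\<Sum>l<n. (\<Sum>i<n. Q i k * Q i l) * x l)"
    unfolding sum_distrib_right by (rule sum.swap)
  also have "\<dots> = (\<Sum>l<n. if l = k then x k else 0)"
  proof (rule sum.cong)
    fix l assume "l \<in> {..<n}"
    then have "(\<Sum>i<n. Q i k * Q i l) = (if k = l then 1 else 0)"
      using Q k unfolding orthogonal_n_def by blast
    then show "(\<Sum>i<n. Q i k * Q i l) * x l = (if l = k then x k else 0)" by simp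
  qed simp
  also have "\<dots> = x k" using k by simp
  finally show ?thesis .
qed

lemma hamiltonian_lin_n:
  assumes Q: "orthogonal_n n Q"
    and A: "\<And>i j. i < n \<Longrightarrow> j < n \<Longrightarrow> A $$ (i, j) = (\<Sum>k<n. d k * Q i k * Q j k)"
  shows "hamiltonian n A (lin_n n Q x) = real n / 2 * (\<Sum>k<n. d k * (x k)\<^sup>2)"
proof -
  let ?y = "lin_n n Q x"
  have "(\<Sum>i<n. \<Sum>j<n. ?y i * A $$ (i, j) * ?y j)
      = (\<Sum>i<n. \<Sum>j<n. \<Sum>k<n. d k * ((Q i k * ?y i) * (Q j k * ?y j)))"
    by (intro sum.cong refl) (simp add: A sum_distrib_left sum_distrib_right mult_ac)
  also have "\<dots> = (\<Sum>i<n. \<Sum>k<n. \<Sum>j<n. d k * ((Q i k * ?y i) * (Q j k * ?y j)))"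
    by (rule sum.cong[OF refl], rule sum.swap)
  also have "\<dots> = (\<Sum>k<n. \<Sum>i<n. \<Sum>j<n. d k * ((Q i k * ?y i) * (Q j k * ?y j)))"
    by (rule sum.swap)
  also have "\<dots> = (\<Sum>k<n. d k * ((\<Sum>i<n. Q i k * ?y i) * (\<Sum>j<n. Q j k * ?y j)))"
    unfolding sum_product by (simp only: sum_distrib_left)
  also have "\<dots> = (\<Sum>k<n. d k * (x k)\<^sup>2)"
    by (intro sum.cong refl) (simp add: sum_orthogonal_lin_n[OF Q] power2_eq_square)
  finally show ?thesis by (simp add: hamiltonian_def)
qed

lemma overlap_lin_n: "orthogonal_n n Q \<Longrightarrow> overlap n (lin_n n Q x) (lin_n n Q y) = overlap n x y"
  by (simp add: overlap_def sum_lin_n_mult)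

lemma measurable_overlap [measurable (raw)]:
  assumes "f \<in> N \<rightarrow>\<^sub>M Rn n" and "g \<in> N \<rightarrow>\<^sub>M Rn n"
  shows "(\<lambda>w. overlap n (f w) (g w)) \<in> borel_measurable N"
  unfolding overlap_def
proof (rule borel_measurable_sum)
  fix i assume i: "i \<in> {..<n}"
  have "(\<lambda>w. f w i) \<in> borel_measurable N" "(\<lambda>w. g w i) \<in> borel_measurable N"
    using measurable_compose[OF assms(1) measurable_component_singleton[OF i]]
      measurable_compose[OF assms(2) measurable_component_singleton[OF i]] by auto
  then show "(\<lambda>w. f w i * g w i) \<in> borel_measurable N" by simp
qed

lemma measurable_hamiltonian [measurable]: "hamiltonian n A \<in> borel_measurable (Rn n)"
  unfolding hamiltonian_def by measurable

lemma overlap_sphere_pt: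
  assumes n: "n \<ge> 2"
  shows "overlap n (sphere_pt n e e' p v) (sphere_pt n f f' p' w)
    = overlap_kernel (tail_sq n v) (tail_sq n w) (\<Sum>i\<in>{2..<n}. v i * w i) (e, e') (f, f') p p'"
  unfolding overlap_def sum_index_split[OF n] sphere_pt_def overlap_kernel_def by simp

lemma measurable_sphere_pt [measurable (raw)]:
  assumes n: "n \<ge> 2" and [measurable]: "v \<in> N \<rightarrow>\<^sub>M Rtail n" "p \<in> borel_measurable N"
  shows "(\<lambda>w. sphere_pt n e e' (p w) (v w)) \<in> N \<rightarrow>\<^sub>M Rn n"
  unfolding sphere_pt_def by (intro measurable_upd2[OF n]) measurable

text \<open>
  The Gibbs measure in eigencoordinates: the last \<open>n - 2\<close> coordinates \<open>v\<close> are independent Gaussian,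
  restricted to the unit ball, and the fraction \<open>p\<close> of the remaining squared norm that the second
  coordinate takes has the arcsine law tilted by \<open>exp (- k (1 - |v|^2) p)\<close> with \<open>k = c \<beta> / 2\<close>.
\<close>

lemma gibbs_weight_disintegration:
  fixes A :: "real mat" and d s :: "nat \<Rightarrow> real"
  assumes n: "n \<ge> 2" and \<beta>: "\<beta> > 0"
    and Q: "orthogonal_n n Q"
    and A: "\<And>i j. i < n \<Longrightarrow> j < n \<Longrightarrow> A $$ (i, j) = (\<Sum>k<n. d k * Q i k * Q j k)"
    and d1: "d 1 = d 0 - c / real n"
    and s: "\<And>i. s i > 0" "\<And>i. i \<in> {2..<n} \<Longrightarrow> 1 / (s i)\<^sup>2 = \<beta> * real n * (d 0 - d i)"
  obtains C :: ennreal where "C \<noteq> 0" "C \<noteq> \<infinity>"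
    "\<And>F. F \<in> borel_measurable (Rn n) \<Longrightarrow>
      (\<integral>\<^sup>+\<sigma>. ennreal (exp (\<beta> * hamiltonian n A \<sigma>)) * F \<sigma> \<partial>uniform_sphere n) =
      C * (\<integral>\<^sup>+v. \<integral>\<^sup>+p. ennreal (tilt (c * \<beta> / 2) (tail_sq n v) p) *
        (\<Sum>\<epsilon>\<in>signs. F (lin_n n Q (sphere_pt n (fst \<epsilon>) (snd \<epsilon>) p v))) \<partial>arcsine \<partial>gauss {2..<n} s)"
proof -
  let ?pt = "\<lambda>\<epsilon> p v. lin_n n Q (sphere_pt n (fst \<epsilon>) (snd \<epsilon>) p v)"
  let ?qt = "\<lambda>e e' p v. lin_n n Q (sphere_pt n e e' p v)"
  let ?arc = "\<lambda>v p. ennreal (arc_weight p * indicator {..<1} (tail_sq n v))"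
  let ?w = "\<lambda>\<sigma>. ennreal (exp (\<beta> * hamiltonian n A \<sigma>))"
  obtain C0 :: ennreal where C0: "C0 \<noteq> 0" "C0 \<noteq> \<infinity>"
    "\<And>F. F \<in> borel_measurable (Rn n) \<Longrightarrow> (\<integral>\<^sup>+x. F x \<partial>uniform_sphere n) =
      C0 * (\<Sum>e\<in>{-1, 1}. \<Sum>e'\<in>{-1, 1}. \<integral>\<^sup>+v. \<integral>\<^sup>+p.
        ?arc v p * F (sphere_pt n e e' p v)
        \<partial>lborel \<partial>Rtail n)"
    by (rule nn_integral_uniform_sphere_tail[OF n]) (rule that; assumption)
  define K1 where "K1 = ennreal (exp (\<beta> * (real n / 2 * d 0)))"
  define Kg where "Kg = ennreal (\<Prod>i\<in>{2..<n}. 1 / sqrt (2 * pi * (s i)\<^sup>2))"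
  have K1: "K1 \<noteq> 0" "K1 \<noteq> \<infinity>" by (auto simp: K1_def)
  have "(\<Prod>i\<in>{2..<n}. 1 / sqrt (2 * pi * (s i)\<^sup>2)) > 0"
    using s(1) by (intro prod_pos) (simp add: less_imp_neq[symmetric])
  then have "Kg \<noteq> 0" by (simp only: Kg_def ennreal_eq_0_iff not_le)
  moreover have "Kg \<noteq> \<infinity>" by (simp add: Kg_def)
  ultimately have Kg: "Kg \<noteq> 0" "Kg \<noteq> \<infinity>" by auto
  define C where "C = C0 * K1 / Kg"
  have C: "C \<noteq> 0" "C \<noteq> \<infinity>"
    using C0 K1 Kg by (auto simp: C_def ennreal_divide_eq_top_iff ennreal_divide_eq_0_iff ennreal_mult_eq_top_iff)
  let ?W = "\<lambda>v. ennreal (exp (- (\<Sum>i\<in>{2..<n}. (v i)\<^sup>2 / (2 * (s i)\<^sup>2))))"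
  let ?t = "\<lambda>v p. ennreal (tilt (c * \<beta> / 2) (tail_sq n v) p)"
  have weight: "?arc v p * ?w (?qt e e' p v)
      = K1 * (?W v * (ennreal (arc_weight p) * ?t v p))"
    if e: "e \<in> {-1, 1}" "e' \<in> {-1, 1}" for e e' p v
  proof (cases "0 < p \<and> p < 1 \<and> tail_sq n v < 1")
    case False
    then consider "arc_weight p = 0" | "indicator {..<1} (tail_sq n v) = (0::real)"
      by (auto simp: arc_weight_def split: split_indicator)
    then show ?thesis by cases (auto simp: tilt_def)
  next
    case True
    define y where "y = sphere_pt n e e' p v"
    have y0: "(y 0)\<^sup>2 = (1 - tail_sq n v) * (1 - p)" and y1: "(y 1)\<^sup>2 = (1 - tail_sq n v) * p"
      using True e by (auto simp: y_def sphere_pt_def power_mult_distrib)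
    have "(\<Sum>k<n. d k * (y k)\<^sup>2) = d 0 * (y 0)\<^sup>2 + d 1 * (y 1)\<^sup>2 + (\<Sum>i\<in>{2..<n}. d i * (y i)\<^sup>2)"
      by (rule sum_index_split[OF n])
    also have "(\<Sum>i\<in>{2..<n}. d i * (y i)\<^sup>2) = (\<Sum>i\<in>{2..<n}. d 0 * (v i)\<^sup>2 - (d 0 - d i) * (v i)\<^sup>2)"
      by (intro sum.cong refl) (auto simp: y_def sphere_pt_def algebra_simps)
    also have "\<dots> = d 0 * tail_sq n v - (\<Sum>i\<in>{2..<n}. (d 0 - d i) * (v i)\<^sup>2)"
      by (simp add: sum_subtractf sum_distrib_left tail_sq_def)
    finally have "(\<Sum>k<n. d k * (y k)\<^sup>2)
        = d 0 - c / real n * ((1 - tail_sq n v) * p) - (\<Sum>i\<in>{2..<n}. (d 0 - d i) * (v i)\<^sup>2)"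
      unfolding y0 y1 d1 by (simp add: algebra_simps)
    then have "\<beta> * (real n / 2 * (\<Sum>k<n. d k * (y k)\<^sup>2))
        = \<beta> * (real n / 2 * d 0) - \<beta> * (real n / 2 * (c / real n * ((1 - tail_sq n v) * p)))
          - \<beta> * (real n / 2 * (\<Sum>i\<in>{2..<n}. (d 0 - d i) * (v i)\<^sup>2))"
      by (simp only: right_diff_distrib)
    also have "\<beta> * (real n / 2 * (c / real n * ((1 - tail_sq n v) * p))) = c * \<beta> / 2 * (1 - tail_sq n v) * p"
      using n by simp
    also have "\<beta> * (real n / 2 * (\<Sum>i\<in>{2..<n}. (d 0 - d i) * (v i)\<^sup>2)) = (\<Sum>i\<in>{2..<n}. (v i)\<^sup>2 / (2 * (s i)\<^sup>2))"
      unfolding sum_distrib_left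
    proof (rule sum.cong[OF refl])
      fix i assume "i \<in> {2..<n}"
      have "(v i)\<^sup>2 / (2 * (s i)\<^sup>2) = (v i)\<^sup>2 / 2 * (1 / (s i)\<^sup>2)" by simp
      also have "\<dots> = \<beta> * (real n / 2 * ((d 0 - d i) * (v i)\<^sup>2))"
        unfolding s(2)[OF \<open>i \<in> {2..<n}\<close>] by simp
      finally show "\<beta> * (real n / 2 * ((d 0 - d i) * (v i)\<^sup>2)) = (v i)\<^sup>2 / (2 * (s i)\<^sup>2)" by simp
    qed
    finally have expo: "\<beta> * (real n / 2 * (\<Sum>k<n. d k * (y k)\<^sup>2)) = \<beta> * (real n / 2 * d 0)
        - c * \<beta> / 2 * (1 - tail_sq n v) * p - (\<Sum>i\<in>{2..<n}. (v i)\<^sup>2 / (2 * (s i)\<^sup>2))" .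
    have ham: "hamiltonian n A (lin_n n Q y) = real n / 2 * (\<Sum>k<n. d k * (y k)\<^sup>2)"
      by (rule hamiltonian_lin_n[OF Q]) (rule A)
    have "exp (\<beta> * hamiltonian n A (lin_n n Q y))
        = exp (\<beta> * (real n / 2 * d 0)) * exp (- (\<Sum>i\<in>{2..<n}. (v i)\<^sup>2 / (2 * (s i)\<^sup>2)))
          * exp (- (c * \<beta> / 2 * (1 - tail_sq n v) * p))"
      unfolding ham expo by (simp add: exp_add[symmetric])
    then show ?thesis
      using True unfolding y_def K1_def by (simp add: tilt_def ennreal_mult'' ennreal_mult mult_ac)
  qed
  have main: "(\<integral>\<^sup>+\<sigma>. ?w \<sigma> * F \<sigma> \<partial>uniform_sphere n) =
      C * (\<integral>\<^sup>+v. \<integral>\<^sup>+p. ?t v p * (\<Sum>\<epsilon>\<in>signs. F (?pt \<epsilon> p v)) \<partial>arcsine \<partial>gauss {2..<n} s)"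
    if F [measurable]: "F \<in> borel_measurable (Rn n)" for F
  proof -
    have Fm [measurable]: "(\<lambda>w. F (lin_n n Q (sphere_pt n e e' (p w) (v w)))) \<in> borel_measurable N"
      if "v \<in> N \<rightarrow>\<^sub>M Rtail n" "p \<in> borel_measurable N" for v p e e' and N :: "'b measure"
      by (rule measurable_compose[OF measurable_compose[OF measurable_sphere_pt[OF n that] measurable_lin_n] F])
    have "(\<integral>\<^sup>+\<sigma>. ?w \<sigma> * F \<sigma> \<partial>uniform_sphere n)
        = (\<integral>\<^sup>+\<sigma>. (\<lambda>\<sigma>. ?w \<sigma> * F \<sigma>) (lin_n n Q \<sigma>) \<partial>uniform_sphere n)"
      by (rule nn_integral_uniform_sphere_orthogonal[OF Q, symmetric]) measurable
    also have "\<dots> = C0 * (\<Sum>e\<in>{-1, 1}. \<Sum>e'\<in>{-1, 1}. \<integral>\<^sup>+v. \<integral>\<^sup>+p.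
        ?arc v p *
        (?w (?qt e e' p v) * F (?qt e e' p v))
        \<partial>lborel \<partial>Rtail n)"
      by (rule C0(3)) measurable
    also have "\<dots> = C0 * (\<Sum>e\<in>{-1, 1}. \<Sum>e'\<in>{-1, 1}. K1 / Kg * (\<integral>\<^sup>+v. \<integral>\<^sup>+p.
        ?t v p * F (?qt e e' p v) \<partial>arcsine \<partial>gauss {2..<n} s))"
    proof (intro arg_cong[where f = "(*) C0"] sum.cong refl)
      fix e e' :: real assume e: "e \<in> {-1, 1}" "e' \<in> {-1, 1}"
      let ?F = "\<lambda>v p. F (?qt e e' p v)"
      have "(\<integral>\<^sup>+v. \<integral>\<^sup>+p. ?arc v p *
          (?w (?qt e e' p v) * ?F v p) \<partial>lborel \<partial>Rtail n)
        = (\<integral>\<^sup>+v. K1 * (?W v * (\<integral>\<^sup>+p. ?t v p * ?F v p \<partial>arcsine)) \<partial>Rtail n)"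
      proof (rule nn_integral_cong)
        fix v assume v [measurable]: "v \<in> space (Rtail n)"
        have "(\<integral>\<^sup>+p. ?arc v p *
            (?w (?qt e e' p v) * ?F v p) \<partial>lborel)
          = (\<integral>\<^sup>+p. K1 * ?W v * (ennreal (arc_weight p) * (?t v p * ?F v p)) \<partial>lborel)"
          by (intro nn_integral_cong, subst mult.assoc[symmetric], subst weight[OF e]) (simp add: mult.assoc)
        also have "\<dots> = K1 * ?W v * (\<integral>\<^sup>+p. ennreal (arc_weight p) * (?t v p * ?F v p) \<partial>lborel)"
          by (rule nn_integral_cmult) measurable
        also have "(\<integral>\<^sup>+p. ennreal (arc_weight p) * (?t v p * ?F v p) \<partial>lborel) = (\<integral>\<^sup>+p. ?t v p * ?F v p \<partial>arcsine)"
          by (rule nn_integral_arcsine[symmetric]) measurable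
        finally show "(\<integral>\<^sup>+p. ?arc v p *
            (?w (?qt e e' p v) * ?F v p) \<partial>lborel)
          = K1 * (?W v * (\<integral>\<^sup>+p. ?t v p * ?F v p \<partial>arcsine))" by (simp add: mult.assoc)
      qed
      also have "\<dots> = K1 * (\<integral>\<^sup>+v. ?W v * (\<integral>\<^sup>+p. ?t v p * ?F v p \<partial>arcsine) \<partial>Rtail n)"
        by (rule nn_integral_cmult) measurable
      also have "\<dots> = K1 / Kg * (Kg * (\<integral>\<^sup>+v. ?W v * (\<integral>\<^sup>+p. ?t v p * ?F v p \<partial>arcsine) \<partial>Rtail n))"
        using Kg by (simp add: mult.assoc[symmetric] ennreal_divide_times)
           (simp add: ennreal_divide_self less_top)
      also have "Kg * (\<integral>\<^sup>+v. ?W v * (\<integral>\<^sup>+p. ?t v p * ?F v p \<partial>arcsine) \<partial>Rtail n)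
          = (\<integral>\<^sup>+v. \<integral>\<^sup>+p. ?t v p * ?F v p \<partial>arcsine \<partial>gauss {2..<n} s)"
        unfolding Kg_def by (rule nn_integral_gauss[OF _ s(1), symmetric]) (simp, measurable)
      finally show "(\<integral>\<^sup>+v. \<integral>\<^sup>+p. ?arc v p *
          (?w (?qt e e' p v) * ?F v p) \<partial>lborel \<partial>Rtail n)
        = K1 / Kg * (\<integral>\<^sup>+v. \<integral>\<^sup>+p. ?t v p * ?F v p \<partial>arcsine \<partial>gauss {2..<n} s)" .
    qed
    also have "\<dots> = C0 * (\<Sum>\<epsilon>\<in>signs. K1 / Kg * (\<integral>\<^sup>+v. \<integral>\<^sup>+p.
        ?t v p * F (?pt \<epsilon> p v) \<partial>arcsine \<partial>gauss {2..<n} s))"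
      by (subst sum_signs) (rule refl)
    also have "\<dots> = C * (\<Sum>\<epsilon>\<in>signs. (\<integral>\<^sup>+v. \<integral>\<^sup>+p.
        ?t v p * F (?pt \<epsilon> p v) \<partial>arcsine \<partial>gauss {2..<n} s))"
      by (simp add: C_def sum_distrib_left[symmetric] mult.assoc[symmetric] ennreal_times_divide)
    also have "(\<Sum>\<epsilon>\<in>signs. (\<integral>\<^sup>+v. \<integral>\<^sup>+p.
        ?t v p * F (?pt \<epsilon> p v) \<partial>arcsine \<partial>gauss {2..<n} s))
      = (\<integral>\<^sup>+v. (\<Sum>\<epsilon>\<in>signs. \<integral>\<^sup>+p.
        ?t v p * F (?pt \<epsilon> p v) \<partial>arcsine) \<partial>gauss {2..<n} s)"
      by (rule nn_integral_sum[symmetric]) measurable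
    also have "\<dots> = (\<integral>\<^sup>+v. \<integral>\<^sup>+p. ?t v p * (\<Sum>\<epsilon>\<in>signs. F (?pt \<epsilon> p v)) \<partial>arcsine \<partial>gauss {2..<n} s)"
    proof (rule nn_integral_cong)
      fix v assume "v \<in> space (gauss {2..<n} s)"
      then have v [measurable]: "v \<in> space (Rtail n)"
        using sets_eq_imp_space_eq[OF sets_gauss[of "{2..<n}" s]] by simp
      show "(\<Sum>\<epsilon>\<in>signs. \<integral>\<^sup>+p. ?t v p * F (?pt \<epsilon> p v) \<partial>arcsine)
        = (\<integral>\<^sup>+p. ?t v p * (\<Sum>\<epsilon>\<in>signs. F (?pt \<epsilon> p v)) \<partial>arcsine)"
        unfolding sum_distrib_left by (rule nn_integral_sum[symmetric]) measurable
    qed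
    finally show ?thesis .
  qed
  show thesis by (rule that[OF C main])
qed

lemma measurable_Psi [measurable (raw)]:
  assumes \<phi>: "\<phi> \<in> borel_measurable borel"
    and [measurable]: "f \<in> borel_measurable N" "g \<in> borel_measurable N" "h \<in> borel_measurable N"
  shows "(\<lambda>w. Psi \<phi> k (f w) (g w) (h w)) \<in> borel_measurable N"
proof -
  interpret A: finite_measure "arcsine \<Otimes>\<^sub>M arcsine"
    by (rule finite_measure_pair_measure) unfold_locales
  note \<phi> [measurable]
  show ?thesis unfolding Psi_def by measurable
qed

text \<open>
  The inner product of two tails.
\<close>

definition tail_inner :: "nat \<Rightarrow> (nat \<Rightarrow> real) \<Rightarrow> (nat \<Rightarrow> real) \<Rightarrow> real" where
  "tail_inner n v w = (\<Sum>i\<in>{2..<n}. v i * w i)"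

lemma measurable_tail_inner [measurable (raw)]:
  assumes "f \<in> N \<rightarrow>\<^sub>M Rtail n" and "g \<in> N \<rightarrow>\<^sub>M Rtail n"
  shows "(\<lambda>w. tail_inner n (f w) (g w)) \<in> borel_measurable N"
  unfolding tail_inner_def
proof (rule borel_measurable_sum)
  fix i assume i: "i \<in> {2..<n}"
  have "(\<lambda>w. f w i) \<in> borel_measurable N" "(\<lambda>w. g w i) \<in> borel_measurable N"
    using measurable_compose[OF assms(1) measurable_component_singleton[OF i]]
      measurable_compose[OF assms(2) measurable_component_singleton[OF i]] by auto
  then show "(\<lambda>w. f w i * g w i) \<in> borel_measurable N" by simp
qed

text \<open>
  \<open>Psi\<close> as a function of the two tails.
\<close>

abbreviation Psi_tail ::
  "nat \<Rightarrow> (real \<Rightarrow> real) \<Rightarrow> real \<Rightarrow> (nat \<Rightarrow> real) \<Rightarrow> (nat \<Rightarrow> real) \<Rightarrow> real" where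
  "Psi_tail n \<phi> k v w \<equiv> Psi \<phi> k (tail_sq n v) (tail_sq n w) (tail_inner n v w)"

lemma sets_gibbs [simp, measurable_cong]: "sets (gibbs n A \<beta>) = sets (Rn n)"
  by (simp add: gibbs_def sets_uniform_sphere)

text \<open>
  From here on \<open>A\<close> is given by its eigenvalues \<open>d 0, \<dots>, d (n - 1)\<close> and an orthogonal matrix \<open>Q\<close>
  of eigenvectors, and \<open>s i\<close>, for \<open>i \<ge> 2\<close>, is the standard deviation of the \<open>i\<close>-th coordinate under
  the Gaussian measure \<open>G\<close> that the Boltzmann factor \<open>weight\<close> produces.
\<close>

context
  fixes n :: nat and A :: "real mat" and Q :: "nat \<Rightarrow> nat \<Rightarrow> real" and d s :: "nat \<Rightarrow> real"
    and \<beta> c :: real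
  assumes n: "n \<ge> 2" and \<beta>: "\<beta> > 0" and c: "c \<ge> 0"
    and Q: "orthogonal_n n Q"
    and A: "\<And>i j. i < n \<Longrightarrow> j < n \<Longrightarrow> A $$ (i, j) = (\<Sum>k<n. d k * Q i k * Q j k)"
    and d1: "d 1 = d 0 - c / real n"
    and s: "\<And>i. s i > 0" "\<And>i. i \<in> {2..<n} \<Longrightarrow> 1 / (s i)\<^sup>2 = \<beta> * real n * (d 0 - d i)"
begin

abbreviation "weight \<sigma> \<equiv> ennreal (exp (\<beta> * hamiltonian n A \<sigma>))"
abbreviation "G \<equiv> gauss {2..<n} s"

lemma gibbs_disintegration:
  "\<exists>C::ennreal. C \<noteq> 0 \<and> C \<noteq> \<infinity> \<and> (\<forall>F\<in>borel_measurable (Rn n). (\<integral>\<^sup>+\<sigma>. weight \<sigma> * F \<sigma> \<partial>uniform_sphere n) =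
      C * (\<integral>\<^sup>+v. \<integral>\<^sup>+p. ennreal (tilt (c * \<beta> / 2) (tail_sq n v) p) *
        (\<Sum>\<epsilon>\<in>signs. F (lin_n n Q (sphere_pt n (fst \<epsilon>) (snd \<epsilon>) p v))) \<partial>arcsine \<partial>G))"
proof (rule gibbs_weight_disintegration[where d = d and s = s and A = A and c = c, OF n \<beta> Q _ d1 s(1)])
  show "A $$ (i, j) = (\<Sum>k<n. d k * Q i k * Q j k)" if "i < n" "j < n" for i j
    using that by (rule A)
  show "1 / (s i)\<^sup>2 = \<beta> * real n * (d 0 - d i)" if "i \<in> {2..<n}" for i
    using that by (rule s(2))
qed blast

lemma partition_function_nn_integral:
  "partition_function n A \<beta> > 0"
  "(\<integral>\<^sup>+\<sigma>. weight \<sigma> \<partial>uniform_sphere n) = ennreal (partition_function n A \<beta>)"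
proof -
  interpret U: prob_space "uniform_sphere n" by (rule prob_space_uniform_sphere)
  interpret G: prob_space G by (rule prob_space_gauss[OF s(1)])
  let ?N = "\<integral>\<^sup>+\<sigma>. weight \<sigma> \<partial>uniform_sphere n"
  obtain C :: ennreal where C: "C \<noteq> 0" "C \<noteq> \<infinity>"
    and C_int: "\<forall>F\<in>borel_measurable (Rn n). (\<integral>\<^sup>+\<sigma>. weight \<sigma> * F \<sigma> \<partial>uniform_sphere n) =
      C * (\<integral>\<^sup>+v. \<integral>\<^sup>+p. ennreal (tilt (c * \<beta> / 2) (tail_sq n v) p) *
        (\<Sum>\<epsilon>\<in>signs. F (lin_n n Q (sphere_pt n (fst \<epsilon>) (snd \<epsilon>) p v))) \<partial>arcsine \<partial>G)"
    using gibbs_disintegration by blast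
  have N: "?N = C * (\<integral>\<^sup>+v. \<integral>\<^sup>+p. ennreal (tilt (c * \<beta> / 2) (tail_sq n v) p) * (\<Sum>\<epsilon>\<in>signs. 1) \<partial>arcsine \<partial>G)"
    using bspec[OF C_int, of "\<lambda>_. 1"] by simp
  have "(\<integral>\<^sup>+v. \<integral>\<^sup>+p. ennreal (tilt (c * \<beta> / 2) (tail_sq n v) p) * (\<Sum>\<epsilon>\<in>signs. 1) \<partial>arcsine \<partial>G)
      \<le> (\<integral>\<^sup>+v. \<integral>\<^sup>+p. (\<Sum>\<epsilon>\<in>signs. 1) \<partial>arcsine \<partial>G)"
  proof (rule nn_integral_mono, rule nn_integral_mono_AE)
    fix v
    show "AE p in arcsine. ennreal (tilt (c * \<beta> / 2) (tail_sq n v) p) * (\<Sum>\<epsilon>\<in>signs. 1) \<le> (\<Sum>\<epsilon>\<in>signs. 1)"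
      using AE_arcsine
    proof eventually_elim
      case (elim p)
      have "ennreal (tilt (c * \<beta> / 2) (tail_sq n v) p) \<le> 1"
        using tilt_le_1[of "c * \<beta> / 2" p] elim c \<beta> by simp
      then show ?case using mult_right_mono[of _ "1::ennreal"] by fastforce
    qed
  qed
  also have "(\<integral>\<^sup>+v. \<integral>\<^sup>+p. (\<Sum>\<epsilon>\<in>signs. 1) \<partial>arcsine \<partial>G) = of_nat (card signs) * emeasure arcsine UNIV"
    by (simp add: G.emeasure_space_1)
  finally have "?N \<le> C * (of_nat (card signs) * emeasure arcsine UNIV)"
    unfolding N by (rule mult_left_mono) simp
  moreover have "C * (of_nat (card signs) * emeasure arcsine UNIV) < \<infinity>"
  proof -
    have "emeasure arcsine UNIV < \<top>"
      using emeasure_arcsine(2) by (simp add: less_top[symmetric])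
    then show ?thesis using C(2) by (simp add: ennreal_mult_less_top less_top of_nat_less_top)
  qed
  ultimately have fin: "?N < \<infinity>" by (rule le_less_trans)
  have "?N \<noteq> 0"
  proof
    assume "?N = 0"
    then have "AE \<sigma> in uniform_sphere n. weight \<sigma> = 0"
      by (subst (asm) nn_integral_0_iff_AE) auto
    then have "AE \<sigma> in uniform_sphere n. False" by simp
    then show False by simp
  qed
  have "integrable (uniform_sphere n) (\<lambda>\<sigma>. exp (\<beta> * hamiltonian n A \<sigma>))"
    by (rule integrableI_nonneg) (use fin in auto)
  then show *: "?N = ennreal (partition_function n A \<beta>)"
    unfolding partition_function_def by (intro nn_integral_eq_integral) auto
  show "partition_function n A \<beta> > 0"
    using \<open>?N \<noteq> 0\<close> unfolding * by (simp add: ennreal_eq_0_iff not_le)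
qed

lemma nn_integral_gibbs:
  assumes [measurable]: "F \<in> borel_measurable (Rn n)"
  shows "(\<integral>\<^sup>+\<sigma>. F \<sigma> \<partial>gibbs n A \<beta>)
    = ennreal (1 / partition_function n A \<beta>) * (\<integral>\<^sup>+\<sigma>. weight \<sigma> * F \<sigma> \<partial>uniform_sphere n)"
proof -
  have "(\<integral>\<^sup>+\<sigma>. F \<sigma> \<partial>gibbs n A \<beta>)
      = (\<integral>\<^sup>+\<sigma>. ennreal (exp (\<beta> * hamiltonian n A \<sigma>) / partition_function n A \<beta>) * F \<sigma> \<partial>uniform_sphere n)"
    unfolding gibbs_def by (rule nn_integral_density) measurable
  also have "\<dots> = (\<integral>\<^sup>+\<sigma>. ennreal (1 / partition_function n A \<beta>) * (weight \<sigma> * F \<sigma>) \<partial>uniform_sphere n)"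
    using partition_function_nn_integral(1)
    by (intro nn_integral_cong) (simp add: mult.assoc[symmetric] ennreal_mult[symmetric])
  also have "\<dots> = ennreal (1 / partition_function n A \<beta>) * (\<integral>\<^sup>+\<sigma>. weight \<sigma> * F \<sigma> \<partial>uniform_sphere n)"
    by (rule nn_integral_cmult) measurable
  finally show ?thesis .
qed

lemma prob_space_gibbs: "prob_space (gibbs n A \<beta>)"
proof (rule prob_spaceI)
  have "emeasure (gibbs n A \<beta>) (space (gibbs n A \<beta>)) = (\<integral>\<^sup>+\<sigma>. 1 \<partial>gibbs n A \<beta>)"
    by simp
  also have "\<dots> = ennreal (1 / partition_function n A \<beta>) * ennreal (partition_function n A \<beta>)"
    by (subst nn_integral_gibbs) (simp_all add: partition_function_nn_integral(2))
  also have "\<dots> = 1"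
    using partition_function_nn_integral(1) by (simp add: ennreal_mult[symmetric])
  finally show "emeasure (gibbs n A \<beta>) (space (gibbs n A \<beta>)) = 1" .
qed

lemma measurable_overlap_pair:
  "(\<lambda>(\<sigma>, \<tau>). overlap n \<sigma> \<tau>) \<in> borel_measurable (gibbs n A \<beta> \<Otimes>\<^sub>M gibbs n A \<beta>)"
  unfolding split_beta' by measurable

lemma real_distribution_overlap_law: "real_distribution (overlap_law n A \<beta>)"
proof -
  interpret P: prob_space "gibbs n A \<beta>" by (rule prob_space_gibbs)
  interpret PP: pair_prob_space "gibbs n A \<beta>" "gibbs n A \<beta>" ..
  show ?thesis
    unfolding overlap_law_def by (rule PP.real_distribution_distr[OF measurable_overlap_pair])
qed

lemma nn_integral_overlap_law:
  assumes g: "g \<in> borel_measurable borel"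
  shows "(\<integral>\<^sup>+x. g x \<partial>overlap_law n A \<beta>)
    = (\<integral>\<^sup>+\<sigma>. \<integral>\<^sup>+\<tau>. g (overlap n \<sigma> \<tau>) \<partial>gibbs n A \<beta> \<partial>gibbs n A \<beta>)"
proof -
  interpret P: prob_space "gibbs n A \<beta>" by (rule prob_space_gibbs)
  have "(\<integral>\<^sup>+x. g x \<partial>overlap_law n A \<beta>)
      = (\<integral>\<^sup>+w. g (case w of (\<sigma>, \<tau>) \<Rightarrow> overlap n \<sigma> \<tau>) \<partial>(gibbs n A \<beta> \<Otimes>\<^sub>M gibbs n A \<beta>))"
    unfolding overlap_law_def by (rule nn_integral_distr[OF measurable_overlap_pair]) (simp add: g)
  also have "\<dots> = (\<integral>\<^sup>+\<sigma>. \<integral>\<^sup>+\<tau>. g (case (\<sigma>, \<tau>) of (\<sigma>, \<tau>) \<Rightarrow> overlap n \<sigma> \<tau>) \<partial>gibbs n A \<beta> \<partial>gibbs n A \<beta>)"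
    by (rule P.nn_integral_fst[OF measurable_compose[OF measurable_overlap_pair g], symmetric])
  finally show ?thesis by simp
qed

text \<open>
  Two applications of the disintegration, one for each sample. The constant does not depend on
  \<open>\<phi>\<close>; the choice \<open>\<phi> = 1\<close> eliminates it afterwards.
\<close>

lemma overlap_law_Psi:
  "\<exists>\<kappa>::ennreal. \<forall>\<phi>. continuous_on UNIV \<phi> \<longrightarrow> (\<forall>x. 0 \<le> \<phi> x) \<longrightarrow> (\<forall>x. \<phi> x \<le> 1) \<longrightarrow>
      (\<integral>\<^sup>+x. ennreal (\<phi> x) \<partial>overlap_law n A \<beta>)
      = \<kappa> * (\<integral>\<^sup>+v. \<integral>\<^sup>+w. ennreal (Psi_tail n \<phi> (c * \<beta> / 2) v w) \<partial>G \<partial>G)"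
proof -
  interpret P: prob_space "gibbs n A \<beta>" by (rule prob_space_gibbs)
  interpret G: prob_space G by (rule prob_space_gauss[OF s(1)])
  interpret GA: pair_sigma_finite G arcsine ..
  obtain C :: ennreal where C: "C \<noteq> 0" "C \<noteq> \<infinity>"
    and C_int: "\<forall>F\<in>borel_measurable (Rn n). (\<integral>\<^sup>+\<sigma>. weight \<sigma> * F \<sigma> \<partial>uniform_sphere n) =
      C * (\<integral>\<^sup>+v. \<integral>\<^sup>+p. ennreal (tilt (c * \<beta> / 2) (tail_sq n v) p) *
        (\<Sum>\<epsilon>\<in>signs. F (lin_n n Q (sphere_pt n (fst \<epsilon>) (snd \<epsilon>) p v))) \<partial>arcsine \<partial>G)"
    using gibbs_disintegration by blast
  define K where "K = ennreal (1 / partition_function n A \<beta>) * C"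
  have gibbs_int: "(\<integral>\<^sup>+\<sigma>. F \<sigma> \<partial>gibbs n A \<beta>)
      = K * (\<integral>\<^sup>+v. \<integral>\<^sup>+p. ennreal (tilt (c * \<beta> / 2) (tail_sq n v) p) *
        (\<Sum>\<epsilon>\<in>signs. F (lin_n n Q (sphere_pt n (fst \<epsilon>) (snd \<epsilon>) p v))) \<partial>arcsine \<partial>G)"
    if "F \<in> borel_measurable (Rn n)" for F
    using that bspec[OF C_int that] by (simp add: nn_integral_gibbs K_def mult.assoc)
  let ?pt = "\<lambda>\<epsilon> p v. lin_n n Q (sphere_pt n (fst \<epsilon>) (snd \<epsilon>) p v)"
  let ?t = "\<lambda>v p. tilt (c * \<beta> / 2) (tail_sq n v) p"
  let ?k = "\<lambda>v w \<epsilon> \<delta> p p'. overlap_kernel (tail_sq n v) (tail_sq n w) (tail_inner n v w) \<epsilon> \<delta> p p'"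
  have space_G: "space G = space (Rtail n)"
    by (rule sets_eq_imp_space_eq[OF sets_gauss])
  show ?thesis
  proof (intro exI[of _ "K * K"] allI impI)
    fix \<phi> :: "real \<Rightarrow> real"
    assume "continuous_on UNIV \<phi>" "\<forall>x. 0 \<le> \<phi> x" "\<forall>x. \<phi> x \<le> 1"
    then have \<phi>: "continuous_on UNIV \<phi>" "\<And>x. 0 \<le> \<phi> x" "\<And>x. \<phi> x \<le> 1" by auto
    have \<phi>_m [measurable]: "\<phi> \<in> borel_measurable borel"
      using \<phi>(1) by (rule borel_measurable_continuous_onI)
    note measurable_Psi[OF \<phi>_m, measurable (raw)]
    have k: "c * \<beta> / 2 \<ge> 0" using c \<beta> by simp
    define J where "J \<sigma> = (\<integral>\<^sup>+\<tau>. ennreal (\<phi> (overlap n \<sigma> \<tau>)) \<partial>gibbs n A \<beta>)" for \<sigma>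
    have J_m: "J \<in> borel_measurable (Rn n)"
      unfolding J_def by measurable
    have J_pt: "J (?pt \<epsilon> p v)
        = K * (\<integral>\<^sup>+w. \<integral>\<^sup>+p'. ennreal (?t w p') * (\<Sum>\<delta>\<in>signs. ennreal (\<phi> (?k v w \<epsilon> \<delta> p p'))) \<partial>arcsine \<partial>G)"
      if v: "v \<in> space (Rtail n)" for v p \<epsilon>
    proof -
      have x: "?pt \<epsilon> p v \<in> space (Rn n)"
        by (auto simp: lin_n_def space_PiM)
      have "J (?pt \<epsilon> p v)
        = K * (\<integral>\<^sup>+w. \<integral>\<^sup>+p'. ennreal (?t w p') * (\<Sum>\<delta>\<in>signs. ennreal (\<phi> (overlap n
            (?pt \<epsilon> p v) (?pt \<delta> p' w)))) \<partial>arcsine \<partial>G)"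
        unfolding J_def by (rule gibbs_int) (use x in measurable)
      then show ?thesis
        unfolding overlap_lin_n[OF Q] overlap_sphere_pt[OF n] tail_inner_def by simp
    qed
    have "(\<integral>\<^sup>+x. ennreal (\<phi> x) \<partial>overlap_law n A \<beta>) = (\<integral>\<^sup>+\<sigma>. J \<sigma> \<partial>gibbs n A \<beta>)"
      unfolding J_def by (rule nn_integral_overlap_law) measurable
    also have "\<dots> = K * (\<integral>\<^sup>+v. \<integral>\<^sup>+p. ennreal (?t v p) *
        (\<Sum>\<epsilon>\<in>signs. J (?pt \<epsilon> p v)) \<partial>arcsine \<partial>G)"
      by (rule gibbs_int[OF J_m])
    also have "\<dots> = K * (\<integral>\<^sup>+v. K * (\<integral>\<^sup>+w. ennreal (Psi_tail n \<phi> (c * \<beta> / 2) v w) \<partial>G) \<partial>G)"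
    proof (intro arg_cong[where f = "(*) K"] nn_integral_cong)
      fix v assume "v \<in> space G"
      then have v [measurable]: "v \<in> space (Rtail n)" by (simp add: space_G)
      let ?X = "\<lambda>p w p'. ennreal (?t v p * ?t w p' * (\<Sum>\<epsilon>\<in>signs. \<Sum>\<delta>\<in>signs. \<phi> (?k v w \<epsilon> \<delta> p p')))"
      have "(\<integral>\<^sup>+p. ennreal (?t v p) * (\<Sum>\<epsilon>\<in>signs. J (?pt \<epsilon> p v)) \<partial>arcsine)
          = (\<integral>\<^sup>+p. K * (\<integral>\<^sup>+w. \<integral>\<^sup>+p'. ?X p w p' \<partial>arcsine \<partial>G) \<partial>arcsine)"
      proof (rule nn_integral_cong)
        fix p :: real
        let ?Y = "\<lambda>\<epsilon> w p'. ennreal (?t w p') * (\<Sum>\<delta>\<in>signs. ennreal (\<phi> (?k v w \<epsilon> \<delta> p p')))"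
        have "(\<Sum>\<epsilon>\<in>signs. J (?pt \<epsilon> p v))
            = K * (\<Sum>\<epsilon>\<in>signs. \<integral>\<^sup>+w. \<integral>\<^sup>+p'. ?Y \<epsilon> w p' \<partial>arcsine \<partial>G)"
          unfolding J_pt[OF v] by (rule sum_distrib_left[symmetric])
        also have "(\<Sum>\<epsilon>\<in>signs. \<integral>\<^sup>+w. \<integral>\<^sup>+p'. ?Y \<epsilon> w p' \<partial>arcsine \<partial>G)
            = (\<integral>\<^sup>+w. (\<Sum>\<epsilon>\<in>signs. \<integral>\<^sup>+p'. ?Y \<epsilon> w p' \<partial>arcsine) \<partial>G)"
          by (rule nn_integral_sum[symmetric]) measurable
        also have "\<dots> = (\<integral>\<^sup>+w. \<integral>\<^sup>+p'. (\<Sum>\<epsilon>\<in>signs. ?Y \<epsilon> w p') \<partial>arcsine \<partial>G)"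
        proof (rule nn_integral_cong)
          fix w assume "w \<in> space G"
          then have [measurable]: "w \<in> space (Rtail n)" by (simp add: space_G)
          show "(\<Sum>\<epsilon>\<in>signs. \<integral>\<^sup>+p'. ?Y \<epsilon> w p' \<partial>arcsine) = (\<integral>\<^sup>+p'. (\<Sum>\<epsilon>\<in>signs. ?Y \<epsilon> w p') \<partial>arcsine)"
            by (rule nn_integral_sum[symmetric]) measurable
        qed
        finally have "ennreal (?t v p) * (\<Sum>\<epsilon>\<in>signs. J (?pt \<epsilon> p v))
            = K * (ennreal (?t v p) * (\<integral>\<^sup>+w. \<integral>\<^sup>+p'. (\<Sum>\<epsilon>\<in>signs. ?Y \<epsilon> w p') \<partial>arcsine \<partial>G))"
          by (simp add: mult.left_commute)
        also have "ennreal (?t v p) * (\<integral>\<^sup>+w. \<integral>\<^sup>+p'. (\<Sum>\<epsilon>\<in>signs. ?Y \<epsilon> w p') \<partial>arcsine \<partial>G)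
            = (\<integral>\<^sup>+w. ennreal (?t v p) * (\<integral>\<^sup>+p'. (\<Sum>\<epsilon>\<in>signs. ?Y \<epsilon> w p') \<partial>arcsine) \<partial>G)"
          by (rule nn_integral_cmult[symmetric]) measurable
        also have "\<dots> = (\<integral>\<^sup>+w. \<integral>\<^sup>+p'. ?X p w p' \<partial>arcsine \<partial>G)"
        proof (rule nn_integral_cong)
          fix w assume "w \<in> space G"
          then have [measurable]: "w \<in> space (Rtail n)" by (simp add: space_G)
          have "ennreal (?t v p) * (\<integral>\<^sup>+p'. (\<Sum>\<epsilon>\<in>signs. ?Y \<epsilon> w p') \<partial>arcsine)
              = (\<integral>\<^sup>+p'. ennreal (?t v p) * (\<Sum>\<epsilon>\<in>signs. ?Y \<epsilon> w p') \<partial>arcsine)"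
            by (rule nn_integral_cmult[symmetric]) measurable
          also have "\<dots> = (\<integral>\<^sup>+p'. ?X p w p' \<partial>arcsine)"
          proof (rule nn_integral_cong)
            fix p' :: real
            have "(\<Sum>\<epsilon>\<in>signs. ?Y \<epsilon> w p') = ennreal (?t w p') * ennreal (\<Sum>\<epsilon>\<in>signs. \<Sum>\<delta>\<in>signs. \<phi> (?k v w \<epsilon> \<delta> p p'))"
              using \<phi>(2) by (simp add: sum_distrib_left[symmetric] sum_ennreal sum_nonneg)
            then show "ennreal (?t v p) * (\<Sum>\<epsilon>\<in>signs. ?Y \<epsilon> w p') = ?X p w p'"
              using \<phi>(2) by (simp add: ennreal_mult sum_nonneg mult.assoc)
          qed
          finally show "ennreal (?t v p) * (\<integral>\<^sup>+p'. (\<Sum>\<epsilon>\<in>signs. ?Y \<epsilon> w p') \<partial>arcsine)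
              = (\<integral>\<^sup>+p'. ?X p w p' \<partial>arcsine)" .
        qed
        finally show "ennreal (?t v p) * (\<Sum>\<epsilon>\<in>signs. J (?pt \<epsilon> p v))
            = K * (\<integral>\<^sup>+w. \<integral>\<^sup>+p'. ?X p w p' \<partial>arcsine \<partial>G)" .
      qed
      also have "\<dots> = K * (\<integral>\<^sup>+p. \<integral>\<^sup>+w. \<integral>\<^sup>+p'. ?X p w p' \<partial>arcsine \<partial>G \<partial>arcsine)"
        by (rule nn_integral_cmult) measurable
      also have "(\<integral>\<^sup>+p. \<integral>\<^sup>+w. \<integral>\<^sup>+p'. ?X p w p' \<partial>arcsine \<partial>G \<partial>arcsine)
          = (\<integral>\<^sup>+w. \<integral>\<^sup>+p. \<integral>\<^sup>+p'. ?X p w p' \<partial>arcsine \<partial>arcsine \<partial>G)"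
        by (rule GA.Fubini') measurable
      also have "\<dots> = (\<integral>\<^sup>+w. ennreal (Psi_tail n \<phi> (c * \<beta> / 2) v w) \<partial>G)"
        by (rule nn_integral_cong) (rule ennreal_Psi[OF \<phi> k, symmetric])
      finally show "(\<integral>\<^sup>+p. ennreal (?t v p) * (\<Sum>\<epsilon>\<in>signs. J (?pt \<epsilon> p v)) \<partial>arcsine)
          = K * (\<integral>\<^sup>+w. ennreal (Psi_tail n \<phi> (c * \<beta> / 2) v w) \<partial>G)" .
    qed
    also have "\<dots> = K * (K * (\<integral>\<^sup>+v. \<integral>\<^sup>+w. ennreal (Psi_tail n \<phi> (c * \<beta> / 2) v w) \<partial>G \<partial>G))"
    proof -
      have "(\<lambda>y. Psi_tail n \<phi> (c * \<beta> / 2) (fst y) (snd y))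
          \<in> borel_measurable (G \<Otimes>\<^sub>M G)"
        by (intro measurable_Psi \<phi>_m) measurable
      then have "(\<lambda>v. \<integral>\<^sup>+w. ennreal (Psi_tail n \<phi> (c * \<beta> / 2) v w) \<partial>G)
          \<in> borel_measurable G"
        by (intro G.borel_measurable_nn_integral) (simp add: split_beta')
      then show ?thesis by (subst nn_integral_cmult) simp_all
    qed
    finally show "(\<integral>\<^sup>+x. ennreal (\<phi> x) \<partial>overlap_law n A \<beta>)
      = K * K * (\<integral>\<^sup>+v. \<integral>\<^sup>+w. ennreal (Psi_tail n \<phi> (c * \<beta> / 2) v w) \<partial>G \<partial>G)"
      by (simp add: mult.assoc)
  qed
qed

lemma expectation_overlap_law:
  assumes \<phi>: "continuous_on UNIV \<phi>" "\<And>x. 0 \<le> \<phi> x" "\<And>x. \<phi> x \<le> 1"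
  shows "(\<integral>x. \<phi> x \<partial>overlap_law n A \<beta>) *
      (\<integral>y. Psi_tail n (\<lambda>_. 1) (c * \<beta> / 2) (fst y) (snd y) \<partial>(G \<Otimes>\<^sub>M G))
    = (\<integral>y. Psi_tail n \<phi> (c * \<beta> / 2) (fst y) (snd y) \<partial>(G \<Otimes>\<^sub>M G))"
proof -
  interpret G: prob_space G by (rule prob_space_gauss[OF s(1)])
  interpret GG: pair_prob_space G G ..
  interpret L: real_distribution "overlap_law n A \<beta>" by (rule real_distribution_overlap_law)
  have k: "c * \<beta> / 2 \<ge> 0" using c \<beta> by simp
  let ?P = "\<lambda>\<phi> y. Psi_tail n \<phi> (c * \<beta> / 2) (fst y) (snd y)"
  let ?E = "\<lambda>\<phi>. \<integral>y. ?P \<phi> y \<partial>(G \<Otimes>\<^sub>M G)"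
  have E: "(\<integral>\<^sup>+v. \<integral>\<^sup>+w. ennreal (Psi_tail n \<psi> (c * \<beta> / 2) v w) \<partial>G \<partial>G)
      = ennreal (?E \<psi>) \<and> ?E \<psi> \<ge> 0"
    if \<psi>: "continuous_on UNIV \<psi>" "\<And>x. 0 \<le> \<psi> x" "\<And>x. \<psi> x \<le> 1" for \<psi>
  proof
    have \<psi>_m: "\<psi> \<in> borel_measurable borel"
      using \<psi>(1) by (rule borel_measurable_continuous_onI)
    have m: "?P \<psi> \<in> borel_measurable (G \<Otimes>\<^sub>M G)"
      by (intro measurable_Psi \<psi>_m) measurable
    have int: "integrable (G \<Otimes>\<^sub>M G) (?P \<psi>)"
      by (rule GG.integrable_const_bound[OF _ m]) (use Psi_le[OF \<psi> k] Psi_nonneg[OF \<psi> k] in auto)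
    have "(\<integral>\<^sup>+v. \<integral>\<^sup>+w. ennreal (?P \<psi> (v, w)) \<partial>G \<partial>G) = (\<integral>\<^sup>+y. ennreal (?P \<psi> y) \<partial>(G \<Otimes>\<^sub>M G))"
      by (rule G.nn_integral_fst) (use m in measurable)
    also have "\<dots> = ennreal (?E \<psi>)"
      by (rule nn_integral_eq_integral[OF int]) (simp add: Psi_nonneg[OF \<psi> k])
    finally show "(\<integral>\<^sup>+v. \<integral>\<^sup>+w. ennreal (Psi_tail n \<psi> (c * \<beta> / 2) v w) \<partial>G \<partial>G)
      = ennreal (?E \<psi>)" by simp
    show "?E \<psi> \<ge> 0" by (rule integral_nonneg_AE) (simp add: Psi_nonneg[OF \<psi> k])
  qed
  obtain \<kappa> :: ennreal where "\<forall>\<phi>. continuous_on UNIV \<phi> \<longrightarrow> (\<forall>x. 0 \<le> \<phi> x) \<longrightarrow> (\<forall>x. \<phi> x \<le> 1) \<longrightarrow>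
      (\<integral>\<^sup>+x. ennreal (\<phi> x) \<partial>overlap_law n A \<beta>)
      = \<kappa> * (\<integral>\<^sup>+v. \<integral>\<^sup>+w. ennreal (Psi_tail n \<phi> (c * \<beta> / 2) v w) \<partial>G \<partial>G)"
    using overlap_law_Psi by blast
  then have \<kappa>: "(\<integral>\<^sup>+x. ennreal (\<psi> x) \<partial>overlap_law n A \<beta>)
      = \<kappa> * (\<integral>\<^sup>+v. \<integral>\<^sup>+w. ennreal (Psi_tail n \<psi> (c * \<beta> / 2) v w) \<partial>G \<partial>G)"
    if "continuous_on UNIV \<psi>" "\<And>x. 0 \<le> \<psi> x" "\<And>x. \<psi> x \<le> 1" for \<psi>
    using that by blast
  have one: "\<kappa> * ennreal (?E (\<lambda>_. 1)) = 1"
    using \<kappa>[of "\<lambda>_. 1"] E[of "\<lambda>_. 1"] by (simp add: L.emeasure_space_1[simplified])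
  have int: "integrable (overlap_law n A \<beta>) \<phi>"
    by (rule L.integrable_const_bound[where B = 1])
       (use \<phi> in \<open>auto simp: overlap_law_def borel_measurable_continuous_onI[OF \<phi>(1)]\<close>)
  have "ennreal (\<integral>x. \<phi> x \<partial>overlap_law n A \<beta>) = \<kappa> * ennreal (?E \<phi>)"
    using \<kappa>[OF \<phi>] E[OF \<phi>] \<phi>(2) by (simp add: nn_integral_eq_integral[OF int])
  then have "ennreal (\<integral>x. \<phi> x \<partial>overlap_law n A \<beta>) * ennreal (?E (\<lambda>_. 1)) = (\<kappa> * ennreal (?E (\<lambda>_. 1))) * ennreal (?E \<phi>)"
    by (simp add: mult_ac)
  then have "ennreal ((\<integral>x. \<phi> x \<partial>overlap_law n A \<beta>) * ?E (\<lambda>_. 1)) = ennreal (?E \<phi>)"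
    unfolding one using E[of "\<lambda>_. 1"] \<phi>(2) by (simp add: ennreal_mult)
  moreover have "(\<integral>x. \<phi> x \<partial>overlap_law n A \<beta>) * ?E (\<lambda>_. 1) \<ge> 0"
    using E[of "\<lambda>_. 1"] \<phi>(2) by simp
  ultimately show ?thesis
    using E[OF \<phi>] by (simp add: ennreal_inj)
qed

end

section \<open>Convergence of the overlap\<close>

text \<open>
  The squared norms and the inner product of a pair of tails.
\<close>

abbreviation tail_stats :: "nat \<Rightarrow> (nat \<Rightarrow> real) \<times> (nat \<Rightarrow> real) \<Rightarrow> real \<times> real \<times> real" where
  "tail_stats n y \<equiv> (tail_sq n (fst y), tail_sq n (snd y), tail_inner n (fst y) (snd y))"

lemma isCont_Psi:
  assumes \<phi>: "continuous_on UNIV \<phi>" "\<And>x. 0 \<le> \<phi> x" "\<And>x. \<phi> x \<le> 1" and k: "k \<ge> 0"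
    and a: "a < 1" "b < 1"
  shows "isCont (\<lambda>y. Psi \<phi> k (fst y) (fst (snd y)) (snd (snd y))) (a, b, x)"
  unfolding continuous_at_sequentially
proof (intro allI impI)
  fix u :: "nat \<Rightarrow> real \<times> real \<times> real" assume u: "u \<longlonglongrightarrow> (a, b, x)"
  have 1: "(\<lambda>n. fst (u n)) \<longlonglongrightarrow> a" and u2: "(\<lambda>n. snd (u n)) \<longlonglongrightarrow> (b, x)"
    using tendsto_fst[OF u] tendsto_snd[OF u] by simp_all
  have 2: "(\<lambda>n. fst (snd (u n))) \<longlonglongrightarrow> b" and 3: "(\<lambda>n. snd (snd (u n))) \<longlonglongrightarrow> x"
    using tendsto_fst[OF u2] tendsto_snd[OF u2] by simp_all
  show "((\<lambda>y. Psi \<phi> k (fst y) (fst (snd y)) (snd (snd y))) \<circ> u) \<longlonglongrightarrow>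
      Psi \<phi> k (fst (a, b, x)) (fst (snd (a, b, x))) (snd (snd (a, b, x)))"
    using Psi_tendsto[OF \<phi> k 1 2 3 a] by (simp add: comp_def)
qed

text \<open>
  The distance in quadratic mean of the squared norms and the inner product of two independent
  Gaussian tails from \<open>(a, a, 0)\<close>.
\<close>

lemma gauss_pair_second_moment_bound:
  fixes m :: real
  assumes s: "\<And>i. s i > 0" and m: "m = (\<Sum>i\<in>{2..<n}. (s i)\<^sup>2)"
  shows "(\<integral>\<^sup>+y. ennreal ((dist (tail_stats n y) (a, a, 0))\<^sup>2)
      \<partial>(gauss {2..<n} s \<Otimes>\<^sub>M gauss {2..<n} s))
    \<le> ennreal (9 * (\<Sum>i\<in>{2..<n}. (s i) ^ 4) + 4 * (m - a)\<^sup>2)"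
proof -
  let ?G = "gauss {2..<n} s" and ?S = "\<Sum>i\<in>{2..<n}. (s i) ^ 4"
  interpret G: prob_space ?G by (rule prob_space_gauss[OF s])
  let ?d = "\<lambda>v. 2 * (tail_sq n v - m)\<^sup>2 + 2 * (m - a)\<^sup>2"
  have S: "?S \<ge> 0" using s by (intro sum_nonneg) (simp add: less_imp_le)
  have sq: "(x - a)\<^sup>2 \<le> 2 * (x - m)\<^sup>2 + 2 * (m - a)\<^sup>2" for x :: real
  proof -
    have "0 \<le> ((x - m) - (m - a))\<^sup>2" by simp
    then show ?thesis by (simp add: power2_eq_square algebra_simps)
  qed
  have D: "ennreal ((dist (tail_stats n (v, w)) (a, a, 0))\<^sup>2)
      \<le> ennreal (?d v) + (ennreal (?d w) + ennreal ((tail_inner n v w)\<^sup>2))" for v w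
  proof -
    have "(dist (tail_stats n (v, w)) (a, a, 0))\<^sup>2
        = (tail_sq n v - a)\<^sup>2 + ((tail_sq n w - a)\<^sup>2 + (tail_inner n v w)\<^sup>2)"
      by (simp add: dist_prod_def dist_real_def)
    also have "\<dots> \<le> ?d v + (?d w + (tail_inner n v w)\<^sup>2)"
      by (intro add_mono sq order_refl)
    finally show ?thesis
      by (simp add: ennreal_plus[symmetric] del: ennreal_plus)
  qed
  have int_d: "(\<integral>\<^sup>+v. ennreal (?d v) \<partial>?G) = ennreal (4 * ?S + 2 * (m - a)\<^sup>2)"
  proof -
    have "(\<integral>\<^sup>+v. ennreal (?d v) \<partial>?G) = (\<integral>\<^sup>+v. 2 * ennreal ((tail_sq n v - m)\<^sup>2) + ennreal (2 * (m - a)\<^sup>2) \<partial>?G)"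
      by (intro nn_integral_cong) (simp add: ennreal_mult'')
    also have "\<dots> = 2 * (\<integral>\<^sup>+v. ennreal ((tail_sq n v - m)\<^sup>2) \<partial>?G) + ennreal (2 * (m - a)\<^sup>2)"
      by (subst nn_integral_add) (auto simp: nn_integral_cmult G.emeasure_space_1)
    also have "(\<integral>\<^sup>+v. ennreal ((tail_sq n v - m)\<^sup>2) \<partial>?G) = ennreal (2 * ?S)"
      unfolding tail_sq_def m by (rule gauss_norm_deviation[OF _ s]) simp
    also have "2 * ennreal (2 * ?S) + ennreal (2 * (m - a)\<^sup>2) = ennreal (4 * ?S + 2 * (m - a)\<^sup>2)"
      using S by (simp add: ennreal_mult'' mult.assoc[symmetric])
    finally show ?thesis .
  qed
  have "(\<integral>\<^sup>+y. ennreal ((dist (tail_stats n y) (a, a, 0))\<^sup>2)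
      \<partial>(?G \<Otimes>\<^sub>M ?G))
    = (\<integral>\<^sup>+v. \<integral>\<^sup>+w. ennreal ((dist (tail_stats n (v, w)) (a, a, 0))\<^sup>2)
      \<partial>?G \<partial>?G)"
    by (rule G.nn_integral_fst[symmetric]) (simp add: dist_prod_def dist_real_def)
  also have "\<dots> \<le> (\<integral>\<^sup>+v. \<integral>\<^sup>+w. ennreal (?d v) + (ennreal (?d w) + ennreal ((tail_inner n v w)\<^sup>2)) \<partial>?G \<partial>?G)"
    using D by (intro nn_integral_mono) simp
  also have "\<dots> = (\<integral>\<^sup>+v. ennreal (?d v) + (ennreal (4 * ?S + 2 * (m - a)\<^sup>2) + (\<integral>\<^sup>+w. ennreal ((tail_inner n v w)\<^sup>2) \<partial>?G)) \<partial>?G)"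
  proof (rule nn_integral_cong)
    fix v assume "v \<in> space ?G"
    then have [measurable]: "v \<in> space (Rtail n)"
      using sets_eq_imp_space_eq[OF sets_gauss[of "{2..<n}" s]] by simp
    show "(\<integral>\<^sup>+w. ennreal (?d v) + (ennreal (?d w) + ennreal ((tail_inner n v w)\<^sup>2)) \<partial>?G)
      = ennreal (?d v) + (ennreal (4 * ?S + 2 * (m - a)\<^sup>2) + (\<integral>\<^sup>+w. ennreal ((tail_inner n v w)\<^sup>2) \<partial>?G))"
      unfolding int_d[symmetric]
      by (subst nn_integral_add, measurable, subst nn_integral_add, measurable) (simp add: G.emeasure_space_1)
  qed
  also have "\<dots> = ennreal (4 * ?S + 2 * (m - a)\<^sup>2) + (ennreal (4 * ?S + 2 * (m - a)\<^sup>2)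
      + (\<integral>\<^sup>+v. \<integral>\<^sup>+w. ennreal ((tail_inner n v w)\<^sup>2) \<partial>?G \<partial>?G))"
    unfolding int_d[symmetric]
    by (subst nn_integral_add, measurable, subst nn_integral_add, measurable) (simp add: G.emeasure_space_1)
  also have "(\<integral>\<^sup>+v. \<integral>\<^sup>+w. ennreal ((tail_inner n v w)\<^sup>2) \<partial>?G \<partial>?G) = ennreal ?S"
    unfolding tail_inner_def by (rule gauss_inner_second_moment[OF _ s]) simp
  also have "ennreal (4 * ?S + 2 * (m - a)\<^sup>2) + (ennreal (4 * ?S + 2 * (m - a)\<^sup>2) + ennreal ?S)
      = ennreal (9 * ?S + 4 * (m - a)\<^sup>2)"
    using S by (simp add: ennreal_plus[symmetric] algebra_simps del: ennreal_plus)
  finally show ?thesis .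
qed

text \<open>
  The theorem for a single realization. By the moment bound the tail statistics converge to
  \<open>(a, a, 0)\<close> with \<open>a = 1 / (\<beta> J)\<close>, where \<open>Psi\<close> is continuous because \<open>a < 1\<close>. The expectations under
  the overlap law are quotients of Gaussian expectations of \<open>Psi\<close>, so they converge to the quotient
  of the values of \<open>Psi\<close> at this point.
\<close>

lemma overlap_law_weak_conv:
  fixes A :: "nat \<Rightarrow> real mat"
  assumes J: "J > 1" and \<beta>: "\<beta> > 0" and \<beta>J: "\<beta> * J > 1" and c: "c \<ge> 0"
    and carrier: "\<And>n. n \<ge> 2 \<Longrightarrow> A n \<in> carrier_mat n n"
    and sym: "\<And>n. n \<ge> 2 \<Longrightarrow> transpose_mat (A n) = A n"
    and eig1: "\<And>n. n \<ge> 2 \<Longrightarrow> eig (A n) 1 = J + 1 / J"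
    and eig2: "\<And>n. n \<ge> 2 \<Longrightarrow> eig (A n) 2 = eig (A n) 1 - c / real n"
    and conv: "weak_conv_m (\<lambda>n. empirical_measure n (A n)) semicircle"
    and q: "\<And>K. K \<ge> 1 \<Longrightarrow> sc_quantiles K (q K)" and rigid: "rigid q A"
  shows "weak_conv_m (\<lambda>n. overlap_law n (A n) \<beta>) (limit_law (1 - 1 / (\<beta> * J)) c \<beta>)"
proof -
  define z where "z = J + 1 / J"
  have z: "z > 2"
    unfolding z_def by (rule add_inverse_gt_2[OF J])
  define b where "b = (2 + z) / 2"
  have b: "2 < b" "b < z" using z by (auto simp: b_def)
  define a where "a = 1 / (\<beta> * J)"
  have a: "a < 1" using \<beta>J by (simp add: a_def)
  have cb: "c * \<beta> \<ge> 0" using c \<beta> by simp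
  then have k: "c * \<beta> / 2 \<ge> 0" by simp
  define d where "d n i = eig (A n) (Suc i)" for n i
  \<comment> \<open>the default value 1 only keeps \<open>s n i\<close> positive for indices outside \<open>{2..<n}\<close> and for
  small \<open>n\<close>\<close>
  define s where "s n i = (if z > d n i \<and> n > 0 then 1 / sqrt (\<beta> * real n * (z - d n i)) else 1)" for n i
  have s_pos: "s n i > 0" for n i using \<beta> by (simp add: s_def)
  \<comment> \<open>the dimensions, eventually all, for which the bulk is separated from the outliers\<close>
  define separated where "separated n \<longleftrightarrow> n \<ge> 3 \<and> (\<forall>j\<in>{3..n}. eig (A n) j \<le> b)" for n
  have bulk: "\<forall>\<^sub>F n in sequentially. \<forall>j\<in>{3..n}. eig (A n) j \<le> b"
    using carrier sym rigid q b(1) by (rule bulk_eigenvalues_le)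
  have separated_ev: "\<forall>\<^sub>F n in sequentially. separated n"
    using bulk eventually_ge_at_top[of 3] unfolding separated_def by eventually_elim simp
  have gap: "z - d n i \<ge> z - b" if "separated n" "i \<in> {2..<n}" for n i
    using that by (auto simp: separated_def d_def)
  have s_sq: "(s n i)\<^sup>2 = 1 / (\<beta> * real n * (z - d n i))" if "separated n" "i \<in> {2..<n}" for n i
  proof -
    have "z > d n i" "n > 0" using gap[OF that] b that by (auto simp: separated_def)
    then show ?thesis using \<beta> by (simp add: s_def power_divide)
  qed
  let ?G = "\<lambda>n. gauss {2..<n} (s n)"
  define E where "E \<phi> n = (\<integral>y. Psi_tail n \<phi> (c * \<beta> / 2) (fst y) (snd y)
      \<partial>(?G n \<Otimes>\<^sub>M ?G n))" for \<phi> n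
  have formula: "real_distribution (overlap_law n (A n) \<beta>) \<and>
      (\<forall>\<phi>. continuous_on UNIV \<phi> \<longrightarrow> (\<forall>x. 0 \<le> \<phi> x) \<longrightarrow> (\<forall>x. \<phi> x \<le> 1) \<longrightarrow>
        (\<integral>x. \<phi> x \<partial>overlap_law n (A n) \<beta>) * E (\<lambda>_. 1) n = E \<phi> n)" if g: "separated n" for n
  proof -
    have n: "n \<ge> 2" using g by (simp add: separated_def)
    obtain Q where Q: "orthogonal_n n Q" and
      AQ: "\<And>i j. i < n \<Longrightarrow> j < n \<Longrightarrow> A n $$ (i, j) = (\<Sum>k<n. eig (A n) (Suc k) * Q i k * Q j k)"
      by (rule eig_orthogonal_decomposition[OF carrier[OF n] sym[OF n]]) (rule that; assumption)
    have AQ': "A n $$ (i, j) = (\<Sum>k<n. d n k * Q i k * Q j k)" if "i < n" "j < n" for i j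
      unfolding d_def by (rule AQ[OF that])
    have d0: "d n 0 = z" using eig1[OF n] by (simp add: d_def z_def)
    have d1: "d n 1 = d n 0 - c / real n"
      using eig2[OF n] by (simp add: d_def numeral_2_eq_2)
    have s2: "1 / (s n i)\<^sup>2 = \<beta> * real n * (d n 0 - d n i)" if "i \<in> {2..<n}" for i
      unfolding d0 s_sq[OF g that] by simp
    note prems = n \<beta> c Q AQ' d1 s_pos s2
    show ?thesis
    proof (intro conjI allI impI)
      show "real_distribution (overlap_law n (A n) \<beta>)"
        by (rule real_distribution_overlap_law[of n \<beta> c Q "A n" "d n" "s n"]) (fact prems)+
      fix \<phi> :: "real \<Rightarrow> real"
      assume "continuous_on UNIV \<phi>" "\<forall>x. 0 \<le> \<phi> x" "\<forall>x. \<phi> x \<le> 1"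
      then have \<phi>: "continuous_on UNIV \<phi>" "\<And>x. 0 \<le> \<phi> x" "\<And>x. \<phi> x \<le> 1" by auto
      show "(\<integral>x. \<phi> x \<partial>overlap_law n (A n) \<beta>) * E (\<lambda>_. 1) n = E \<phi> n"
        unfolding E_def
        by (rule expectation_overlap_law[of n \<beta> c Q "A n" "d n" "s n"]) (fact prems \<phi>)+
    qed
  qed
  define m where "m n = (\<Sum>i\<in>{2..<n}. (s n i)\<^sup>2)" for n
  define S where "S n = (\<Sum>i\<in>{2..<n}. (s n i) ^ 4)" for n
  have m_lim: "m \<longlonglongrightarrow> a"
  proof -
    have "(\<lambda>n. (\<Sum>j\<in>{3..n}. 1 / (J + 1 / J - eig (A n) j)) / real n) \<longlonglongrightarrow> 1 / J"
      using carrier sym rigid q conv J by (rule bulk_resolvent_sum)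
    then have "(\<lambda>n. 1 / \<beta> * ((\<Sum>j\<in>{3..n}. 1 / (J + 1 / J - eig (A n) j)) / real n)) \<longlonglongrightarrow> 1 / \<beta> * (1 / J)"
      by (intro tendsto_mult tendsto_const)
    then have "(\<lambda>n. 1 / \<beta> * ((\<Sum>j\<in>{3..n}. 1 / (J + 1 / J - eig (A n) j)) / real n)) \<longlonglongrightarrow> a"
      by (simp add: a_def)
    moreover have "\<forall>\<^sub>F n in sequentially. 1 / \<beta> * ((\<Sum>j\<in>{3..n}. 1 / (J + 1 / J - eig (A n) j)) / real n) = m n"
      using separated_ev
    proof eventually_elim
      case (elim n)
      have "(\<Sum>j\<in>{3..n}. 1 / (J + 1 / J - eig (A n) j)) = (\<Sum>i\<in>{2..<n}. 1 / (z - d n i))"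
        by (rule sum.reindex_bij_witness[of _ Suc "\<lambda>j. j - 1"]) (auto simp: d_def z_def)
      then have "1 / \<beta> * ((\<Sum>j\<in>{3..n}. 1 / (J + 1 / J - eig (A n) j)) / real n)
          = (\<Sum>i\<in>{2..<n}. 1 / \<beta> * (1 / (z - d n i) / real n))"
        by (simp only: sum_distrib_left sum_divide_distrib)
      also have "\<dots> = m n"
        unfolding m_def by (intro sum.cong refl) (simp add: s_sq[OF elim] mult_ac)
      finally show ?case .
    qed
    ultimately show ?thesis by (rule Lim_transform_eventually)
  qed
  have S_lim: "S \<longlonglongrightarrow> 0"
  proof (rule Lim_null_comparison)
    show "(\<lambda>n. (1 / (\<beta> * (z - b)))\<^sup>2 * (1 / real n)) \<longlonglongrightarrow> 0"
      by (rule tendsto_mult_right_zero[OF lim_1_over_n])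
    show "\<forall>\<^sub>F n in sequentially. norm (S n) \<le> (1 / (\<beta> * (z - b)))\<^sup>2 * (1 / real n)"
      using separated_ev
    proof eventually_elim
      case (elim n)
      have n0: "real n > 0" using elim by (simp add: separated_def)
      have "(s n i) ^ 4 \<le> (1 / (\<beta> * real n * (z - b)))\<^sup>2" if i: "i \<in> {2..<n}" for i
      proof -
        have "(s n i)\<^sup>2 \<le> 1 / (\<beta> * real n * (z - b))"
          unfolding s_sq[OF elim i] using gap[OF elim i] b \<beta> n0
          by (intro divide_left_mono mult_left_mono mult_pos_pos) auto
        then have "((s n i)\<^sup>2)\<^sup>2 \<le> (1 / (\<beta> * real n * (z - b)))\<^sup>2"
          by (intro power_mono) auto
        then show ?thesis by (simp flip: power_mult)
      qed
      then have "S n \<le> real (card {2..<n}) * (1 / (\<beta> * real n * (z - b)))\<^sup>2"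
        unfolding S_def by (intro sum_bounded_above) 
      also have "\<dots> \<le> real n * (1 / (\<beta> * real n * (z - b)))\<^sup>2"
        by (intro mult_right_mono) auto
      also have "\<dots> = (1 / (\<beta> * (z - b)))\<^sup>2 * (1 / real n)"
        using n0 by (simp add: power2_eq_square)
      finally show ?case
        using s_pos by (simp add: S_def sum_nonneg less_imp_le)
    qed
  qed
  have L2: "(\<lambda>n. \<integral>\<^sup>+y. ennreal ((dist (tail_stats n y) (a, a, 0))\<^sup>2)
      \<partial>(?G n \<Otimes>\<^sub>M ?G n)) \<longlonglongrightarrow> 0"
  proof (rule tendsto_sandwich[OF _ _ tendsto_const])
    show "\<forall>\<^sub>F n in sequentially. (\<integral>\<^sup>+y. ennreal ((dist (tail_stats n y) (a, a, 0))\<^sup>2)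
      \<partial>(?G n \<Otimes>\<^sub>M ?G n)) \<le> ennreal (9 * S n + 4 * (m n - a)\<^sup>2)"
      unfolding S_def by (intro always_eventually allI gauss_pair_second_moment_bound s_pos m_def)
    have "(\<lambda>n. 9 * S n + 4 * (m n - a)\<^sup>2) \<longlonglongrightarrow> 9 * 0 + 4 * (a - a)\<^sup>2"
      by (intro tendsto_intros S_lim m_lim)
    then have "(\<lambda>n. ennreal (9 * S n + 4 * (m n - a)\<^sup>2)) \<longlonglongrightarrow> ennreal 0"
      by (intro tendsto_ennrealI) simp
    then show "(\<lambda>n. ennreal (9 * S n + 4 * (m n - a)\<^sup>2)) \<longlonglongrightarrow> 0" by simp
  qed simp
  have E_lim: "E \<phi> \<longlonglongrightarrow> Psi \<phi> (c * \<beta> / 2) a a 0"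
    if \<phi>: "continuous_on UNIV \<phi>" "\<And>x. 0 \<le> \<phi> x" "\<And>x. \<phi> x \<le> 1" for \<phi> :: "real \<Rightarrow> real"
  proof -
    have \<phi>_m: "\<phi> \<in> borel_measurable borel"
      using \<phi>(1) by (rule borel_measurable_continuous_onI)
    let ?h = "\<lambda>y. Psi \<phi> (c * \<beta> / 2) (fst y) (fst (snd y)) (snd (snd y))"
    let ?Y = "\<lambda>n y. (tail_stats n y)"
    have "(\<lambda>n. \<integral>y. ?h (?Y n y) \<partial>(?G n \<Otimes>\<^sub>M ?G n)) \<longlonglongrightarrow> ?h (a, a, 0)"
    proof (rule tendsto_expectation_of_L2)
      show "prob_space (?G n \<Otimes>\<^sub>M ?G n)" for n
      proof -
        interpret G: prob_space "?G n" by (rule prob_space_gauss[OF s_pos])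
        interpret GG: pair_prob_space "?G n" "?G n" ..
        show ?thesis by unfold_locales
      qed
      show "?Y n \<in> borel_measurable (?G n \<Otimes>\<^sub>M ?G n)" for n
        by measurable
      show "?h \<in> borel_measurable borel"
        by (intro measurable_Psi \<phi>_m borel_measurable_continuous_onI continuous_intros)
      show "\<bar>?h y\<bar> \<le> 16 * measure (arcsine \<Otimes>\<^sub>M arcsine) UNIV" for y
        using Psi_le[OF \<phi> k] Psi_nonneg[OF \<phi> k] by simp
      show "isCont ?h (a, a, 0)"
        by (rule isCont_Psi[OF \<phi> k a a])
      show "(\<lambda>n. \<integral>\<^sup>+y. ennreal ((dist (?Y n y) (a, a, 0))\<^sup>2) \<partial>(?G n \<Otimes>\<^sub>M ?G n)) \<longlonglongrightarrow> 0"
        by (rule L2)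
    qed
    then show ?thesis by (simp add: E_def[abs_def])
  qed
  let ?L = "limit_law (1 - a) c \<beta>"
  interpret L: real_distribution ?L
    by (rule real_distribution_limit_law) (use a cb in auto)
  define w where "w = 16 * (s_mass (1 - a) c \<beta>)\<^sup>2"
  have w: "w > 0" using s_mass_nn_integral(1)[of "1 - a" c \<beta>] a cb by (simp add: w_def)
  have Psi_w: "Psi \<phi> (c * \<beta> / 2) a a 0 = w * (\<integral>x. \<phi> x \<partial>?L)"
    if \<phi>: "continuous_on UNIV \<phi>" "\<And>x. 0 \<le> \<phi> x" "\<And>x. \<phi> x \<le> 1" for \<phi> :: "real \<Rightarrow> real"
    unfolding w_def by (rule Psi_eq_limit_law[OF \<phi> a cb])
  have E1_lim: "E (\<lambda>_. 1) \<longlonglongrightarrow> w"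
    using E_lim[of "\<lambda>_. 1"] Psi_w[of "\<lambda>_. 1"] L.prob_space by simp
  have main: "(\<lambda>n. \<integral>x. \<phi> x \<partial>overlap_law n (A n) \<beta>) \<longlonglongrightarrow> (\<integral>x. \<phi> x \<partial>?L)"
    if \<phi>: "continuous_on UNIV \<phi>" "\<And>x. 0 \<le> \<phi> x" "\<And>x. \<phi> x \<le> 1" for \<phi> :: "real \<Rightarrow> real"
  proof (rule Lim_transform_eventually)
    have "(\<lambda>n. E \<phi> n / E (\<lambda>_. 1) n) \<longlonglongrightarrow> w * (\<integral>x. \<phi> x \<partial>?L) / w"
      using E_lim[OF \<phi>] E1_lim w unfolding Psi_w[OF \<phi>] by (intro tendsto_divide) auto
    then show "(\<lambda>n. E \<phi> n / E (\<lambda>_. 1) n) \<longlonglongrightarrow> (\<integral>x. \<phi> x \<partial>?L)" using w by simp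
    have "\<forall>\<^sub>F n in sequentially. E (\<lambda>_. 1) n > 0"
      using E1_lim w by (rule order_tendstoD(1))
    then show "\<forall>\<^sub>F n in sequentially. E \<phi> n / E (\<lambda>_. 1) n = (\<integral>x. \<phi> x \<partial>overlap_law n (A n) \<beta>)"
      using separated_ev
    proof eventually_elim
      case (elim n)
      then have "(\<integral>x. \<phi> x \<partial>overlap_law n (A n) \<beta>) * E (\<lambda>_. 1) n = E \<phi> n"
        using formula \<phi> by blast
      then show ?case using elim(1) by (simp add: field_simps)
    qed
  qed
  \<comment> \<open>the criterion for weak convergence needs probability measures for every \<open>n\<close>\<close>
  define M where "M n = (if separated n then overlap_law n (A n) \<beta> else ?L)" for n
  have M_eq: "\<forall>\<^sub>F n in sequentially. overlap_law n (A n) \<beta> = M n"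
    using separated_ev by eventually_elim (simp add: M_def)
  have "weak_conv_m M ?L"
  proof (rule integral_cts_step_conv_imp_weak_conv)
    show "real_distribution (M n)" for n
      using formula[of n] L.real_distribution_axioms by (simp add: M_def)
    show "real_distribution ?L" by (rule L.real_distribution_axioms)
    fix x y :: real assume xy: "x < y"
    have "(\<lambda>n. \<integral>t. cts_step x y t \<partial>overlap_law n (A n) \<beta>) \<longlonglongrightarrow> (\<integral>t. cts_step x y t \<partial>?L)"
    proof (rule main)
      show "continuous_on UNIV (cts_step x y)"
        by (rule uniformly_continuous_imp_continuous[OF cts_step_uniformly_continuous[OF xy]])
      show "0 \<le> cts_step x y t" "cts_step x y t \<le> 1" for t
        using xy by (auto simp: cts_step_def)
    qed
    then show "(\<lambda>n. \<integral>t. cts_step x y t \<partial>M n) \<longlonglongrightarrow> (\<integral>t. cts_step x y t \<partial>?L)"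
      by (rule Lim_transform_eventually) (use M_eq in eventually_elim, simp)
  qed
  then show ?thesis
    unfolding weak_conv_m_def weak_conv_def a_def[symmetric]
  proof (intro allI impI)
    fix x
    assume "\<forall>x. isCont (cdf ?L) x \<longrightarrow> (\<lambda>n. cdf (M n) x) \<longlonglongrightarrow> cdf ?L x" and "isCont (cdf ?L) x"
    then have "(\<lambda>n. cdf (M n) x) \<longlonglongrightarrow> cdf ?L x" by blast
    then show "(\<lambda>n. cdf (overlap_law n (A n) \<beta>) x) \<longlonglongrightarrow> cdf ?L x"
      by (rule Lim_transform_eventually) (use M_eq in eventually_elim, simp)
  qed
qed

theorem theorem2:
  fixes M :: "'w measure" and X :: "nat \<Rightarrow> 'w \<Rightarrow> real mat"
    and J \<beta> c :: real and q :: "nat \<Rightarrow> nat \<Rightarrow> real"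
  assumes "J > 1" and "\<beta> > 0" and "\<beta> * J > 1" and "c \<ge> 0"
    and "prob_space M"
    and "\<And>n \<omega>. n \<ge> 2 \<Longrightarrow> \<omega> \<in> space M \<Longrightarrow> X n \<omega> \<in> carrier_mat n n"
    and "\<And>n \<omega>. n \<ge> 2 \<Longrightarrow> \<omega> \<in> space M \<Longrightarrow> transpose_mat (X n \<omega>) = X n \<omega>"
    and "\<And>n i j. n \<ge> 2 \<Longrightarrow> i < n \<Longrightarrow> j < n \<Longrightarrow> (\<lambda>\<omega>. X n \<omega> $$ (i, j)) \<in> borel_measurable M"
    and "AE \<omega> in M. \<forall>n\<ge>2. eig (X n \<omega>) 1 = J + 1 / J"
    and "AE \<omega> in M. \<forall>n\<ge>2. eig (X n \<omega>) 2 = eig (X n \<omega>) 1 - c / real n"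
    and "AE \<omega> in M. weak_conv_m (\<lambda>n. empirical_measure n (X n \<omega>)) semicircle"
    and "\<And>K. K \<ge> 1 \<Longrightarrow> sc_quantiles K (q K)"
    and "AE \<omega> in M. rigid q (\<lambda>n. X n \<omega>)"
  shows "AE \<omega> in M. weak_conv_m (\<lambda>n. overlap_law n (X n \<omega>) \<beta>) (limit_law (1 - 1 / (\<beta> * J)) c \<beta>)"
  using assms(9,10,11,13) AE_space
proof eventually_elim
  case (elim \<omega>)
  show ?case
  proof (rule overlap_law_weak_conv[where A = "\<lambda>n. X n \<omega>" and q = q])
    show "X n \<omega> \<in> carrier_mat n n" if "n \<ge> 2" for n
      using assms(6)[OF that elim(5)] .
    show "transpose_mat (X n \<omega>) = X n \<omega>" if "n \<ge> 2" for n
      using assms(7)[OF that elim(5)] .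
    show "eig (X n \<omega>) 1 = J + 1 / J" "eig (X n \<omega>) 2 = eig (X n \<omega>) 1 - c / real n" if "n \<ge> 2" for n
      using elim(1,2) that by auto
    show "sc_quantiles K (q K)" if "K \<ge> 1" for K
      using assms(12)[OF that] .
  qed (use assms(1-4) elim(3,4) in auto)
qed

end
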